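(* Let $M\ge 0$ be an integer, let $k_1<k_2<\dots<k_M$ be positive integers, and let $\mathcal K=\{k_1,\dots,k_M\}$ (so $\mathcal K=\emptyset$ if $M=0$). Let $f\in H^1_{\mathcal K}$ be a function with $\|f\|_1=1$ whose canonical factorization is $f=IF$, with $I$ inner and $F$ outer. Then $f$ is an extreme point of $\mathrm{ball}(H^1_{\mathcal K})$ if and only if the following two conditions hold: (a) $I$ is a finite Blaschke product, with $m:=\deg I$ not exceeding $M=\#\mathcal K$. (b) The matrix $\mathfrak M=\mathfrak M_{\mathcal K}\left(F,\{a_j\}_{j=1}^m\right)$, built (as described in the context) from $F$ and the zeros $\{a_j\}_{j=1}^m$ of $I$, has rank $2m$.
   Context: Let $\mathbb T=\{\zeta\in\mathbb C:|\zeta|=1\}$ with normalized arc length measure and $\mathbb D=\{z\in\mathbb C:|z|<1\}$. $L^p=L^p(\mathbb T)$ consists of complex-valued functions, and $\|f\|_1=\frac1{2\pi}\int_{\mathbb T}|f(\zeta)|\,|d\zeta|$. For $f\in L^1$, the Fourier coefficients are $\widehat f(k)=\frac1{2\pi}\int_{\mathbb T}\overline\zeta^{\,k}f(\zeta)\,|d\zeta|$, $k\in\mathbb Z$. The Hardy space is $H^1=\{f\in L^1:\widehat f(k)=0\text{ for all }k<0\}$ with norm $\|\cdot\|_1$; its elements are also regarded as holomorphic functions on $\mathbb D$ via Poisson integrals. The punctured Hardy space is $$H^1_{\mathcal K}=\{f\in H^1:\widehat f(k)=0\text{ for all }k\in\mathcal K\},$$ with norm $\|\cdot\|_1$ (so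 $H^1_\emptyset=H^1$). For a Banach space $X$, $\mathrm{ball}(X)=\{x\in X:\|x\|\le1\}$. A point of $\mathrm{ball}(X)$ is extreme if it is not the midpoint of any nondegenerate line segment contained in $\mathrm{ball}(X)$. A function $I\in H^\infty:=H^1\cap L^\infty$ is inner if $|I|=1$ a.e. on $\mathbb T$. A non-null $F\in H^1$ is outer if $\log|F(0)|=\frac1{2\pi}\int_{\mathbb T}\log|F(\zeta)|\,|d\zeta|$. Every $f\in H^1$, $f\not\equiv0$, factors as $f=IF$ with $I$ inner and $F$ outer, uniquely up to a multiplicative constant of modulus 1 (canonical factorization). A finite Blaschke product of degree $m\in\{0,1,2,\dots\}$ is a function $z\mapsto c\prod_{j=1}^m\frac{z-a_j}{1-\overline a_jz}$ with $a_1,\dots,a_m\in\mathbb D$ (not necessarily distinct) and $|c|=1$; for $m=0$ it is the constant $c$. When $I$ is a finite Blaschke product, the factorization $f=IF$ is normalized so that $c=1$, i.e. $I(z)=\prod_{j=1}^m\frac{z-a_j}{1-\overline a_jz}$; the zeros $a_1,\dots,a_m$ are listed with multiplicity. Construction of $\mathfrak M$. Let $$F_0(z)=F(z)\prod_{j=1}^m(1-\overline a_jz)^{-2},\qquad C_k=\widehat F_0(k),\quad A(k)=\mathrm{Re}\,C_k,\quad B(k)=\mathrm{Im}\,C_k\quad(k\in\mathbb Z)$$ (so $C_k=0$ for $k<0$). For $j=1,\dots,M$ and $l=0,\dots,m$ put $$A^+_{j,l}=A(k_j+l-m)+A(k_j-l-m),\qquad B^+_{j,l}=B(k_j+l-m)+B(k_j-l-m),$$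 $$A^-_{j,l}=A(k_j+l-m)-A(k_j-l-m),\qquad B^-_{j,l}=B(k_j+l-m)-B(k_j-l-m).$$ Let $\mathcal A^+=\{A^+_{j,l}\}$ and $\mathcal B^+=\{B^+_{j,l}\}$ be the $M\times(m+1)$ matrices with row index $j=1,\dots,M$ and column index $l=0,\dots,m$, and let $\mathcal A^-=\{A^-_{j,l}\}$ and $\mathcal B^-=\{B^-_{j,l}\}$ be the $M\times m$ matrices with row index $j=1,\dots,M$ and column index $l=1,\dots,m$. Then $$\mathfrak M=\mathfrak M_{\mathcal K}\left(F,\{a_j\}_{j=1}^m\right)=\begin{pmatrix}\mathcal A^+&\mathcal B^-\\ \mathcal B^+&-\mathcal A^-\end{pmatrix},$$ a real matrix with $2M$ rows and $2m+1$ columns. (If $m=0$, the blocks $\mathcal A^-,\mathcal B^-$ are absent. If $M=0$, condition (b) is void.) *)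

theory Defs
  imports "HOL-Analysis.Analysis" "Jordan_Normal_Form.DL_Rank"
begin

text \<open>Elements of \<open>L\<^sup>1\<close> of the unit circle are represented by measurable functions on the circle;
  equality in \<open>L\<^sup>1\<close> is equality almost everywhere. Values off the circle play no role,
  since the space of the measure is the circle itself.\<close>

definition circle_measure :: "complex measure" where
  "circle_measure =
     distr (uniform_measure lborel {0..<2 * pi}) (restrict_space borel (sphere 0 1)) cis"

definition L1_norm :: "(complex \<Rightarrow> complex) \<Rightarrow> real" where
  "L1_norm f = (LINT \<zeta>|circle_measure. norm (f \<zeta>))"

definition fourier_coeff :: "(complex \<Rightarrow> complex) \<Rightarrow> int \<Rightarrow> complex" where
  "fourier_coeff f k = (LINT \<zeta>|circle_measure. (cnj \<zeta> powi k) * f \<zeta>)"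

definition hardy_H1 :: "(complex \<Rightarrow> complex) set" where
  "hardy_H1 = {f. integrable circle_measure f \<and> (\<forall>k<0. fourier_coeff f k = 0)}"

definition punctured_H1 :: "int set \<Rightarrow> (complex \<Rightarrow> complex) set" where
  "punctured_H1 K = {f \<in> hardy_H1. \<forall>k\<in>K. fourier_coeff f k = 0}"

definition L1_ball :: "(complex \<Rightarrow> complex) set \<Rightarrow> (complex \<Rightarrow> complex) set" where
  "L1_ball X = {f \<in> X. L1_norm f \<le> 1}"

text \<open>Extreme points, with points identified when they agree almost everywhere: \<open>f\<close> is not the
  midpoint of a nondegenerate segment \<open>[g, h]\<close> contained in \<open>S\<close>.\<close>

definition L1_extreme_point :: "(complex \<Rightarrow> complex) \<Rightarrow> (complex \<Rightarrow> complex) set \<Rightarrow> bool" where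
  "L1_extreme_point f S \<longleftrightarrow> f \<in> S \<and>
     \<not> (\<exists>g h. \<not> (AE \<zeta> in circle_measure. g \<zeta> = h \<zeta>) \<and>
            (\<forall>t\<in>{0..1::real}. (\<lambda>\<zeta>. of_real (1 - t) * g \<zeta> + of_real t * h \<zeta>) \<in> S) \<and>
            (AE \<zeta> in circle_measure. f \<zeta> = (g \<zeta> + h \<zeta>) / 2))"

definition poisson_ext :: "(complex \<Rightarrow> complex) \<Rightarrow> complex \<Rightarrow> complex" where
  "poisson_ext f z =
     (LINT \<zeta>|circle_measure. of_real ((1 - (norm z)\<^sup>2) / (norm (\<zeta> - z))\<^sup>2) * f \<zeta>)"

definition inner_function :: "(complex \<Rightarrow> complex) \<Rightarrow> bool" where
  "inner_function I \<longleftrightarrow> I \<in> hardy_H1 \<and>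
     (\<exists>C. AE \<zeta> in circle_measure. norm (I \<zeta>) \<le> C) \<and>
     (AE \<zeta> in circle_measure. norm (I \<zeta>) = 1)"

text \<open>For non-null \<open>F\<close> in \<open>H\<^sup>1\<close> the integral of \<open>log |F|\<close> is finite, so the defining equation
  of an outer function forces \<open>F(0) \<noteq> 0\<close>. Both facts are stated explicitly because
  \<open>ln 0 = 0\<close> and the integral of a non-integrable function is \<open>0\<close> here.\<close>

definition outer_function :: "(complex \<Rightarrow> complex) \<Rightarrow> bool" where
  "outer_function F \<longleftrightarrow> F \<in> hardy_H1 \<and>
     \<not> (AE \<zeta> in circle_measure. F \<zeta> = 0) \<and>
     poisson_ext F 0 \<noteq> 0 \<and>
     integrable circle_measure (\<lambda>\<zeta>. ln (norm (F \<zeta>))) \<and>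
     ln (norm (poisson_ext F 0)) = (LINT \<zeta>|circle_measure. ln (norm (F \<zeta>)))"

definition canonical_factorization ::
  "(complex \<Rightarrow> complex) \<Rightarrow> (complex \<Rightarrow> complex) \<Rightarrow> (complex \<Rightarrow> complex) \<Rightarrow> bool" where
  "canonical_factorization f I F \<longleftrightarrow> inner_function I \<and> outer_function F \<and>
     (AE \<zeta> in circle_measure. f \<zeta> = I \<zeta> * F \<zeta>)"

definition blaschke :: "complex \<Rightarrow> nat \<Rightarrow> (nat \<Rightarrow> complex) \<Rightarrow> complex \<Rightarrow> complex" where
  "blaschke c m a z = c * (\<Prod>j = 1..m. (z - a j) / (1 - cnj (a j) * z))"

text \<open>\<open>c\<close>, \<open>m\<close>, \<open>a\<close> represent \<open>I\<close> as a finite Blaschke product of degree \<open>m\<close> with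
  zeros \<open>a 1, \<dots>, a m\<close>, listed with multiplicity.\<close>

definition is_blaschke_rep ::
  "(complex \<Rightarrow> complex) \<Rightarrow> complex \<Rightarrow> nat \<Rightarrow> (nat \<Rightarrow> complex) \<Rightarrow> bool" where
  "is_blaschke_rep I c m a \<longleftrightarrow> norm c = 1 \<and> (\<forall>j\<in>{1..m}. norm (a j) < 1) \<and>
     (AE \<zeta> in circle_measure. I \<zeta> = blaschke c m a \<zeta>)"

definition F0 :: "(complex \<Rightarrow> complex) \<Rightarrow> nat \<Rightarrow> (nat \<Rightarrow> complex) \<Rightarrow> complex \<Rightarrow> complex" where
  "F0 F m a z = F z * (\<Prod>j = 1..m. (1 - cnj (a j) * z) powi (-2))"

text \<open>Matrix rows and columns are numbered from \<open>0\<close>: row \<open>r\<close> of each block belongs to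
  \<open>j = r + 1\<close>; column \<open>s\<close> belongs to \<open>l = s\<close> in the plus blocks and to \<open>l = s + 1\<close> in the
  minus blocks.\<close>

definition frakM ::
  "nat \<Rightarrow> (nat \<Rightarrow> int) \<Rightarrow> (complex \<Rightarrow> complex) \<Rightarrow> nat \<Rightarrow> (nat \<Rightarrow> complex) \<Rightarrow> real mat" where
  "frakM M k F m a =
    (let C = fourier_coeff (F0 F m a);
         A = (\<lambda>i. Re (C i));
         B = (\<lambda>i. Im (C i));
         plus = (\<lambda>X. mat M (m + 1) (\<lambda>(r, s).
           X (k (r + 1) + int s - int m) + X (k (r + 1) - int s - int m)));
         minus = (\<lambda>X. mat M m (\<lambda>(r, s).
           X (k (r + 1) + int (s + 1) - int m) - X (k (r + 1) - int (s + 1) - int m)))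
     in four_block_mat (plus A) (minus B) (plus B) (- minus A))"

end

theory Submission
  imports Defs "HOL-Computational_Algebra.Fundamental_Theorem_Algebra" "Jordan_Normal_Form.Matrix_Kernel"
begin

text \<open>
  Write \<open>X\<close> for the punctured Hardy space. Since \<open>f\<close> is nonzero almost everywhere, equality in the
  triangle inequality shows that \<open>f\<close> is an extreme point of the unit ball of \<open>X\<close> if and only if every
  bounded real function \<open>h\<close> with \<open>h f \<in> X\<close> is constant (\<open>L1_extreme_point_imp_multiplier_const\<close>,
  \<open>L1_extreme_pointI\<close>). The theorem is the description of these multipliers \<open>h\<close>.

  Let \<open>f = I F\<close>, where \<open>I\<close> is a Blaschke product of degree \<open>m\<close>, and let \<open>D\<close> be the product of its
  denominators \<open>1 - cnj (a j) z\<close>. On the circle \<open>I = z ^ m cnj D / D\<close>, hence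
  \<open>h f = z ^ m (h |D|\<^sup>2) F0\<close> with \<open>F0 = F / D\<^sup>2\<close>. Multiplying by \<open>D\<^sup>2\<close> gives an element of \<open>H\<^sup>1\<close> whose
  quotient by the outer function \<open>F\<close> is the bounded function \<open>z ^ m (h |D|\<^sup>2)\<close>. By the theorem of
  Smirnov (\<open>Smirnov\<close>) that quotient lies in \<open>H\<^sup>1\<close>, so the real function \<open>h |D|\<^sup>2\<close> has no frequency
  below \<open>- m\<close>, and by symmetry none above \<open>m\<close>. It is a real trigonometric polynomial with \<open>2 m + 1\<close>
  real parameters. The matrix maps these parameters to the real and imaginary parts of the
  coefficients of \<open>h f\<close> at the punctures (\<open>frakM_mult_vec\<close>). Its kernel is therefore a copy of the
  space of multipliers and contains the vector of \<open>h = 1\<close>; only the constants are multipliers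
  exactly when the kernel is a line, that is, when the rank is \<open>2 m\<close>
  (\<open>frakM_rank_iff_multipliers_const\<close>). Such a rank forces \<open>m \<le> M\<close>, as there are \<open>2 M\<close> rows.

  It remains to see that an extreme \<open>f\<close> has a finite Blaschke product as inner factor. The backward
  shifts \<open>g\<^sub>n\<close> of \<open>I\<close> satisfy \<open>I cnj g\<^sub>n \<in> H\<^sup>1\<close>, so that the real part of any combination of them
  multiplies \<open>f\<close> into \<open>H\<^sup>1\<close>. Among combinations of \<open>M + 1\<close> of them some nontrivial one also satisfies
  the \<open>2 M\<close> real conditions at the punctures. If its real part is constant, then \<open>I\<close> is a quotient
  of polynomials (\<open>multipliers_const_imp_blaschke\<close>), and a rational inner function is a finite
  Blaschke product (\<open>rational_inner_imp_blaschke\<close>).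

  The Hardy space theory rests on one fact, the density of trigonometric polynomials in \<open>L\<^sup>1\<close>. In
  particular, outer functions are handled through their definition by the mean of \<open>ln |F|\<close>: if \<open>P\<close>
  is a polynomial whose real part is close to \<open>ln |F|\<close>, then \<open>exp (- P) F\<close> has modulus close to \<open>1\<close>,
  and it has mean close to \<open>1\<close> after a rotation, which makes it close to \<open>1\<close> in \<open>L\<^sup>1\<close>
  (\<open>outer_function_exp_approx\<close>). Thus \<open>1\<close> is a limit of analytic multiples of \<open>F\<close>, and Smirnov's
  theorem follows.\<close>

section \<open>Integration over the unit circle\<close>

lemma space_circle_measure [simp]: "space circle_measure = sphere 0 1"
  by (simp add: circle_measure_def space_restrict_space)

lemma sets_circle_measure [measurable_cong]:
  "sets circle_measure = sets (restrict_space borel (sphere 0 1))"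
  by (simp add: circle_measure_def)

lemma cis_measurable_circle:
  "cis \<in> uniform_measure lborel {0..<2 * pi} \<rightarrow>\<^sub>M restrict_space borel (sphere 0 1)"
proof (rule measurable_restrict_space2)
  have "cis \<in> borel_measurable borel"
    by (intro borel_measurable_continuous_onI continuous_intros)
  then show "cis \<in> borel_measurable (uniform_measure lborel {0..<2 * pi})"
    by simp
qed auto

lemma emeasure_circle_space: "emeasure circle_measure (sphere 0 1) = 1"
proof -
  have "emeasure circle_measure (sphere 0 1) =
        emeasure (uniform_measure lborel {0..<2 * pi}) (space (uniform_measure lborel {0..<2 * pi}))"
    unfolding circle_measure_def
    by (subst emeasure_distr[OF cis_measurable_circle])
       (auto simp: sets_restrict_space vimage_def)
  also have "\<dots> = 1"
    by (subst emeasure_uniform_measure) (auto simp: ennreal_divide_self)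
  finally show ?thesis .
qed

interpretation circle: finite_measure circle_measure
  by standard (simp add: emeasure_circle_space)

lemma measure_circle_space [simp]: "measure circle_measure (sphere 0 1) = 1"
  by (simp add: measure_def emeasure_circle_space)

lemma AE_circle_False: "\<not> (AE z in circle_measure. False)"
  using emeasure_circle_space ae_filter_eq_bot_iff[of circle_measure]
  by (simp add: trivial_limit_def)

lemma AE_circle_obtain:
  assumes "AE z in circle_measure. P z"
  obtains z where "P z"
  using AE_circle_False eventually_mono[OF assms, of "\<lambda>_. False"] by blast

lemma AE_circle_unit: "AE z in circle_measure. norm z = 1"
  by (rule AE_I2) simp

lemma continuous_on_circle_measurable:
  fixes f :: "complex \<Rightarrow> 'b :: topological_space"
  assumes "continuous_on (sphere 0 1) f"
  shows "f \<in> borel_measurable circle_measure"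
  using borel_measurable_continuous_on_restrict[OF assms]
  by (simp cong: measurable_cong_sets add: sets_circle_measure)

lemma continuous_on_circle_integrable:
  fixes f :: "complex \<Rightarrow> 'b :: {banach, second_countable_topology}"
  assumes "continuous_on (sphere 0 1) f"
  shows "integrable circle_measure f"
proof -
  have "bounded (f ` sphere 0 1)"
    by (intro compact_imp_bounded compact_continuous_image assms compact_sphere)
  then obtain C where "\<forall>z\<in>sphere 0 1. norm (f z) \<le> C"
    by (auto simp: bounded_iff)
  then show ?thesis
    by (intro circle.integrable_const_bound[of _ C] AE_I2 continuous_on_circle_measurable assms) auto
qed

lemma continuous_on_circle_powi:
  "continuous_on (sphere 0 1) f \<Longrightarrow> (\<And>z. norm z = 1 \<Longrightarrow> f z \<noteq> 0)
   \<Longrightarrow> continuous_on (sphere 0 1) (\<lambda>z. (f z :: complex) powi n)"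
  by (rule continuous_on_power_int) auto

lemma continuous_on_circle_bounded:
  fixes g :: "complex \<Rightarrow> complex"
  assumes "continuous_on (sphere 0 1) g"
  obtains C where "\<And>z. norm z = 1 \<Longrightarrow> norm (g z) \<le> C"
proof -
  have "bounded (g ` sphere 0 1)"
    by (intro compact_imp_bounded compact_continuous_image assms compact_sphere)
  then obtain C where "\<forall>x\<in>g ` sphere 0 1. norm x \<le> C" by (auto simp: bounded_iff)
  then show thesis by (intro that[of C]) auto
qed

lemma borel_measurable_cnj [measurable (raw)]:
  "f \<in> borel_measurable M \<Longrightarrow> (\<lambda>x. cnj (f x)) \<in> borel_measurable M"
  by (rule measurable_compose[of f M borel cnj borel])
     (auto intro: borel_measurable_continuous_onI continuous_intros)

lemma bounded_integrable:
  fixes v :: "complex \<Rightarrow> 'b :: {banach, second_countable_topology}"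
  shows "v \<in> borel_measurable circle_measure \<Longrightarrow> AE z in circle_measure. norm (v z) \<le> N \<Longrightarrow> integrable circle_measure v"
  by (rule circle.integrable_const_bound)

lemma powi_circle_measurable [measurable]:
  "(\<lambda>z. z powi n) \<in> borel_measurable circle_measure"
  "(\<lambda>z. cnj z powi n) \<in> borel_measurable circle_measure"
  by (rule continuous_on_circle_measurable, rule continuous_on_circle_powi, intro continuous_intros, force)+

lemma id_circle_measurable [measurable]: "(\<lambda>z. z) \<in> borel_measurable circle_measure"
  by (rule continuous_on_circle_measurable) (intro continuous_intros)

lemma cnj_circle: "norm z = 1 \<Longrightarrow> cnj z = inverse z"
  using complex_norm_square[of z] by (auto intro!: inverse_unique[symmetric])

lemma cnj_powi_circle: "norm z = 1 \<Longrightarrow> cnj z powi n = z powi (- n)"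
  by (simp add: cnj_circle power_int_inverse power_int_minus)

lemma integral_circle_eq:
  fixes f :: "complex \<Rightarrow> complex"
  assumes "f \<in> borel_measurable circle_measure"
  shows "(LINT z|circle_measure. f z) = (LINT t:{0..2*pi}|lborel. f (cis t)) / (2 * pi)"
proof -
  have f: "f \<in> borel_measurable (restrict_space borel (sphere 0 1))"
    using assms by (simp cong: measurable_cong_sets add: sets_circle_measure)
  have "cis \<in> borel \<rightarrow>\<^sub>M restrict_space borel (sphere 0 1)"
    using cis_measurable_circle by (simp add: measurable_def)
  then have fc [measurable]: "(\<lambda>t. f (cis t)) \<in> borel_measurable borel"
    using f by (rule measurable_compose)
  have um: "uniform_measure lborel {0..<2 * pi} = density lborel (\<lambda>t. ennreal (indicator {0..<2*pi} t / (2 * pi)))"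
    unfolding uniform_measure_def
    by (intro arg_cong2[where f=density] ext) (auto simp: indicator_def divide_ennreal[symmetric])
  have "(LINT z|circle_measure. f z) = (LINT t|uniform_measure lborel {0..<2 * pi}. f (cis t))"
    unfolding circle_measure_def by (intro integral_distr cis_measurable_circle f)
  also have "\<dots> = (LINT t|lborel. (indicator {0..<2*pi} t / (2 * pi)) *\<^sub>R f (cis t))"
    unfolding um by (subst integral_density) auto
  also have "\<dots> = (LINT t|lborel. (indicator {0..2*pi} t *\<^sub>R f (cis t)) / (2 * pi))"
  proof (rule integral_cong_AE)
    have "AE t in lborel. t \<noteq> 2 * pi" by (rule AE_lborel_singleton)
    then show "AE t in lborel. (indicator {0..<2*pi} t / (2 * pi)) *\<^sub>R f (cis t) =
        (indicator {0..2*pi} t *\<^sub>R f (cis t)) / (2 * pi)"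
      by eventually_elim (auto simp: indicator_def scaleR_conv_of_real)
  qed auto
  finally show ?thesis by (simp add: set_lebesgue_integral_def)
qed

lemma integral_circle_powi: "(LINT z|circle_measure. z powi n) = (if n = 0 then 1 else 0)"
proof (cases "n = 0")
  case False
  have cisn: "cis t powi n = cis (of_int n * t)" for t
    by (cases "n \<ge> 0") (auto simp: power_int_def Complex.DeMoivre cis_inverse)
  have "((\<lambda>t. cis (of_int n * t) / (\<i> * of_int n)) has_vector_derivative cis (of_int n * t))
      (at t within {0..2*pi})" for t
  proof -
    have "((\<lambda>z. exp (\<i> * of_int n * z) / (\<i> * of_int n)) has_field_derivative
        exp (\<i> * of_int n * of_real t)) (at (of_real t))"
      using False by (auto intro!: derivative_eq_intros)
    then have "((\<lambda>t. exp (\<i> * of_int n * of_real t) / (\<i> * of_int n)) has_vector_derivative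
        exp (\<i> * of_int n * of_real t)) (at t within {0..2*pi})"
      by (rule has_vector_derivative_real_field)
    then show ?thesis by (simp add: cis_conv_exp mult.assoc)
  qed
  then have "((\<lambda>t. cis (of_int n * t)) has_integral
      (cis (of_int n * (2 * pi)) / (\<i> * of_int n) - cis (of_int n * 0) / (\<i> * of_int n))) {0..2*pi}"
    by (intro fundamental_theorem_of_calculus) auto
  moreover have "cis (of_int n * (2 * pi)) = 1"
    by (metis cis_multiple_2pi Ints_of_int mult.commute)
  ultimately have "((\<lambda>t. cis (of_int n * t)) has_integral 0) {0..2*pi}" by simp
  moreover have "(LINT t:{0..2*pi}|lborel. cis (of_int n * t)) = integral {0..2*pi} (\<lambda>t. cis (of_int n * t))"
    by (intro set_borel_integral_eq_integral borel_integrable_atLeastAtMost' continuous_intros)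
  ultimately have "(LINT t:{0..2*pi}|lborel. cis t powi n) = 0"
    by (simp add: cisn integral_unique)
  then show ?thesis using False by (simp add: integral_circle_eq)
qed simp

section \<open>Density of trigonometric polynomials\<close>

text \<open>On the circle these are the trigonometric polynomials. In this form the real part of such a function
is visibly the real part of one analytic polynomial.\<close>

definition harmonic_poly :: "(complex \<Rightarrow> complex) set" where
  "harmonic_poly = {f. \<exists>p q. \<forall>z. norm z = 1 \<longrightarrow> f z = poly p z + cnj (poly q z)}"

lemma harmonic_polyI: "(\<And>z. norm z = 1 \<Longrightarrow> f z = poly p z + cnj (poly q z)) \<Longrightarrow> f \<in> harmonic_poly"
  by (auto simp: harmonic_poly_def)

lemma harmonic_poly_add:
  assumes "f \<in> harmonic_poly" "g \<in> harmonic_poly"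
  shows "(\<lambda>z. f z + g z) \<in> harmonic_poly"
proof -
  from assms obtain p q r s where
    "\<And>z. norm z = 1 \<Longrightarrow> f z = poly p z + cnj (poly q z)"
    "\<And>z. norm z = 1 \<Longrightarrow> g z = poly r z + cnj (poly s z)"
    unfolding harmonic_poly_def by blast
  then show ?thesis by (intro harmonic_polyI[of _ "p + r" "q + s"]) simp
qed

lemma harmonic_poly_cmult:
  assumes "f \<in> harmonic_poly"
  shows "(\<lambda>z. c * f z) \<in> harmonic_poly"
proof -
  from assms obtain p q where "\<And>z. norm z = 1 \<Longrightarrow> f z = poly p z + cnj (poly q z)"
    unfolding harmonic_poly_def by blast
  then show ?thesis by (intro harmonic_polyI[of _ "Polynomial.smult c p" "Polynomial.smult (cnj c) q"]) (simp add: distrib_left)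
qed

lemma harmonic_poly_cnj:
  assumes "f \<in> harmonic_poly"
  shows "(\<lambda>z. cnj (f z)) \<in> harmonic_poly"
proof -
  from assms obtain p q where "\<And>z. norm z = 1 \<Longrightarrow> f z = poly p z + cnj (poly q z)"
    unfolding harmonic_poly_def by blast
  then show ?thesis by (intro harmonic_polyI[of _ q p]) simp
qed

text \<open>Since \<open>z cnj z = 1\<close>, multiplication by \<open>z\<close> lowers the degree of the antianalytic part and moves its
constant term into the analytic part.\<close>

lemma harmonic_poly_times_id:
  assumes "f \<in> harmonic_poly"
  shows "(\<lambda>z. z * f z) \<in> harmonic_poly"
proof -
  from assms obtain p q where f: "\<And>z. norm z = 1 \<Longrightarrow> f z = poly p z + cnj (poly q z)"
    unfolding harmonic_poly_def by blast
  obtain a r where q: "q = pCons a r" by (cases q)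
  have "z * f z = poly (pCons 0 (p + [:cnj a:])) z + cnj (poly r z)" if "norm z = 1" for z
  proof -
    have "z * cnj z = 1" using that complex_norm_square[of z] by simp
    then have "z * (cnj z * x) = x" for x by (simp flip: mult.assoc)
    then show ?thesis using f[OF that] by (simp add: q algebra_simps)
  qed
  then show ?thesis by (rule harmonic_polyI)
qed

lemma harmonic_poly_times_poly:
  "f \<in> harmonic_poly \<Longrightarrow> (\<lambda>z. poly p z * f z) \<in> harmonic_poly"
proof (induction p)
  case 0
  then show ?case by (intro harmonic_polyI[of _ 0 0]) simp
next
  case (pCons a p)
  then have "(\<lambda>z. a * f z + z * (poly p z * f z)) \<in> harmonic_poly"
    by (intro harmonic_poly_add harmonic_poly_cmult harmonic_poly_times_id) auto
  then show ?case by (simp add: algebra_simps)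
qed

lemma harmonic_poly_mult:
  assumes "f \<in> harmonic_poly" "g \<in> harmonic_poly"
  shows "(\<lambda>z. f z * g z) \<in> harmonic_poly"
proof -
  from assms obtain p q where f: "\<And>z. norm z = 1 \<Longrightarrow> f z = poly p z + cnj (poly q z)"
    unfolding harmonic_poly_def by blast
  have "(\<lambda>z. poly p z * g z + cnj (poly q z * cnj (g z))) \<in> harmonic_poly"
    by (intro harmonic_poly_add harmonic_poly_times_poly harmonic_poly_cnj assms)
  then obtain r s where "\<And>z. norm z = 1 \<Longrightarrow>
      poly p z * g z + cnj (poly q z * cnj (g z)) = poly r z + cnj (poly s z)"
    unfolding harmonic_poly_def by blast
  then show ?thesis by (intro harmonic_polyI[of _ r s]) (simp add: f algebra_simps)
qed

lemma real_polynomial_function_harmonic_poly: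
  fixes g :: "complex \<Rightarrow> real"
  assumes "real_polynomial_function g"
  shows "(\<lambda>z. of_real (g z)) \<in> harmonic_poly"
  using assms
proof induction
  case (linear f)
  interpret f: bounded_linear f by fact
  define w where "w = Complex (f 1) (- f \<i>)"
  have "of_real (f z) = poly [:0, w / 2:] z + cnj (poly [:0, w / 2:] z)" for z
  proof -
    have "f z = f (Re z *\<^sub>R 1 + Im z *\<^sub>R \<i>)"
      by (intro arg_cong[of _ _ f]) (simp add: complex_eq_iff)
    also have "\<dots> = Re (w * z)"
      by (simp only: f.add f.scaleR) (simp add: w_def)
    finally show ?thesis by (simp add: complex_eq_iff w_def field_simps)
  qed
  then show ?case by (intro harmonic_polyI)
next
  case (const c)
  show ?case by (rule harmonic_polyI[of _ "[:of_real c:]" 0]) simp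
next
  case (add f g)
  then show ?case using harmonic_poly_add[OF add.IH] by simp
next
  case (mult f g)
  then show ?case using harmonic_poly_mult[OF mult.IH] by simp
qed

lemma integrable_Re_poly: "integrable circle_measure (\<lambda>z. Re (poly P z))"
  by (intro continuous_on_circle_integrable continuous_intros)

lemma continuous_on_circle_approx_Re_poly:
  fixes g :: "complex \<Rightarrow> real"
  assumes "continuous_on (sphere 0 1) g" "e > 0"
  obtains P where "\<And>z. norm z = 1 \<Longrightarrow> \<bar>g z - Re (poly P z)\<bar> < e"
proof -
  obtain h where h: "real_polynomial_function h" "\<And>z. z \<in> sphere 0 1 \<Longrightarrow> \<bar>g z - h z\<bar> < e"
    using Stone_Weierstrass_real_polynomial_function[OF compact_sphere assms] by blast
  from real_polynomial_function_harmonic_poly[OF h(1)] obtain p q where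
    pq: "\<And>z. norm z = 1 \<Longrightarrow> of_real (h z) = poly p z + cnj (poly q z)"
    unfolding harmonic_poly_def by blast
  have "h z = Re (poly (p + q) z)" if "norm z = 1" for z
    using arg_cong[OF pq[OF that], of Re] by simp
  with h(2) show thesis by (intro that[of "p + q"]) auto
qed

text \<open>The push-forward of the measure to the plane is regular, so \<open>A\<close> lies between a compact \<open>K\<close> and an
open \<open>U\<close> of nearly equal measure. A Urysohn function for \<open>K\<close> and the complement of \<open>U\<close> differs from
the indicator of \<open>A\<close> only on \<open>U - K\<close>.\<close>

lemma indicator_circle_L1_approx_continuous:
  assumes A: "A \<in> sets circle_measure" and "e > 0"
  obtains g :: "complex \<Rightarrow> real" where "continuous_on UNIV g"
    "(LINT z|circle_measure. \<bar>indicator A z - g z\<bar>) < e"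
proof -
  let ?M = "distr circle_measure borel (\<lambda>z. z)"
  have Ab: "A \<in> sets borel"
    using A by (auto simp: sets_circle_measure sets_restrict_space)
  have em: "emeasure ?M B = emeasure circle_measure (B \<inter> sphere 0 1)" if "B \<in> sets borel" for B
    using that by (subst emeasure_distr) auto
  interpret M: finite_measure ?M
    by standard (auto simp: em emeasure_circle_space)
  have fin: "emeasure ?M (space ?M) \<noteq> \<infinity>" by simp
  have "emeasure ?M A < ennreal (measure ?M A + e / 2)"
    using \<open>e > 0\<close> by (subst M.emeasure_eq_measure) (intro ennreal_lessI, auto intro: add_nonneg_pos)
  then obtain U where U: "A \<subseteq> U" "open U" "emeasure ?M U < ennreal (measure ?M A + e / 2)"
    using outer_regular[OF _ fin Ab] by (auto simp: Inf_less_iff)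
  obtain K where K: "K \<subseteq> A" "compact K" "measure ?M A - e / 2 < measure ?M K"
  proof (cases "measure ?M A < e / 2")
    case True
    then show thesis by (intro that[of "{}"]) auto
  next
    case False
    then have "ennreal (measure ?M A - e / 2) < emeasure ?M A"
      using \<open>e > 0\<close> by (subst M.emeasure_eq_measure) (intro ennreal_lessI, auto)
    then obtain K where K: "K \<subseteq> A" "compact K" "ennreal (measure ?M A - e / 2) < emeasure ?M K"
      using inner_regular[OF _ fin Ab] by (auto simp: less_Sup_iff)
    with False show thesis
      by (intro that[of K]) (auto simp: M.emeasure_eq_measure ennreal_less_iff)
  qed
  have Um: "measure ?M U < measure ?M A + e / 2"
    using U(3) by (simp add: M.emeasure_eq_measure ennreal_less_iff)
  have "closed K" "closed (- U)" "K \<inter> - U = {}"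
    using K U by (auto simp: compact_imp_closed)
  then obtain g :: "complex \<Rightarrow> real" where g: "continuous_on UNIV g"
      "\<And>x. g x \<in> closed_segment 1 0" "\<And>x. x \<in> K \<Longrightarrow> g x = 1" "\<And>x. x \<in> - U \<Longrightarrow> g x = 0"
    by (rule Urysohn[of K "- U" 1 0]) auto
  have gb: "0 \<le> g x" "g x \<le> 1" for x using g(2)[of x] by (auto simp: closed_segment_eq_real_ivl)
  have [measurable]: "g \<in> borel_measurable borel"
    using g(1) by (rule borel_measurable_continuous_onI)
  have [measurable]: "U \<in> sets borel" "K \<in> sets borel" "A \<in> sets borel"
    using U K Ab by (auto simp: compact_imp_closed)
  have "(LINT z|circle_measure. \<bar>indicator A z - g z\<bar>) = (LINT z|?M. \<bar>indicator A z - g z\<bar>)"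
    by (rule integral_distr[symmetric]) auto
  also have "\<dots> \<le> (LINT z|?M. indicator (U - K) z)"
  proof (rule integral_mono)
    show "integrable ?M (\<lambda>x. \<bar>indicator A x - g x\<bar>)"
    proof (rule M.integrable_const_bound[of _ 1])
      have "norm \<bar>indicator A x - g x\<bar> \<le> 1" for x
        using gb[of x] by (auto simp: indicator_def)
      then show "AE x in ?M. norm \<bar>indicator A x - g x\<bar> \<le> 1" by simp
    qed auto
    show "\<bar>indicator A x - g x\<bar> \<le> indicator (U - K) x" for x
      using K U g(3,4)[of x] gb[of x] by (auto simp: indicator_def)
  qed (auto intro!: integrable_real_indicator simp: M.emeasure_eq_measure)
  also have "\<dots> = measure ?M U - measure ?M K"
    using K U by (simp add: M.finite_measure_Diff order_trans[OF K(1) U(1)])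
  also have "\<dots> < e" using Um K(3) by simp
  finally show thesis using g(1) by (intro that[of g])
qed

text \<open>Indicators are approximated through continuous functions and the theorem of Stone and Weierstrass;
sums and dominated limits inherit the property.\<close>

lemma L1_approx_Re_poly:
  fixes v :: "complex \<Rightarrow> real"
  assumes "integrable circle_measure v" "e > 0"
  shows "\<exists>P. (LINT z|circle_measure. \<bar>v z - Re (poly P z)\<bar>) < e"
  using assms
proof (induction arbitrary: e)
  case (base A c)
  define d where "d = e / (2 * (\<bar>c\<bar> + 1))"
  have "d > 0" using base by (auto simp: d_def)
  obtain g :: "complex \<Rightarrow> real" where g: "continuous_on UNIV g"
    "(LINT z|circle_measure. \<bar>indicator A z - g z\<bar>) < d"
    using indicator_circle_L1_approx_continuous[OF base(1) \<open>d > 0\<close>] by blast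
  have gc: "continuous_on (sphere 0 1) g" using g(1) continuous_on_subset by blast
  have "continuous_on (sphere 0 1) (\<lambda>z. c * g z)" "e / 2 > 0"
    using gc base by (auto intro: continuous_intros)
  then obtain P where P: "\<And>z. norm z = 1 \<Longrightarrow> \<bar>c * g z - Re (poly P z)\<bar> < e / 2"
    using continuous_on_circle_approx_Re_poly by blast
  have iA: "integrable circle_measure (\<lambda>z. indicator A z :: real)"
    using base by (auto intro!: integrable_real_indicator)
  have ig: "integrable circle_measure g" by (rule continuous_on_circle_integrable[OF gc])
  note iP = integrable_Re_poly[of P]
  have "(LINT z|circle_measure. \<bar>indicator A z *\<^sub>R c - Re (poly P z)\<bar>)
      \<le> (LINT z|circle_measure. \<bar>c\<bar> * \<bar>indicator A z - g z\<bar> + e / 2)"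
  proof (rule integral_mono)
    fix z assume "z \<in> space circle_measure"
    then have "\<bar>c * g z - Re (poly P z)\<bar> < e / 2" using P by simp
    moreover have "\<bar>c * indicator A z - c * g z\<bar> = \<bar>c\<bar> * \<bar>indicator A z - g z\<bar>"
      by (simp add: abs_mult flip: right_diff_distrib)
    ultimately have "\<bar>c * indicator A z - Re (poly P z)\<bar> \<le> \<bar>c\<bar> * \<bar>indicator A z - g z\<bar> + e / 2"
      by linarith
    then show "\<bar>indicator A z *\<^sub>R c - Re (poly P z)\<bar> \<le> \<bar>c\<bar> * \<bar>indicator A z - g z\<bar> + e / 2"
      by (simp add: mult.commute)
  qed (use iA ig iP in auto)
  also have "\<dots> = \<bar>c\<bar> * (LINT z|circle_measure. \<bar>indicator A z - g z\<bar>) + e / 2"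
    using iA ig by simp
  also have "\<dots> \<le> \<bar>c\<bar> * d + e / 2" using g(2) by (intro add_mono mult_left_mono) auto
  also have "\<dots> < (\<bar>c\<bar> + 1) * d + e / 2" using \<open>d > 0\<close> by simp
  also have "\<dots> = e" by (simp add: d_def field_simps add_nonneg_eq_0_iff)
  finally show ?case by blast
next
  case (add f g)
  from add.IH(1)[of "e / 2"] add.IH(2)[of "e / 2"] \<open>e > 0\<close> obtain P Q where
    PQ: "(LINT z|circle_measure. \<bar>f z - Re (poly P z)\<bar>) < e / 2"
        "(LINT z|circle_measure. \<bar>g z - Re (poly Q z)\<bar>) < e / 2" by auto
  note iP = integrable_Re_poly
  have "(LINT z|circle_measure. \<bar>f z + g z - Re (poly (P + Q) z)\<bar>)
    \<le> (LINT z|circle_measure. \<bar>f z - Re (poly P z)\<bar> + \<bar>g z - Re (poly Q z)\<bar>)"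
    using add iP[of P] iP[of Q] by (intro integral_mono) auto
  also have "\<dots> < e" using PQ add iP[of P] iP[of Q] by simp
  finally show ?case by blast
next
  case (lim f s)
  have "(\<lambda>i. LINT z|circle_measure. \<bar>f z - s i z\<bar>) \<longlonglongrightarrow> (LINT z|circle_measure. 0)"
  proof (rule integral_dominated_convergence[where w = "\<lambda>z. 3 * \<bar>f z\<bar>"])
    show "AE z in circle_measure. (\<lambda>i. \<bar>f z - s i z\<bar>) \<longlonglongrightarrow> 0"
    proof (rule AE_I2)
      fix z assume "z \<in> space circle_measure"
      then have "(\<lambda>i. \<bar>f z - s i z\<bar>) \<longlonglongrightarrow> \<bar>f z - f z\<bar>"
        by (intro tendsto_intros lim)
      then show "(\<lambda>i. \<bar>f z - s i z\<bar>) \<longlonglongrightarrow> 0" by simp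
    qed
    show "AE z in circle_measure. norm \<bar>f z - s i z\<bar> \<le> 3 * \<bar>f z\<bar>" for i
    proof (rule AE_I2)
      fix z assume "z \<in> space circle_measure"
      then have "norm (s i z) \<le> 2 * norm (f z)" using lim.hyps by blast
      then show "norm \<bar>f z - s i z\<bar> \<le> 3 * \<bar>f z\<bar>" by simp
    qed
  qed (use lim in \<open>auto intro: borel_measurable_integrable\<close>)
  then have "eventually (\<lambda>i. (LINT z|circle_measure. \<bar>f z - s i z\<bar>) < e / 2) sequentially"
    using \<open>e > 0\<close> by (intro order_tendstoD(2)[of _ 0]) auto
  then obtain i where i: "(LINT z|circle_measure. \<bar>f z - s i z\<bar>) < e / 2"
    by (auto simp: eventually_sequentially)
  obtain P where P: "(LINT z|circle_measure. \<bar>s i z - Re (poly P z)\<bar>) < e / 2"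
    using lim.IH[of "e / 2" i] \<open>e > 0\<close> by auto
  note iP = integrable_Re_poly[of P]
  have "(LINT z|circle_measure. \<bar>f z - Re (poly P z)\<bar>)
    \<le> (LINT z|circle_measure. \<bar>f z - s i z\<bar> + \<bar>s i z - Re (poly P z)\<bar>)"
    using lim iP by (intro integral_mono) auto
  also have "\<dots> < e" using i P lim iP by simp
  finally show ?case by blast
qed

text \<open>The uniform bound is what permits dominated convergence, also after the approximants have been put
into an exponential.\<close>

lemma AE_approx_Re_poly:
  fixes v :: "complex \<Rightarrow> real"
  assumes v [measurable]: "v \<in> borel_measurable circle_measure"
    and bound: "AE z in circle_measure. \<bar>v z\<bar> \<le> N"
  obtains P :: "nat \<Rightarrow> complex poly" where
    "\<And>n z. norm z = 1 \<Longrightarrow> \<bar>Re (poly (P n) z)\<bar> \<le> N + 1"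
    "AE z in circle_measure. (\<lambda>n. Re (poly (P n) z)) \<longlonglongrightarrow> v z"
proof -
  have iv: "integrable circle_measure v"
    using bound by (intro circle.integrable_const_bound[of _ N]) auto
  have "N \<ge> 0"
  proof (rule ccontr)
    assume "\<not> N \<ge> 0"
    then have "AE z in circle_measure. False"
      by (intro eventually_mono[OF bound]) (auto simp: not_le)
    then show False using AE_circle_False by simp
  qed
  note iP = integrable_Re_poly
  have "\<exists>Q. (LINT z|circle_measure. \<bar>v z - Re (poly Q z)\<bar>) < 1 / Suc n" for n
    using iv by (rule L1_approx_Re_poly) simp
  then obtain Q where Q: "\<And>n. (LINT z|circle_measure. \<bar>v z - Re (poly (Q n) z)\<bar>) < 1 / Suc n"
    by metis
  \<comment> \<open>Truncation keeps the bound and, as \<open>v\<close> already obeys it, brings no point further from \<open>v\<close>.\<close>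
  define c where "c n z = max (- N) (min N (Re (poly (Q n) z)))" for n z
  have cc: "continuous_on (sphere 0 1) (c n)" for n
    unfolding c_def by (intro continuous_intros)
  have "\<exists>P. \<forall>z. norm z = 1 \<longrightarrow> \<bar>c n z - Re (poly P z)\<bar> < 1 / Suc n" for n
    using continuous_on_circle_approx_Re_poly[OF cc[of n], of "1 / Suc n"]
    by (metis of_nat_0_less_iff zero_less_Suc zero_less_divide_1_iff)
  then obtain P where P: "\<And>n z. norm z = 1 \<Longrightarrow> \<bar>c n z - Re (poly (P n) z)\<bar> < 1 / Suc n"
    by metis
  have Pb: "\<bar>Re (poly (P n) z)\<bar> \<le> N + 1" if "norm z = 1" for n z
  proof -
    have "1 / real (Suc n) \<le> 1" by simp
    moreover have "\<bar>c n z\<bar> \<le> N" using \<open>N \<ge> 0\<close> by (auto simp: c_def)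
    ultimately show ?thesis using P[OF that, of n] by linarith
  qed
  have le: "(LINT z|circle_measure. norm (v z - Re (poly (P n) z))) \<le> 2 / Suc n" for n
  proof -
    have "(LINT z|circle_measure. norm (v z - Re (poly (P n) z))) \<le>
        (LINT z|circle_measure. \<bar>v z - Re (poly (Q n) z)\<bar> + 1 / Suc n)"
    proof (rule integral_mono_AE)
      show "AE z in circle_measure. norm (v z - Re (poly (P n) z)) \<le> \<bar>v z - Re (poly (Q n) z)\<bar> + 1 / Suc n"
        using bound AE_circle_unit
      proof eventually_elim
        case (elim z)
        have "\<bar>v z - c n z\<bar> \<le> \<bar>v z - Re (poly (Q n) z)\<bar>"
          using elim(1) by (auto simp: c_def)
        then show ?case using P[OF elim(2), of n] by simp
      qed
    qed (use iv iP in auto)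
    also have "\<dots> = (LINT z|circle_measure. \<bar>v z - Re (poly (Q n) z)\<bar>) + 1 / Suc n"
      using iv iP by simp
    also have "\<dots> \<le> 2 / Suc n" using Q[of n] by linarith
    finally show ?thesis .
  qed
  have "(\<lambda>n. LINT z|circle_measure. norm (v z - Re (poly (P n) z))) \<longlonglongrightarrow> 0"
  proof (rule tendsto_sandwich[OF _ _ tendsto_const])
    show "(\<lambda>n. 2 / real (Suc n)) \<longlonglongrightarrow> 0"
      by (rule LIMSEQ_Suc, rule lim_const_over_n)
  qed (use le in auto)
  then obtain r where r: "strict_mono r"
      "AE z in circle_measure. (\<lambda>n. v z - Re (poly (P (r n)) z)) \<longlonglongrightarrow> 0"
    using tendsto_L1_AE_subseq[of circle_measure "\<lambda>n z. v z - Re (poly (P n) z)"] iv iP by auto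
  have "AE z in circle_measure. (\<lambda>n. Re (poly (P (r n)) z)) \<longlonglongrightarrow> v z"
    using r(2)
  proof eventually_elim
    case (elim z)
    from tendsto_diff[OF tendsto_const[of "v z"] this] show ?case by simp
  qed
  with Pb show thesis by (intro that[of "\<lambda>n. P (r n)"])
qed

lemma L1_approx_harmonic_poly:
  fixes f :: "complex \<Rightarrow> complex"
  assumes "integrable circle_measure f" "e > 0"
  obtains h where "h \<in> harmonic_poly" "continuous_on (sphere 0 1) h"
    "(LINT z|circle_measure. norm (f z - h z)) < e"
proof -
  have iR: "integrable circle_measure (\<lambda>z. Re (f z))" and iI: "integrable circle_measure (\<lambda>z. Im (f z))"
    using assms(1) by auto
  note iP = integrable_Re_poly
  obtain P Q where PQ: "(LINT z|circle_measure. \<bar>Re (f z) - Re (poly P z)\<bar>) < e / 2"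
      "(LINT z|circle_measure. \<bar>Im (f z) - Re (poly Q z)\<bar>) < e / 2"
    using L1_approx_Re_poly[OF iR, of "e / 2"] L1_approx_Re_poly[OF iI, of "e / 2"] assms(2) by auto
  define h where "h z = of_real (Re (poly P z)) + \<i> * of_real (Re (poly Q z))" for z
  have R: "(\<lambda>z. of_real (Re (poly P z))) \<in> harmonic_poly" for P
    by (rule harmonic_polyI[of _ "Polynomial.smult (1/2) P" "Polynomial.smult (1/2) P"])
       (simp add: complex_eq_iff)
  have hc: "continuous_on (sphere 0 1) h" unfolding h_def by (intro continuous_intros)
  have "(LINT z|circle_measure. norm (f z - h z)) \<le>
    (LINT z|circle_measure. \<bar>Re (f z) - Re (poly P z)\<bar> + \<bar>Im (f z) - Re (poly Q z)\<bar>)"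
  proof (rule integral_mono)
    show "norm (f z - h z) \<le> \<bar>Re (f z) - Re (poly P z)\<bar> + \<bar>Im (f z) - Re (poly Q z)\<bar>" for z
      using cmod_le[of "f z - h z"] by (simp add: h_def)
  qed (use assms(1) continuous_on_circle_integrable[OF hc] iR iI iP in auto)
  also have "\<dots> < e" using PQ iR iI iP by simp
  finally show thesis
    using hc harmonic_poly_add[OF R[of P] harmonic_poly_cmult[OF R[of Q], of \<i>]]
    by (intro that[of h]) (simp_all add: h_def[abs_def])
qed

section \<open>Fourier coefficients and the Hardy space\<close>

lemma integrable_bounded_mult:
  fixes u f :: "complex \<Rightarrow> complex"
  assumes "integrable circle_measure f" "u \<in> borel_measurable circle_measure"
    and "AE z in circle_measure. norm (u z) \<le> C"
  shows "integrable circle_measure (\<lambda>z. u z * f z)"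
proof (rule Bochner_Integration.integrable_bound)
  show "integrable circle_measure (\<lambda>z. C * norm (f z))" using assms by auto
  show "AE z in circle_measure. norm (u z * f z) \<le> norm (C * norm (f z))"
    using assms(3)
  proof eventually_elim
    case (elim z)
    then have "norm (u z) * norm (f z) \<le> C * norm (f z)" by (rule mult_right_mono) simp
    then show ?case by (simp add: norm_mult)
  qed
qed (use assms in auto)

lemma integrable_continuous_mult:
  fixes u f :: "complex \<Rightarrow> complex"
  assumes "integrable circle_measure f" "continuous_on (sphere 0 1) u"
  shows "integrable circle_measure (\<lambda>z. u z * f z)"
proof -
  obtain C where "\<And>z. norm z = 1 \<Longrightarrow> norm (u z) \<le> C"
    using continuous_on_circle_bounded[OF assms(2)] by blast
  then show ?thesis
    by (intro integrable_bounded_mult[where C=C] AE_I2 continuous_on_circle_measurable assms) auto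
qed

lemma integrable_powi_mult:
  assumes "integrable circle_measure f"
  shows "integrable circle_measure (\<lambda>z. z powi n * f z)"
    and "integrable circle_measure (\<lambda>z. cnj z powi n * f z)"
  by (rule integrable_bounded_mult[where C=1]; use assms in \<open>auto simp: norm_power_int\<close>)+

lemma fourier_coeff_cong_AE:
  assumes "AE z in circle_measure. f z = g z"
    "f \<in> borel_measurable circle_measure" "g \<in> borel_measurable circle_measure"
  shows "fourier_coeff f k = fourier_coeff g k"
  unfolding fourier_coeff_def using assms by (intro integral_cong_AE) auto

lemma fourier_coeff_cong:
  "(\<And>z. norm z = 1 \<Longrightarrow> f z = g z) \<Longrightarrow> fourier_coeff f k = fourier_coeff g k"
  unfolding fourier_coeff_def by (intro Bochner_Integration.integral_cong) auto

lemma fourier_coeff_add: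
  assumes "integrable circle_measure f" "integrable circle_measure g"
  shows "fourier_coeff (\<lambda>z. f z + g z) k = fourier_coeff f k + fourier_coeff g k"
  using assms[THEN integrable_powi_mult(2)] by (simp add: fourier_coeff_def distrib_left)

lemma fourier_coeff_diff:
  assumes "integrable circle_measure f" "integrable circle_measure g"
  shows "fourier_coeff (\<lambda>z. f z - g z) k = fourier_coeff f k - fourier_coeff g k"
  using assms[THEN integrable_powi_mult(2)] by (simp add: fourier_coeff_def right_diff_distrib)

lemma fourier_coeff_cmult:
  "fourier_coeff (\<lambda>z. c * f z) k = c * fourier_coeff f k"
proof -
  have "(\<lambda>z. cnj z powi k * (c * f z)) = (\<lambda>z. c * (cnj z powi k * f z))" by (auto simp: ac_simps)
  then show ?thesis by (simp add: fourier_coeff_def)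
qed

lemma fourier_coeff_sum:
  assumes "\<And>i. i \<in> A \<Longrightarrow> integrable circle_measure (f i)"
  shows "fourier_coeff (\<lambda>z. \<Sum>i\<in>A. f i z) k = (\<Sum>i\<in>A. fourier_coeff (f i) k)"
  using assms[THEN integrable_powi_mult(2)] by (simp add: fourier_coeff_def sum_distrib_left)

lemma fourier_coeff_cnj:
  "fourier_coeff (\<lambda>z. cnj (f z)) k = cnj (fourier_coeff f (- k))"
proof -
  have "fourier_coeff (\<lambda>z. cnj (f z)) k = (LINT z|circle_measure. cnj (cnj z powi (- k) * f z))"
    unfolding fourier_coeff_def
    by (intro Bochner_Integration.integral_cong) (auto simp: cnj_powi_circle)
  also have "\<dots> = cnj (fourier_coeff f (- k))"
    unfolding fourier_coeff_def by (rule Bochner_Integration.integral_cnj)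
  finally show ?thesis .
qed

lemma fourier_coeff_powi_mult:
  "fourier_coeff (\<lambda>z. z powi n * f z) k = fourier_coeff f (k - n)"
proof -
  have "cnj z powi k * (z powi n * f z) = cnj z powi (k - n) * f z" if "norm z = 1" for z
  proof -
    have "z \<noteq> 0" using that by auto
    then have "z powi (- k) * z powi n = z powi (n - k)" by (simp flip: power_int_add)
    then show ?thesis using that by (simp add: cnj_powi_circle flip: mult.assoc)
  qed
  then show ?thesis unfolding fourier_coeff_def by (intro Bochner_Integration.integral_cong) auto
qed

lemma fourier_coeff_id_mult:
  "fourier_coeff (\<lambda>z. z * f z) k = fourier_coeff f (k - 1)"
  using fourier_coeff_powi_mult[of 1 f k] by simp

lemma fourier_coeff_const: "fourier_coeff (\<lambda>z. c) k = (if k = 0 then c else 0)"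
proof -
  have "fourier_coeff (\<lambda>z. 1) k = (LINT z|circle_measure. z powi (- k))"
    unfolding fourier_coeff_def
    by (intro Bochner_Integration.integral_cong) (auto simp: cnj_powi_circle)
  then show ?thesis using fourier_coeff_cmult[of c "\<lambda>_. 1" k] by (simp add: integral_circle_powi)
qed

lemma fourier_coeff_powi: "fourier_coeff (\<lambda>z. z powi n) k = (if k = n then 1 else 0)"
  using fourier_coeff_powi_mult[of n "\<lambda>_. 1" k] by (simp add: fourier_coeff_const)

lemma integral_circle_eq_fourier_coeff: "(LINT z|circle_measure. f z) = fourier_coeff f 0"
  by (simp add: fourier_coeff_def)

lemma norm_fourier_coeff_le:
  assumes "integrable circle_measure f"
  shows "norm (fourier_coeff f k) \<le> (LINT z|circle_measure. norm (f z))"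
proof -
  have "norm (fourier_coeff f k) \<le> (LINT z|circle_measure. norm (cnj z powi k * f z))"
    unfolding fourier_coeff_def by (rule integral_norm_bound)
  also have "\<dots> = (LINT z|circle_measure. norm (f z))"
    by (intro Bochner_Integration.integral_cong) (auto simp: norm_mult norm_power_int)
  finally show ?thesis .
qed

lemma integrable_poly [simp]: "integrable circle_measure (\<lambda>z. poly p z :: complex)"
  by (intro continuous_on_circle_integrable continuous_intros)

lemma poly_circle_measurable [measurable]: "poly p \<in> borel_measurable circle_measure" for p :: "complex poly"
  by (rule borel_measurable_integrable) simp

lemma integrable_poly_mult:
  "integrable circle_measure f \<Longrightarrow> integrable circle_measure (\<lambda>z. poly p z * f z)"
  by (intro integrable_continuous_mult continuous_intros)

lemma fourier_coeff_poly_mult: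
  assumes "integrable circle_measure f"
  shows "fourier_coeff (\<lambda>z. poly p z * f z) k =
    (\<Sum>i\<le>degree p. Polynomial.coeff p i * fourier_coeff f (k - int i))"
proof -
  have "fourier_coeff (\<lambda>z. poly p z * f z) k =
      fourier_coeff (\<lambda>z. \<Sum>i\<le>degree p. Polynomial.coeff p i * (z powi int i * f z)) k"
    by (intro arg_cong2[of _ _ _ _ fourier_coeff] ext)
       (simp_all add: poly_altdef sum_distrib_right mult.assoc)
  also have "\<dots> = (\<Sum>i\<le>degree p. fourier_coeff (\<lambda>z. Polynomial.coeff p i * (z powi int i * f z)) k)"
    by (intro fourier_coeff_sum integrable_mult_right integrable_powi_mult assms)
  also have "\<dots> = (\<Sum>i\<le>degree p. Polynomial.coeff p i * fourier_coeff f (k - int i))"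
    by (simp only: fourier_coeff_cmult fourier_coeff_powi_mult)
  finally show ?thesis .
qed

lemma fourier_coeff_poly:
  "fourier_coeff (poly p) k = (if k < 0 then 0 else Polynomial.coeff p (nat k))"
proof -
  have "fourier_coeff (poly p) k = (\<Sum>i\<le>degree p. Polynomial.coeff p i * (if k - int i = 0 then 1 else 0))"
    using fourier_coeff_poly_mult[of "\<lambda>_. 1" p k] by (simp add: fourier_coeff_const cong: sum.cong)
  also have "\<dots> = (\<Sum>i\<le>degree p. if i = nat k \<and> k \<ge> 0 then Polynomial.coeff p i else 0)"
    by (intro sum.cong) auto
  also have "\<dots> = (if k < 0 then 0 else Polynomial.coeff p (nat k))"
    by (auto simp: sum.delta coeff_eq_0)
  finally show ?thesis .
qed

text \<open>A trigonometric polynomial has only finitely many frequencies, and it is close to \<open>f\<close> in \<open>L\<^sup>1\<close>.\<close>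

lemma Riemann_Lebesgue:
  assumes f: "integrable circle_measure f"
  shows "(\<lambda>n. fourier_coeff f (- int n)) \<longlonglongrightarrow> 0"
proof (rule LIMSEQ_I)
  fix e :: real assume "e > 0"
  obtain h where h: "h \<in> harmonic_poly" "continuous_on (sphere 0 1) h"
      "(LINT z|circle_measure. norm (f z - h z)) < e"
    using L1_approx_harmonic_poly[OF f \<open>e > 0\<close>] by blast
  then obtain p q where pq: "\<And>z. norm z = 1 \<Longrightarrow> h z = poly p z + cnj (poly q z)"
    unfolding harmonic_poly_def by blast
  have ih: "integrable circle_measure h" by (rule continuous_on_circle_integrable[OF h(2)])
  show "\<exists>no. \<forall>n\<ge>no. norm (fourier_coeff f (- int n) - 0) < e"
  proof (intro exI[of _ "Suc (degree q)"] allI impI)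
    fix n assume n: "Suc (degree q) \<le> n"
    have "fourier_coeff h (- int n) = fourier_coeff (poly p) (- int n) + fourier_coeff (\<lambda>z. cnj (poly q z)) (- int n)"
      by (subst fourier_coeff_add[symmetric]) (auto intro: fourier_coeff_cong pq)
    also have "\<dots> = 0" using n by (simp add: fourier_coeff_cnj fourier_coeff_poly coeff_eq_0)
    finally have "fourier_coeff f (- int n) = fourier_coeff (\<lambda>z. f z - h z) (- int n)"
      by (simp add: fourier_coeff_diff f ih)
    also have "norm \<dots> < e" using f ih by (intro le_less_trans[OF norm_fourier_coeff_le h(3)]) simp
    finally show "norm (fourier_coeff f (- int n) - 0) < e" by simp
  qed
qed

lemma integral_harmonic_poly_mult_eq_0:
  assumes f: "integrable circle_measure f" and 0: "\<And>k. fourier_coeff f k = 0"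
    and h: "h \<in> harmonic_poly"
  shows "(LINT z|circle_measure. h z * f z) = 0"
proof -
  have *: "fourier_coeff (\<lambda>z. poly p z * g z) 0 = 0"
    if "integrable circle_measure g" "\<And>k. fourier_coeff g k = 0" for g p
    using that by (simp add: fourier_coeff_poly_mult)
  obtain p q where pq: "\<And>z. norm z = 1 \<Longrightarrow> h z = poly p z + cnj (poly q z)"
    using h unfolding harmonic_poly_def by blast
  have if': "integrable circle_measure (\<lambda>z. cnj (f z))" using f by simp
  have "(LINT z|circle_measure. h z * f z) =
      fourier_coeff (\<lambda>z. poly p z * f z + cnj (poly q z * cnj (f z))) 0"
    unfolding integral_circle_eq_fourier_coeff
    by (intro fourier_coeff_cong) (simp add: pq algebra_simps)
  also have "\<dots> = fourier_coeff (\<lambda>z. poly p z * f z) 0 +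
      fourier_coeff (\<lambda>z. cnj (poly q z * cnj (f z))) 0"
    using integrable_poly_mult[OF f] integrable_cnj[OF integrable_poly_mult[OF if']]
    by (intro fourier_coeff_add) auto
  also have "\<dots> = 0"
    by (simp only: fourier_coeff_cnj) (simp add: * f if' 0 fourier_coeff_cnj)
  finally show ?thesis .
qed

text \<open>Such an \<open>f\<close> annihilates all trigonometric polynomials. As \<open>f\<close> is bounded, approximating \<open>cnj f\<close> by
them in \<open>L\<^sup>1\<close> suffices to conclude that the integral of \<open>|f|\<^sup>2\<close> vanishes.\<close>

lemma bounded_fourier_unique:
  assumes f [measurable]: "f \<in> borel_measurable circle_measure"
    and C: "AE z in circle_measure. norm (f z) \<le> C"
    and 0: "\<And>k. fourier_coeff f k = 0"
  shows "AE z in circle_measure. f z = 0"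
proof -
  have if': "integrable circle_measure f" by (rule circle.integrable_const_bound[OF C]) simp
  have if2: "integrable circle_measure (\<lambda>z. cnj (f z))" using if' by simp
  have iff': "integrable circle_measure (\<lambda>z. cnj (f z) * f z)"
    using C by (intro integrable_bounded_mult[where C=C] if' borel_measurable_integrable[OF if2]) auto
  have "norm (LINT z|circle_measure. cnj (f z) * f z) \<le> (\<bar>C\<bar> + 1) * e" if "e > 0" for e
  proof -
    obtain h where h: "h \<in> harmonic_poly" "continuous_on (sphere 0 1) h"
        "(LINT z|circle_measure. norm (cnj (f z) - h z)) < e"
      using L1_approx_harmonic_poly[OF if2 \<open>e > 0\<close>] by blast
    have ih: "integrable circle_measure h" by (rule continuous_on_circle_integrable[OF h(2)])
    have ihf: "integrable circle_measure (\<lambda>z. h z * f z)"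
      by (intro integrable_continuous_mult h if')
    have "(LINT z|circle_measure. cnj (f z) * f z) = (LINT z|circle_measure. (cnj (f z) - h z) * f z)"
      using integral_harmonic_poly_mult_eq_0[OF if' 0 h(1)] iff' ihf by (simp add: left_diff_distrib)
    also have "norm \<dots> \<le> (LINT z|circle_measure. norm ((cnj (f z) - h z) * f z))"
      by (rule integral_norm_bound)
    also have "\<dots> \<le> (LINT z|circle_measure. (\<bar>C\<bar> + 1) * norm (cnj (f z) - h z))"
    proof (rule integral_mono_AE)
      show "AE z in circle_measure. norm ((cnj (f z) - h z) * f z) \<le> (\<bar>C\<bar> + 1) * norm (cnj (f z) - h z)"
        using C by eventually_elim (auto simp: norm_mult mult.commute intro!: mult_right_mono)
      show "integrable circle_measure (\<lambda>z. norm ((cnj (f z) - h z) * f z))"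
        using iff' ihf by (simp add: left_diff_distrib)
    qed (use if2 ih in auto)
    also have "\<dots> \<le> (\<bar>C\<bar> + 1) * e" using h(3) by (simp add: mult_left_mono)
    finally show ?thesis .
  qed
  note le = this
  have "norm (LINT z|circle_measure. cnj (f z) * f z) \<le> 0 + e" if "e > 0" for e
  proof -
    have "\<bar>C\<bar> + 1 > 0" by simp
    then show ?thesis using le[of "e / (\<bar>C\<bar> + 1)"] that by simp
  qed
  then have "norm (LINT z|circle_measure. cnj (f z) * f z) \<le> 0"
    by (rule field_le_epsilon)
  then have "(LINT z|circle_measure. cnj (f z) * f z) = 0" by simp
  moreover have sq: "(\<lambda>z. cnj (f z) * f z) = (\<lambda>z. of_real ((norm (f z))\<^sup>2))"
  proof
    show "cnj (f z) * f z = of_real ((norm (f z))\<^sup>2)" for z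
      using complex_norm_square[of "f z"] by (simp add: mult.commute)
  qed
  ultimately have "(LINT z|circle_measure. complex_of_real ((norm (f z))\<^sup>2)) = 0"
    by (simp only: sq)
  then have "(LINT z|circle_measure. (norm (f z))\<^sup>2) = 0"
    by (simp only: integral_complex_of_real of_real_eq_0_iff)
  moreover have "integrable circle_measure (\<lambda>z. (norm (f z))\<^sup>2)"
    using iff' unfolding sq complex_of_real_integrable_eq .
  ultimately have "AE z in circle_measure. (norm (f z))\<^sup>2 = 0"
    by (subst (asm) integral_nonneg_eq_0_iff_AE) auto
  then show ?thesis by eventually_elim simp
qed

lemma hardy_H1_integrable: "f \<in> hardy_H1 \<Longrightarrow> integrable circle_measure f"
  by (simp add: hardy_H1_def)

lemma hardy_H1_measurable: "f \<in> hardy_H1 \<Longrightarrow> f \<in> borel_measurable circle_measure"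
  by (simp add: hardy_H1_def borel_measurable_integrable)

lemma hardy_H1_D: "f \<in> hardy_H1 \<Longrightarrow> k < 0 \<Longrightarrow> fourier_coeff f k = 0"
  by (simp add: hardy_H1_def)

lemma hardy_H1_add: "f \<in> hardy_H1 \<Longrightarrow> g \<in> hardy_H1 \<Longrightarrow> (\<lambda>z. f z + g z) \<in> hardy_H1"
  by (simp add: hardy_H1_def fourier_coeff_add)

lemma hardy_H1_sum: "(\<And>i. i \<in> A \<Longrightarrow> f i \<in> hardy_H1) \<Longrightarrow> (\<lambda>z. \<Sum>i\<in>A. f i z) \<in> hardy_H1"
  by (auto simp: hardy_H1_def fourier_coeff_sum)

lemma hardy_H1_cmult: "f \<in> hardy_H1 \<Longrightarrow> (\<lambda>z. c * f z) \<in> hardy_H1"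
  by (simp add: hardy_H1_def fourier_coeff_cmult)

lemma hardy_H1_cong_AE:
  assumes "f \<in> hardy_H1" "g \<in> borel_measurable circle_measure"
    and "AE z in circle_measure. f z = g z"
  shows "g \<in> hardy_H1"
proof -
  have "integrable circle_measure g"
    using hardy_H1_integrable[OF assms(1)] integrable_cong_AE[OF hardy_H1_measurable[OF assms(1)] assms(2,3)]
    by blast
  moreover have "fourier_coeff f k = fourier_coeff g k" for k
    by (rule fourier_coeff_cong_AE[OF assms(3) hardy_H1_measurable[OF assms(1)] assms(2)])
  ultimately show ?thesis using assms(1) by (simp add: hardy_H1_def)
qed

lemma hardy_H1_poly: "poly p \<in> hardy_H1"
  by (simp add: hardy_H1_def fourier_coeff_poly)

lemma hardy_H1_poly_mult:
  assumes "f \<in> hardy_H1"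
  shows "(\<lambda>z. poly p z * f z) \<in> hardy_H1"
  using assms by (auto simp: hardy_H1_def integrable_poly_mult fourier_coeff_poly_mult intro!: sum.neutral)

lemma fourier_coeff_0_poly_mult:
  assumes "f \<in> hardy_H1"
  shows "fourier_coeff (\<lambda>z. poly p z * f z) 0 = poly p 0 * fourier_coeff f 0"
proof -
  have "(\<Sum>i\<le>degree p. Polynomial.coeff p i * fourier_coeff f (- int i)) =
      (\<Sum>i\<le>degree p. if i = 0 then Polynomial.coeff p 0 * fourier_coeff f 0 else 0)"
    using assms by (intro sum.cong) (auto simp: hardy_H1_D)
  then show ?thesis
    using assms by (simp add: fourier_coeff_poly_mult hardy_H1_integrable poly_0_coeff_0)
qed

lemma fourier_coeff_tendsto:
  assumes "\<And>n. integrable circle_measure (g n)" "integrable circle_measure f"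
    and "(\<lambda>n. LINT z|circle_measure. norm (f z - g n z)) \<longlonglongrightarrow> 0"
  shows "(\<lambda>n. fourier_coeff (g n) k) \<longlonglongrightarrow> fourier_coeff f k"
proof -
  have "(\<lambda>n. fourier_coeff (g n) k - fourier_coeff f k) \<longlonglongrightarrow> 0"
  proof (rule tendsto_0_le[OF assms(3), where K=1])
    have "norm (fourier_coeff (g n) k - fourier_coeff f k) \<le> (LINT z|circle_measure. norm (f z - g n z))" for n
      using norm_fourier_coeff_le[of "\<lambda>z. f z - g n z" k] assms(1)[of n] assms(2)
      by (simp add: fourier_coeff_diff norm_minus_commute)
    then show "\<forall>\<^sub>F n in sequentially. norm (fourier_coeff (g n) k - fourier_coeff f k)
        \<le> norm (LINT z|circle_measure. norm (f z - g n z)) * 1"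
      by simp
  qed
  then show ?thesis by (simp add: LIM_zero_iff)
qed

lemma hardy_H1_L1_limit:
  assumes "\<And>n. g n \<in> hardy_H1" "integrable circle_measure f"
    and "(\<lambda>n. LINT z|circle_measure. norm (f z - g n z)) \<longlonglongrightarrow> 0"
  shows "f \<in> hardy_H1"
proof -
  have "fourier_coeff f k = 0" if "k < 0" for k
  proof -
    have "(\<lambda>n. fourier_coeff (g n) k) \<longlonglongrightarrow> fourier_coeff f k"
      using assms by (intro fourier_coeff_tendsto) (auto simp: hardy_H1_def)
    moreover have "(\<lambda>n. fourier_coeff (g n) k) = (\<lambda>_. 0)"
      using assms(1) that by (auto simp: hardy_H1_def)
    ultimately show ?thesis by (simp add: LIMSEQ_const_iff)
  qed
  with assms(2) show ?thesis by (simp add: hardy_H1_def)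
qed

text \<open>The functions \<open>exp (poly P)\<close> take the place of general outer functions: their modulus is
\<open>exp (Re P)\<close>, and \<open>Re P\<close> can approximate any bounded real function without recourse to conjugate
functions. Both claims pass to the limit from the Taylor polynomials of the exponential.\<close>

lemma hardy_H1_exp_poly_mult:
  assumes g: "g \<in> hardy_H1"
  shows "(\<lambda>z. exp (poly P z) * g z) \<in> hardy_H1"
    and "fourier_coeff (\<lambda>z. exp (poly P z) * g z) 0 = exp (poly P 0) * fourier_coeff g 0"
proof -
  define S where "S n = (\<Sum>k<n. Polynomial.smult (1 / fact k) (P ^ k))" for n
  have S: "poly (S n) z = (\<Sum>k<n. poly P z ^ k /\<^sub>R fact k)" for n z
    by (simp add: S_def poly_sum scaleR_conv_of_real field_simps)
  have lim: "(\<lambda>n. poly (S n) z) \<longlonglongrightarrow> exp (poly P z)" for z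
    unfolding S using exp_converges[of "poly P z"] by (simp add: sums_def)
  have bd: "norm (poly (S n) z) \<le> exp (norm (poly P z))" for n z
  proof -
    have "norm (poly (S n) z) \<le> (\<Sum>k<n. norm (poly P z) ^ k /\<^sub>R fact k)"
      unfolding S by (rule order_trans[OF norm_sum]) (simp add: norm_power divide_inverse)
    also have "\<dots> \<le> exp (norm (poly P z))"
      unfolding exp_def by (intro sum_le_suminf summable_exp_generic) auto
    finally show ?thesis .
  qed
  have ig: "integrable circle_measure g" using g by (rule hardy_H1_integrable)
  note mg [measurable] = hardy_H1_measurable[OF g]
  have iS: "(\<lambda>z. poly (S n) z * g z) \<in> hardy_H1" for n
    by (rule hardy_H1_poly_mult[OF g])
  have ie: "integrable circle_measure (\<lambda>z. exp (poly P z) * g z)"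
    by (intro integrable_continuous_mult ig continuous_intros)
  have iw: "integrable circle_measure (\<lambda>z. 2 * norm (complex_of_real (exp (norm (poly P z))) * g z))"
    by (intro integrable_mult_right integrable_norm integrable_continuous_mult ig continuous_intros)
  have L: "(\<lambda>n. LINT z|circle_measure. norm (exp (poly P z) * g z - poly (S n) z * g z)) \<longlonglongrightarrow>
     (LINT z|circle_measure. 0)"
  proof (rule integral_dominated_convergence[OF _ _ iw])
    show "AE z in circle_measure. (\<lambda>n. norm (exp (poly P z) * g z - poly (S n) z * g z)) \<longlonglongrightarrow> 0"
    proof (rule AE_I2)
      fix z
      have "(\<lambda>n. norm (exp (poly P z) * g z - poly (S n) z * g z)) \<longlonglongrightarrow>
          norm (exp (poly P z) * g z - exp (poly P z) * g z)"
        by (intro tendsto_intros lim)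
      then show "(\<lambda>n. norm (exp (poly P z) * g z - poly (S n) z * g z)) \<longlonglongrightarrow> 0" by simp
    qed
    show "AE z in circle_measure. norm (norm (exp (poly P z) * g z - poly (S n) z * g z))
        \<le> 2 * norm (complex_of_real (exp (norm (poly P z))) * g z)" for n
    proof (rule AE_I2)
      fix z
      have "norm (exp (poly P z) - poly (S n) z) \<le> 2 * exp (norm (poly P z))"
        using norm_triangle_ineq4[of "exp (poly P z)" "poly (S n) z"] bd[of n z] norm_exp[of "poly P z"]
        by linarith
      then have "norm (exp (poly P z) - poly (S n) z) * norm (g z) \<le> 2 * exp (norm (poly P z)) * norm (g z)"
        by (rule mult_right_mono) simp
      then show "norm (norm (exp (poly P z) * g z - poly (S n) z * g z))
        \<le> 2 * norm (complex_of_real (exp (norm (poly P z))) * g z)"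
        by (simp add: norm_mult flip: left_diff_distrib)
    qed
  qed simp_all
  then show "(\<lambda>z. exp (poly P z) * g z) \<in> hardy_H1"
    by (intro hardy_H1_L1_limit[OF iS ie]) simp
  have "(\<lambda>n. fourier_coeff (\<lambda>z. poly (S n) z * g z) 0) \<longlonglongrightarrow> fourier_coeff (\<lambda>z. exp (poly P z) * g z) 0"
    using L by (intro fourier_coeff_tendsto hardy_H1_integrable[OF iS] ie) simp
  moreover have "(\<lambda>n. fourier_coeff (\<lambda>z. poly (S n) z * g z) 0) \<longlonglongrightarrow> exp (poly P 0) * fourier_coeff g 0"
    unfolding fourier_coeff_0_poly_mult[OF g] by (intro tendsto_intros lim)
  ultimately show "fourier_coeff (\<lambda>z. exp (poly P z) * g z) 0 = exp (poly P 0) * fourier_coeff g 0"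
    by (rule LIMSEQ_unique)
qed

section \<open>Outer functions and the theorem of Smirnov\<close>

lemma Re_poly_0_eq_integral: "Re (poly P 0) = (LINT z|circle_measure. Re (poly P z))"
proof -
  have "poly P 0 = (LINT z|circle_measure. poly P z)"
    by (simp add: integral_circle_eq_fourier_coeff fourier_coeff_poly poly_0_coeff_0)
  then show ?thesis using integral_Re[OF integrable_poly, of P] by simp
qed

lemma Re_poly_measurable [measurable]: "(\<lambda>z. Re (poly P z)) \<in> borel_measurable circle_measure"
  by (intro continuous_on_circle_measurable continuous_intros)

lemma integral_Re_poly_tendsto:
  assumes "\<And>n z. norm z = 1 \<Longrightarrow> \<bar>Re (poly (P n) z)\<bar> \<le> N"
    and "AE z in circle_measure. (\<lambda>n. Re (poly (P n) z)) \<longlonglongrightarrow> v z"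
    and "v \<in> borel_measurable circle_measure"
  shows "(\<lambda>n. Re (poly (P n) 0)) \<longlonglongrightarrow> (LINT z|circle_measure. v z)"
  unfolding Re_poly_0_eq_integral
  by (rule integral_dominated_convergence[where w = "\<lambda>_. N"])
     (use assms in \<open>auto intro!: AE_I2\<close>)

text \<open>The inequality behind Szego's theorem. If \<open>v = Re P\<close>, it is the bound of a Fourier coefficient by
the norm, applied to \<open>exp (- P) F\<close>; a bounded \<open>v\<close> is a limit of such real parts.\<close>

lemma hardy_H1_geometric_mean_le:
  fixes v :: "complex \<Rightarrow> real"
  assumes F: "F \<in> hardy_H1"
    and v [measurable]: "v \<in> borel_measurable circle_measure"
    and N: "AE z in circle_measure. \<bar>v z\<bar> \<le> N"
  shows "norm (fourier_coeff F 0) \<le>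
    exp (LINT z|circle_measure. v z) * (LINT z|circle_measure. norm (F z) * exp (- v z))"
proof -
  obtain P :: "nat \<Rightarrow> complex poly" where
    P: "\<And>n z. norm z = 1 \<Longrightarrow> \<bar>Re (poly (P n) z)\<bar> \<le> N + 1"
    "AE z in circle_measure. (\<lambda>n. Re (poly (P n) z)) \<longlonglongrightarrow> v z"
    using AE_approx_Re_poly[OF v N] by blast
  note mF [measurable] = hardy_H1_measurable[OF F]
  have iF: "integrable circle_measure F" by (rule hardy_H1_integrable[OF F])
  have le: "norm (fourier_coeff F 0) \<le>
      exp (Re (poly (P n) 0)) * (LINT z|circle_measure. norm (F z) * exp (- Re (poly (P n) z)))" for n
  proof -
    have "exp (- Re (poly (P n) 0)) * norm (fourier_coeff F 0) =
        norm (fourier_coeff (\<lambda>z. exp (poly (- P n) z) * F z) 0)"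
      by (simp only: hardy_H1_exp_poly_mult(2)[OF F] norm_mult norm_exp_eq_Re) simp
    also have "\<dots> \<le> (LINT z|circle_measure. norm (exp (poly (- P n) z) * F z))"
      by (intro norm_fourier_coeff_le hardy_H1_integrable hardy_H1_exp_poly_mult F)
    also have "\<dots> = (LINT z|circle_measure. norm (F z) * exp (- Re (poly (P n) z)))"
      by (simp only: norm_mult norm_exp_eq_Re) (simp add: mult.commute)
    finally show ?thesis by (simp add: exp_minus field_simps)
  qed
  have "(\<lambda>n. exp (Re (poly (P n) 0)) * (LINT z|circle_measure. norm (F z) * exp (- Re (poly (P n) z))))
      \<longlonglongrightarrow> exp (LINT z|circle_measure. v z) * (LINT z|circle_measure. norm (F z) * exp (- v z))"
  proof (intro tendsto_mult tendsto_exp)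
    show "(\<lambda>n. Re (poly (P n) 0)) \<longlonglongrightarrow> (LINT z|circle_measure. v z)"
      by (rule integral_Re_poly_tendsto[OF P v])
    show "(\<lambda>n. LINT z|circle_measure. norm (F z) * exp (- Re (poly (P n) z))) \<longlonglongrightarrow>
        (LINT z|circle_measure. norm (F z) * exp (- v z))"
    proof (rule integral_dominated_convergence[where w = "\<lambda>z. norm (F z) * exp (N + 1)"])
      show "AE z in circle_measure. (\<lambda>n. norm (F z) * exp (- Re (poly (P n) z))) \<longlonglongrightarrow> norm (F z) * exp (- v z)"
        using P(2) by eventually_elim (intro tendsto_intros)
      show "AE z in circle_measure. norm (norm (F z) * exp (- Re (poly (P n) z))) \<le> norm (F z) * exp (N + 1)" for n
        using AE_circle_unit
      proof eventually_elim
        case (elim z)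
        have "exp (- Re (poly (P n) z)) \<le> exp (N + 1)" using P(1)[OF elim, of n] by simp
        then show ?case by (simp add: abs_mult mult_left_mono)
      qed
    qed (use iF in auto)
  qed
  with le show ?thesis by (intro LIMSEQ_le_const[of _ _ "norm (fourier_coeff F 0)"]) auto
qed

text \<open>Let \<open>v = s\<close> off the zero set \<open>E\<close> of \<open>F\<close> and \<open>v = 0\<close> on it. The previous bound becomes
\<open>exp (- s \<mu>(E))\<close> times the norm of \<open>F\<close>, which tends to \<open>0\<close> as \<open>s\<close> grows, unless \<open>\<mu>(E) = 0\<close>.\<close>

lemma hardy_H1_nonzero_AE:
  assumes F: "F \<in> hardy_H1" and 0: "fourier_coeff F 0 \<noteq> 0"
  shows "AE z in circle_measure. F z \<noteq> 0"
proof -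
  note mF [measurable] = hardy_H1_measurable[OF F]
  define E where "E = {z \<in> space circle_measure. F z = 0}"
  have E [measurable]: "E \<in> sets circle_measure" unfolding E_def by measurable
  define L where "L = (LINT z|circle_measure. norm (F z))"
  have le: "norm (fourier_coeff F 0) \<le> exp (- (s * measure circle_measure E)) * L" for s :: real
  proof -
    define v where "v z = s - s * indicator E z" for z
    have vm [measurable]: "v \<in> borel_measurable circle_measure" unfolding v_def by measurable
    have "\<bar>v z\<bar> \<le> \<bar>s\<bar>" for z by (auto simp: v_def indicator_def)
    then have "norm (fourier_coeff F 0) \<le>
        exp (LINT z|circle_measure. v z) * (LINT z|circle_measure. norm (F z) * exp (- v z))"
      by (intro hardy_H1_geometric_mean_le[where N="\<bar>s\<bar>"] F vm AE_I2)
    also have "(LINT z|circle_measure. v z) = s - s * measure circle_measure E"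
    proof -
      have "E \<inter> sphere 0 1 = E" by (auto simp: E_def)
      then show ?thesis
        unfolding v_def
        by (subst Bochner_Integration.integral_diff)
           (auto intro!: integrable_real_indicator simp: circle.emeasure_eq_measure)
    qed
    also have "(LINT z|circle_measure. norm (F z) * exp (- v z)) = (LINT z|circle_measure. norm (F z) * exp (- s))"
      by (intro Bochner_Integration.integral_cong) (auto simp: v_def E_def indicator_def)
    also have "exp (s - s * measure circle_measure E) * (LINT z|circle_measure. norm (F z) * exp (- s)) =
        (exp (s - s * measure circle_measure E) * exp (- s)) * L"
      by (simp add: L_def)
    also have "exp (s - s * measure circle_measure E) * exp (- s) = exp (- (s * measure circle_measure E))"
      by (simp add: mult_exp_exp)
    finally show ?thesis .
  qed
  have "measure circle_measure E = 0"
  proof (rule ccontr)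
    assume "measure circle_measure E \<noteq> 0"
    then have m: "measure circle_measure E > 0" by (simp add: zero_less_measure_iff)
    have "filterlim (\<lambda>n. real n * measure circle_measure E) at_top sequentially"
      using m by (intro filterlim_at_top_mult_tendsto_pos[OF tendsto_const] filterlim_real_sequentially) auto
    then have "(\<lambda>n. exp (- (real n * measure circle_measure E)) * L) \<longlonglongrightarrow> 0 * L"
      by (intro tendsto_mult tendsto_const filterlim_compose[OF exp_at_bot])
         (simp add: filterlim_uminus_at_bot)
    then have "norm (fourier_coeff F 0) \<le> 0 * L"
      by (rule LIMSEQ_le_const) (use le in auto)
    with 0 show False by simp
  qed
  then have "E \<in> null_sets circle_measure"
    by (simp add: null_sets_def circle.emeasure_eq_measure)
  then have "AE z in circle_measure. z \<notin> E" by (rule AE_not_in)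
  then show ?thesis using AE_space by eventually_elim (simp add: E_def)
qed

lemma poisson_ext_0: "poisson_ext F 0 = fourier_coeff F 0"
  unfolding poisson_ext_def fourier_coeff_def by (intro Bochner_Integration.integral_cong) auto

lemma outer_function_nonzero_AE: "outer_function F \<Longrightarrow> AE z in circle_measure. F z \<noteq> 0"
  by (intro hardy_H1_nonzero_AE) (auto simp: outer_function_def poisson_ext_0)

text \<open>Truncating \<open>ln |F|\<close> at height \<open>N\<close> makes it bounded, so that it is a bounded limit of real parts of
polynomials. The quotients of \<open>|F|\<close> by the exponentials of the truncations are at most
\<open>max 1 |F|\<close>, an integrable bound that does not depend on \<open>N\<close>.\<close>

lemma outer_function_modulus_approx:
  assumes F: "outer_function F" and "e > 0"
  obtains P where "(LINT z|circle_measure. \<bar>norm (F z) * exp (- Re (poly P z)) - 1\<bar>) < e"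
    and "\<bar>Re (poly P 0) - ln (norm (fourier_coeff F 0))\<bar> < e"
proof -
  have FH: "F \<in> hardy_H1" using F by (simp add: outer_function_def)
  note mF [measurable] = hardy_H1_measurable[OF FH]
  have iF: "integrable circle_measure F" by (rule hardy_H1_integrable[OF FH])
  define L where "L z = ln (norm (F z))" for z
  have iL: "integrable circle_measure L" using F by (simp add: outer_function_def L_def[abs_def])
  have mL [measurable]: "L \<in> borel_measurable circle_measure" using iL by auto
  have lam: "ln (norm (fourier_coeff F 0)) = (LINT z|circle_measure. L z)"
    using F by (simp add: outer_function_def L_def[abs_def] poisson_ext_0)
  define v where "v N z = max (- real N) (min (real N) (L z))" for N z
  have mv [measurable]: "v N \<in> borel_measurable circle_measure" for N unfolding v_def by measurable
  have vb: "\<bar>v N z\<bar> \<le> real N" for N z by (auto simp: v_def)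
  have v_ev: "\<forall>\<^sub>F N in sequentially. v N z = L z" for z
    using eventually_ge_at_top[of "nat \<lceil>\<bar>L z\<bar>\<rceil>"]
  proof eventually_elim
    case (elim N)
    then have "\<bar>L z\<bar> \<le> real N" by linarith
    then show ?case by (auto simp: v_def)
  qed
  have "(\<lambda>N. LINT z|circle_measure. v N z) \<longlonglongrightarrow> (LINT z|circle_measure. L z)"
  proof (rule integral_dominated_convergence[where w = "\<lambda>z. \<bar>L z\<bar>"])
    show "AE z in circle_measure. (\<lambda>N. v N z) \<longlonglongrightarrow> L z"
      by (intro AE_I2 tendsto_eventually v_ev)
  qed (use iL in \<open>auto simp: v_def\<close>)
  then have 1: "\<forall>\<^sub>F N in sequentially. dist (LINT z|circle_measure. v N z) (LINT z|circle_measure. L z) < e / 2"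
    using \<open>e > 0\<close> by (intro tendstoD) auto
  have "(\<lambda>N. LINT z|circle_measure. \<bar>norm (F z) * exp (- v N z) - 1\<bar>) \<longlonglongrightarrow> (LINT z|circle_measure. 0)"
  proof (rule integral_dominated_convergence[where w = "\<lambda>z. 1 + norm (F z)"])
    show "AE z in circle_measure. (\<lambda>N. \<bar>norm (F z) * exp (- v N z) - 1\<bar>) \<longlonglongrightarrow> 0"
      using outer_function_nonzero_AE[OF F]
    proof eventually_elim
      case (elim z)
      have "\<forall>\<^sub>F N in sequentially. \<bar>norm (F z) * exp (- v N z) - 1\<bar> = 0"
        using v_ev[of z] by eventually_elim (use elim in \<open>simp add: L_def exp_minus\<close>)
      then show ?case by (rule tendsto_eventually)
    qed
    show "AE z in circle_measure. norm \<bar>norm (F z) * exp (- v N z) - 1\<bar> \<le> 1 + norm (F z)" for N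
      using outer_function_nonzero_AE[OF F]
    proof eventually_elim
      case (elim z)
      have Fe: "norm (F z) = exp (L z)" using elim by (simp add: L_def)
      have "L z - v N z \<le> max 0 (L z)" by (auto simp: v_def)
      then have "exp (L z - v N z) \<le> exp (max 0 (L z))" by simp
      also have "\<dots> \<le> 1 + exp (L z)" by (auto simp: max_def add_increasing)
      finally have "exp (L z - v N z) \<le> 1 + exp (L z)" .
      moreover have "exp (L z - v N z) > 0" "exp (L z) > 0" by auto
      moreover have "norm (F z) * exp (- v N z) = exp (L z - v N z)"
        by (simp add: Fe exp_diff exp_minus field_simps)
      ultimately show ?case using Fe unfolding real_norm_def by linarith
    qed
  qed (use iF in auto)
  then have 2: "\<forall>\<^sub>F N in sequentially. (LINT z|circle_measure. \<bar>norm (F z) * exp (- v N z) - 1\<bar>) < e / 2"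
    using \<open>e > 0\<close> by (intro order_tendstoD(2)[of _ 0]) auto
  obtain N where N: "\<bar>(LINT z|circle_measure. v N z) - (LINT z|circle_measure. L z)\<bar> < e / 2"
      "(LINT z|circle_measure. \<bar>norm (F z) * exp (- v N z) - 1\<bar>) < e / 2"
    using eventually_happens'[OF sequentially_bot eventually_conj[OF 1 2]] by (auto simp: dist_real_def)
  obtain P :: "nat \<Rightarrow> complex poly" where
    P: "\<And>n z. norm z = 1 \<Longrightarrow> \<bar>Re (poly (P n) z)\<bar> \<le> real N + 1"
    "AE z in circle_measure. (\<lambda>n. Re (poly (P n) z)) \<longlonglongrightarrow> v N z"
    using AE_approx_Re_poly[OF mv AE_I2[OF vb]] by blast
  have 3: "\<forall>\<^sub>F n in sequentially. \<bar>Re (poly (P n) 0) - (LINT z|circle_measure. v N z)\<bar> < e / 2"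
    using tendstoD[OF integral_Re_poly_tendsto[OF P mv], of "e / 2"] \<open>e > 0\<close> by (simp add: dist_real_def)
  have "(\<lambda>n. LINT z|circle_measure. \<bar>norm (F z) * exp (- Re (poly (P n) z)) - 1\<bar>) \<longlonglongrightarrow>
      (LINT z|circle_measure. \<bar>norm (F z) * exp (- v N z) - 1\<bar>)"
  proof (rule integral_dominated_convergence[where w = "\<lambda>z. norm (F z) * exp (real N + 1) + 1"])
    show "AE z in circle_measure. (\<lambda>n. \<bar>norm (F z) * exp (- Re (poly (P n) z)) - 1\<bar>) \<longlonglongrightarrow>
        \<bar>norm (F z) * exp (- v N z) - 1\<bar>"
      using P(2) by eventually_elim (intro tendsto_intros)
    show "AE z in circle_measure. norm \<bar>norm (F z) * exp (- Re (poly (P n) z)) - 1\<bar>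
        \<le> norm (F z) * exp (real N + 1) + 1" for n
      using AE_circle_unit
    proof eventually_elim
      case (elim z)
      have "exp (- Re (poly (P n) z)) \<le> exp (real N + 1)" using P(1)[OF elim, of n] by simp
      then have "norm (F z) * exp (- Re (poly (P n) z)) \<le> norm (F z) * exp (real N + 1)"
        by (intro mult_left_mono) auto
      moreover have "norm (F z) * exp (- Re (poly (P n) z)) \<ge> 0" by simp
      ultimately show ?case unfolding real_norm_def by linarith
    qed
  qed (use iF in auto)
  then have 4: "\<forall>\<^sub>F n in sequentially. (LINT z|circle_measure. \<bar>norm (F z) * exp (- Re (poly (P n) z)) - 1\<bar>) < e"
    by (rule order_tendstoD(2)) (use N(2) \<open>e > 0\<close> in linarith)
  obtain n where n: "\<bar>Re (poly (P n) 0) - (LINT z|circle_measure. v N z)\<bar> < e / 2"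
      "(LINT z|circle_measure. \<bar>norm (F z) * exp (- Re (poly (P n) z)) - 1\<bar>) < e"
    using eventually_happens'[OF sequentially_bot eventually_conj[OF 3 4]] by auto
  show thesis
  proof (rule that[of "P n"])
    show "\<bar>Re (poly (P n) 0) - ln (norm (fourier_coeff F 0))\<bar> < e"
      unfolding lam using N(1) n(1) by linarith
  qed (rule n(2))
qed

text \<open>From \<open>|g - 1|\<^sup>2 = (|g| - 1)\<^sup>2 + 2 (|g| - Re g)\<close>. The root of the last term is linearized by the
inequality of the arithmetic and geometric means, with a free parameter \<open>t\<close>, so that it can be integrated.\<close>

lemma norm_diff_1_le:
  fixes g :: complex
  assumes "t > 0"
  shows "norm (g - 1) \<le> \<bar>norm g - 1\<bar> + (norm g - Re g) / t + t / 2"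
proof -
  define s where "s = norm g - Re g"
  have s: "s \<ge> 0" by (simp add: s_def complex_Re_le_cmod)
  have "(norm (g - 1))\<^sup>2 = (norm g - 1)\<^sup>2 + 2 * s"
    by (simp add: s_def cmod_power2 power2_diff)
  then have "norm (g - 1) = sqrt ((norm g - 1)\<^sup>2 + 2 * s)"
    by (metis norm_ge_zero real_sqrt_unique)
  also have "\<dots> \<le> sqrt ((norm g - 1)\<^sup>2) + sqrt (2 * s)"
    using s by (intro sqrt_add_le_add_sqrt) auto
  also have "sqrt (2 * s) \<le> s / t + t / 2"
  proof (rule real_le_lsqrt)
    have "0 \<le> (s / t - t / 2)\<^sup>2" by simp
    also have "\<dots> = (s / t + t / 2)\<^sup>2 - 2 * s"
      using assms by (simp add: power2_eq_square field_simps)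
    finally show "2 * s \<le> (s / t + t / 2)\<^sup>2" by simp
  qed (use s assms in auto)
  finally show ?thesis by (simp add: s_def)
qed

text \<open>If the modulus of \<open>g\<close> is close to \<open>1\<close> in \<open>L\<^sup>1\<close> and its mean is close to \<open>1\<close>, then \<open>|g| - Re g\<close> has a
small integral, and hence \<open>g\<close> itself is close to \<open>1\<close>. The mean is controlled because \<open>F\<close> is outer:
the modulus of the mean of \<open>F\<close> is the exponential of the mean of \<open>ln |F|\<close>.\<close>

lemma outer_function_exp_approx:
  assumes F: "outer_function F" and "e > 0"
  obtains Q where "(LINT z|circle_measure. norm (exp (poly Q z) * F z - 1)) < e"
proof -
  have FH: "F \<in> hardy_H1" using F by (simp add: outer_function_def)
  define c where "c = fourier_coeff F 0"
  have c: "c \<noteq> 0" using F by (simp add: outer_function_def c_def poisson_ext_0)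
  \<comment> \<open>\<open>norm_diff_1_le\<close> will yield the bound \<open>d + 2 d / t + t / 2\<close>; these choices make it \<open>3 e / 4\<close>.\<close>
  define t where "t = e / 2"
  define d where "d = e\<^sup>2 / (2 * (e + 4))"
  have "d > 0" "t > 0" using \<open>e > 0\<close> by (auto simp: d_def t_def)
  have dt: "d + 2 * d / t = e / 2"
    using \<open>e > 0\<close> by (simp add: d_def t_def divide_simps) (simp add: power2_eq_square algebra_simps)
  obtain P where P: "(LINT z|circle_measure. \<bar>norm (F z) * exp (- Re (poly P z)) - 1\<bar>) < d"
      "\<bar>Re (poly P 0) - ln (norm c)\<bar> < d"
    using outer_function_modulus_approx[OF F \<open>d > 0\<close>] unfolding c_def by blast
  \<comment> \<open>Rotate so that the mean of the approximant is positive.\<close>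
  define \<theta> where "\<theta> = Im (poly P 0) - Arg c"
  define Q where "Q = - P + [:\<i> * of_real \<theta>:]"
  define g where "g z = exp (poly Q z) * F z" for z
  have gH: "g \<in> hardy_H1" unfolding g_def by (rule hardy_H1_exp_poly_mult[OF FH])
  have ig: "integrable circle_measure g" by (rule hardy_H1_integrable[OF gH])
  have ng: "norm (g z) = norm (F z) * exp (- Re (poly P z))" for z
    by (simp add: g_def Q_def norm_mult norm_exp_eq_Re)
  have g0: "fourier_coeff g 0 = of_real (exp (ln (norm c) - Re (poly P 0)))"
  proof -
    have "fourier_coeff g 0 = exp (- poly P 0 + \<i> * of_real \<theta>) * c"
      unfolding g_def hardy_H1_exp_poly_mult(2)[OF FH] by (simp add: Q_def c_def)
    also have "c = exp (of_real (ln (norm c)) + \<i> * of_real (Arg c))"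
      using c by (simp add: exp_add exp_of_real Arg_eq)
    also have "exp (- poly P 0 + \<i> * of_real \<theta>) * exp (of_real (ln (norm c)) + \<i> * of_real (Arg c)) =
        exp (- poly P 0 + \<i> * of_real \<theta> + (of_real (ln (norm c)) + \<i> * of_real (Arg c)))"
      by (simp add: mult_exp_exp)
    also have "- poly P 0 + \<i> * of_real \<theta> + (of_real (ln (norm c)) + \<i> * of_real (Arg c)) =
        of_real (ln (norm c) - Re (poly P 0))"
      by (simp add: \<theta>_def complex_eq_iff)
    finally show ?thesis unfolding exp_of_real .
  qed
  have "(LINT z|circle_measure. Re (g z)) = Re (fourier_coeff g 0)"
    using integral_Re[OF ig] by (simp add: integral_circle_eq_fourier_coeff)
  also have "\<dots> \<ge> 1 - d"
    unfolding g0 Re_complex_of_real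
    using P(2) exp_ge_add_one_self[of "ln (norm c) - Re (poly P 0)"] by linarith
  finally have Re: "(LINT z|circle_measure. Re (g z)) \<ge> 1 - d" .
  have A: "(LINT z|circle_measure. \<bar>norm (g z) - 1\<bar>) < d" using P(1) by (simp add: ng)
  have "(LINT z|circle_measure. norm (g z)) \<le> (LINT z|circle_measure. \<bar>norm (g z) - 1\<bar> + 1)"
    using ig by (intro integral_mono) auto
  also have "\<dots> \<le> 1 + d" using A ig by simp
  finally have B: "(LINT z|circle_measure. norm (g z)) \<le> 1 + d" .
  have iRe: "integrable circle_measure (\<lambda>z. Re (g z))" using ig by simp
  have "(LINT z|circle_measure. norm (g z - 1)) \<le>
      (LINT z|circle_measure. \<bar>norm (g z) - 1\<bar> + (norm (g z) - Re (g z)) / t + t / 2)"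
    using ig iRe \<open>t > 0\<close> by (intro integral_mono norm_diff_1_le) auto
  also have "\<dots> = (LINT z|circle_measure. \<bar>norm (g z) - 1\<bar>) +
      ((LINT z|circle_measure. norm (g z)) - (LINT z|circle_measure. Re (g z))) / t + t / 2"
    using ig iRe by simp
  also have "\<dots> \<le> d + (2 * d) / t + t / 2"
    using A B Re \<open>t > 0\<close> by (intro add_mono divide_right_mono) auto
  also have "\<dots> < e" using dt \<open>e > 0\<close> by (simp add: t_def)
  finally show thesis unfolding g_def by (rule that)
qed

text \<open>As \<open>exp Q\<^sub>n F\<close> tends to \<open>1\<close> in \<open>L\<^sup>1\<close> and \<open>\<phi>\<close> is bounded, the functions \<open>exp Q\<^sub>n G\<close>, which lie in
\<open>H\<^sup>1\<close>, tend to \<open>\<phi>\<close>.\<close>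

lemma Smirnov:
  assumes F: "outer_function F" and G: "G \<in> hardy_H1"
    and phi [measurable]: "\<phi> \<in> borel_measurable circle_measure"
    and C: "AE z in circle_measure. norm (\<phi> z) \<le> C"
    and eq: "AE z in circle_measure. G z = \<phi> z * F z"
  shows "\<phi> \<in> hardy_H1"
proof -
  have FH: "F \<in> hardy_H1" using F by (simp add: outer_function_def)
  have "\<exists>Q. (LINT z|circle_measure. norm (exp (poly Q z) * F z - 1)) < 1 / Suc n" for n
    using outer_function_exp_approx[OF F, of "1 / Suc n"] by auto
  then obtain Q where Q: "\<And>n. (LINT z|circle_measure. norm (exp (poly (Q n) z) * F z - 1)) < 1 / Suc n"
    by metis
  have i\<phi>: "integrable circle_measure \<phi>" by (rule bounded_integrable[OF phi C])
  have GH: "(\<lambda>z. exp (poly (Q n) z) * G z) \<in> hardy_H1" for n by (rule hardy_H1_exp_poly_mult[OF G])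
  have iFn: "integrable circle_measure (\<lambda>z. exp (poly (Q n) z) * F z)" for n
    by (intro hardy_H1_integrable hardy_H1_exp_poly_mult FH)
  have le: "(LINT z|circle_measure. norm (\<phi> z - exp (poly (Q n) z) * G z)) \<le> \<bar>C\<bar> * (1 / Suc n)" for n
  proof -
    have "(LINT z|circle_measure. norm (\<phi> z - exp (poly (Q n) z) * G z)) \<le>
        (LINT z|circle_measure. \<bar>C\<bar> * norm (exp (poly (Q n) z) * F z - 1))"
    proof (rule integral_mono_AE)
      show "AE z in circle_measure. norm (\<phi> z - exp (poly (Q n) z) * G z) \<le>
          \<bar>C\<bar> * norm (exp (poly (Q n) z) * F z - 1)"
        using C eq
      proof eventually_elim
        case (elim z)
        have "\<phi> z - exp (poly (Q n) z) * G z = - \<phi> z * (exp (poly (Q n) z) * F z - 1)"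
          by (simp add: elim algebra_simps)
        then have "norm (\<phi> z - exp (poly (Q n) z) * G z) = norm (\<phi> z) * norm (exp (poly (Q n) z) * F z - 1)"
          by (simp only: norm_mult norm_minus_cancel)
        also have "\<dots> \<le> \<bar>C\<bar> * norm (exp (poly (Q n) z) * F z - 1)"
          using elim(1) by (intro mult_right_mono) auto
        finally show ?case .
      qed
    qed (use i\<phi> hardy_H1_integrable[OF GH] iFn in auto)
    also have "\<dots> = \<bar>C\<bar> * (LINT z|circle_measure. norm (exp (poly (Q n) z) * F z - 1))"
      using iFn by simp
    also have "\<dots> \<le> \<bar>C\<bar> * (1 / Suc n)" using less_imp_le[OF Q] by (intro mult_left_mono) auto
    finally show ?thesis .
  qed
  show ?thesis
  proof (rule hardy_H1_L1_limit[OF GH i\<phi>])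
    have "(\<lambda>n. \<bar>C\<bar> * (1 / Suc n)) \<longlonglongrightarrow> \<bar>C\<bar> * 0"
      by (intro tendsto_mult tendsto_const LIMSEQ_Suc lim_1_over_n)
    then have lim: "(\<lambda>n. \<bar>C\<bar> * (1 / Suc n)) \<longlonglongrightarrow> 0" by (simp only: mult_zero_right)
    show "(\<lambda>n. LINT z|circle_measure. norm (\<phi> z - exp (poly (Q n) z) * G z)) \<longlonglongrightarrow> 0"
      by (rule tendsto_sandwich[OF _ _ tendsto_const lim])
         (intro always_eventually allI le Bochner_Integration.integral_nonneg norm_ge_zero)+
  qed
qed

section \<open>Products and quotients in the Hardy space\<close>

text \<open>Convergence holds against trigonometric polynomials, and the common bound extends it to their
\<open>L\<^sup>1\<close> limits.\<close>

lemma fourier_coeff_tendsto_imp_weak_star: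
  assumes d: "\<And>n. d n \<in> borel_measurable circle_measure"
    and C: "\<And>n. AE z in circle_measure. norm (d n z) \<le> C"
    and 0: "\<And>k. (\<lambda>n. fourier_coeff (d n) k) \<longlonglongrightarrow> 0"
    and G: "integrable circle_measure G"
  shows "(\<lambda>n. LINT z|circle_measure. d n z * G z) \<longlonglongrightarrow> 0"
proof (rule LIMSEQ_I)
  fix e :: real assume "e > 0"
  have id: "integrable circle_measure (d n)" for n by (rule bounded_integrable[OF d C])
  have idc: "integrable circle_measure (\<lambda>z. cnj (d n z))" for n using id by simp
  have "e / (2 * (\<bar>C\<bar> + 1)) > 0" using \<open>e > 0\<close> by (simp add: add_nonneg_pos)
  then obtain h where h: "h \<in> harmonic_poly" "continuous_on (sphere 0 1) h"
      "(LINT z|circle_measure. norm (G z - h z)) < e / (2 * (\<bar>C\<bar> + 1))"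
    using L1_approx_harmonic_poly[OF G] by blast
  have ih: "integrable circle_measure h" by (rule continuous_on_circle_integrable[OF h(2)])
  obtain p q where pq: "\<And>z. norm z = 1 \<Longrightarrow> h z = poly p z + cnj (poly q z)"
    using h(1) unfolding harmonic_poly_def by blast
  have "(LINT z|circle_measure. h z * d n z) =
      fourier_coeff (\<lambda>z. poly p z * d n z) 0 + cnj (fourier_coeff (\<lambda>z. poly q z * cnj (d n z)) 0)" for n
  proof -
    have "(LINT z|circle_measure. h z * d n z) =
        fourier_coeff (\<lambda>z. poly p z * d n z + cnj (poly q z * cnj (d n z))) 0"
      unfolding integral_circle_eq_fourier_coeff
      by (intro fourier_coeff_cong) (simp add: pq algebra_simps)
    also have "\<dots> = fourier_coeff (\<lambda>z. poly p z * d n z) 0 +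
        fourier_coeff (\<lambda>z. cnj (poly q z * cnj (d n z))) 0"
      using integrable_poly_mult[OF id] integrable_cnj[OF integrable_poly_mult[OF idc]]
      by (intro fourier_coeff_add) auto
    finally show ?thesis by (simp only: fourier_coeff_cnj) simp
  qed
  moreover have "(\<lambda>n. fourier_coeff (\<lambda>z. poly p z * d n z) 0 + cnj (fourier_coeff (\<lambda>z. poly q z * cnj (d n z)) 0))
      \<longlonglongrightarrow> (\<Sum>i\<le>degree p. Polynomial.coeff p i * 0) + cnj (\<Sum>i\<le>degree q. Polynomial.coeff q i * cnj 0)"
    unfolding fourier_coeff_poly_mult[OF id] fourier_coeff_poly_mult[OF idc] fourier_coeff_cnj
    by (intro tendsto_intros 0)
  ultimately have "(\<lambda>n. LINT z|circle_measure. h z * d n z) \<longlonglongrightarrow> 0" by simp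
  then obtain n0 where "\<forall>n\<ge>n0. norm ((LINT z|circle_measure. h z * d n z) - 0) < e / 2"
    using LIMSEQ_D half_gt_zero[OF \<open>e > 0\<close>] by blast
  then have n0: "\<And>n. n \<ge> n0 \<Longrightarrow> norm (LINT z|circle_measure. h z * d n z) < e / 2" by simp
  show "\<exists>no. \<forall>n\<ge>no. norm ((LINT z|circle_measure. d n z * G z) - 0) < e"
  proof (intro exI[of _ n0] allI impI)
    fix n assume n: "n \<ge> n0"
    have i1: "integrable circle_measure (\<lambda>z. d n z * (G z - h z))"
      using G ih by (intro integrable_bounded_mult[OF _ d C]) auto
    have i2: "integrable circle_measure (\<lambda>z. h z * d n z)"
      by (intro integrable_continuous_mult id h)
    have "(LINT z|circle_measure. d n z * G z) =
        (LINT z|circle_measure. d n z * (G z - h z) + h z * d n z)"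
      by (simp add: algebra_simps)
    also have "\<dots> = (LINT z|circle_measure. d n z * (G z - h z)) + (LINT z|circle_measure. h z * d n z)"
      by (rule Bochner_Integration.integral_add[OF i1 i2])
    finally have eq: "(LINT z|circle_measure. d n z * G z) =
      (LINT z|circle_measure. d n z * (G z - h z)) + (LINT z|circle_measure. h z * d n z)" .
    have "norm (LINT z|circle_measure. d n z * (G z - h z)) \<le>
        (LINT z|circle_measure. norm (d n z * (G z - h z)))" by (rule integral_norm_bound)
    also have "\<dots> \<le> (LINT z|circle_measure. (\<bar>C\<bar> + 1) * norm (G z - h z))"
    proof (rule integral_mono_AE)
      show "AE z in circle_measure. norm (d n z * (G z - h z)) \<le> (\<bar>C\<bar> + 1) * norm (G z - h z)"
        using C[of n] by eventually_elim (auto simp: norm_mult intro!: mult_right_mono)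
    qed (use i1 G ih in auto)
    also have "\<dots> = (\<bar>C\<bar> + 1) * (LINT z|circle_measure. norm (G z - h z))" using G ih by simp
    also have "\<dots> < (\<bar>C\<bar> + 1) * (e / (2 * (\<bar>C\<bar> + 1)))" using h(3) by (intro mult_strict_left_mono) auto
    also have "\<dots> = e / 2"
    proof -
      have "\<bar>C\<bar> + 1 \<noteq> 0" by linarith
      then show ?thesis by (simp add: divide_simps)
    qed
    finally have "norm (LINT z|circle_measure. d n z * (G z - h z)) < e / 2" .
    with n0[OF n] show "norm ((LINT z|circle_measure. d n z * G z) - 0) < e"
      unfolding eq using norm_triangle_ineq[of "LINT z|circle_measure. d n z * (G z - h z)"
          "LINT z|circle_measure. h z * d n z"] by simp
  qed
qed

text \<open>The Cesaro mean of the partial sums, as a double sum: in this shape its kernel is visibly the square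
of the modulus of a geometric sum.\<close>

definition fejer_mean :: "(complex \<Rightarrow> complex) \<Rightarrow> nat \<Rightarrow> complex \<Rightarrow> complex" where
  "fejer_mean u N z = (\<Sum>i<N. \<Sum>j<N. fourier_coeff u (int i - int j) * z powi (int i - int j)) / of_nat N"

lemma integrable_fejer_mean: "integrable circle_measure (fejer_mean u N)"
  unfolding fejer_mean_def divide_inverse
  by (intro continuous_on_circle_integrable continuous_intros continuous_on_circle_powi) auto

text \<open>Convolution with a positive kernel of integral \<open>1\<close> does not increase the bound.\<close>

lemma norm_fejer_mean_le:
  assumes u: "u \<in> borel_measurable circle_measure"
    and C: "AE z in circle_measure. norm (u z) \<le> C"
    and y: "norm y = 1"
  shows "norm (fejer_mean u N y) \<le> C"
proof -
  have C0: "C \<ge> 0"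
  proof (rule ccontr)
    assume "\<not> C \<ge> 0"
    then have "AE z in circle_measure. False"
      by (intro eventually_mono[OF C]) (metis norm_ge_zero order_trans)
    then show False using AE_circle_False by simp
  qed
  have iu: "integrable circle_measure u" by (rule bounded_integrable[OF u C])
  \<comment> \<open>\<open>K\<close> is \<open>N\<close> times the Fejer kernel centred at \<open>y\<close>.\<close>
  define K where "K z = (\<Sum>i<N. \<Sum>j<N. (cnj z powi (int i - int j) * y powi (int i - int j)))" for z
  have Kc: "continuous_on (sphere 0 1) K"
    unfolding K_def by (intro continuous_intros continuous_on_circle_powi) auto
  have Keq: "K z = of_real ((norm (\<Sum>i<N. (cnj z * y) ^ i))\<^sup>2)" if "norm z = 1" for z
  proof -
    define w where "w = cnj z * y"
    have w: "norm w = 1" "w \<noteq> 0" using that y by (auto simp: w_def norm_mult)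
    have "of_real ((norm (\<Sum>i<N. w ^ i))\<^sup>2) = (\<Sum>i<N. w ^ i) * (\<Sum>j<N. cnj w ^ j)"
      using complex_norm_square[of "\<Sum>i<N. w ^ i"] by simp
    also have "\<dots> = (\<Sum>i<N. \<Sum>j<N. w ^ i * cnj w ^ j)" by (simp add: sum_product)
    also have "\<dots> = (\<Sum>i<N. \<Sum>j<N. w powi (int i - int j))"
      by (intro sum.cong refl) (use w in \<open>simp add: cnj_circle power_int_diff field_simps\<close>)
    also have "\<dots> = K z" by (simp add: K_def w_def power_int_mult_distrib)
    finally show ?thesis by (simp add: w_def)
  qed
  have "(\<Sum>i<N. \<Sum>j<N. fourier_coeff u (int i - int j) * y powi (int i - int j)) =
      (LINT z|circle_measure. K z * u z)"
  proof -
    have int: "integrable circle_measure (\<lambda>z. cnj z powi n * u z * y powi n)" for n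
      using integrable_powi_mult(2)[OF iu] by simp
    have "(\<Sum>i<N. \<Sum>j<N. fourier_coeff u (int i - int j) * y powi (int i - int j)) =
        (\<Sum>i<N. \<Sum>j<N. (LINT z|circle_measure. cnj z powi (int i - int j) * u z * y powi (int i - int j)))"
      by (simp add: fourier_coeff_def)
    also have "\<dots> = (LINT z|circle_measure. (\<Sum>i<N. \<Sum>j<N. cnj z powi (int i - int j) * u z * y powi (int i - int j)))"
      using int by (simp add: Bochner_Integration.integral_sum Bochner_Integration.integrable_sum)
    finally show ?thesis
      by (simp only: K_def sum_distrib_right) (simp only: mult_ac)
  qed
  also have "norm \<dots> \<le> (LINT z|circle_measure. norm (K z * u z))" by (rule integral_norm_bound)
  also have "\<dots> \<le> (LINT z|circle_measure. C * Re (K z))"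
  proof (rule integral_mono_AE)
    show "AE z in circle_measure. norm (K z * u z) \<le> C * Re (K z)"
      using C AE_circle_unit
    proof eventually_elim
      case (elim z)
      have K: "norm (K z) = Re (K z)" "0 \<le> Re (K z)"
        by (simp_all only: Keq[OF elim(2)] norm_of_real Re_complex_of_real abs_of_nonneg zero_le_power2)
      from K have "norm (K z * u z) = Re (K z) * norm (u z)" by (simp only: norm_mult)
      also have "\<dots> \<le> Re (K z) * C"
        using elim(1) K(2) by (rule mult_left_mono)
      finally show ?case by (simp add: mult.commute)
    qed
  qed (use continuous_on_circle_integrable[OF Kc] integrable_continuous_mult[OF iu Kc] in auto)
  also have "\<dots> = C * Re (LINT z|circle_measure. K z)"
    using continuous_on_circle_integrable[OF Kc] integral_Re by simp
  also have "(LINT z|circle_measure. K z) = of_nat N"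
  proof -
    have int: "integrable circle_measure (\<lambda>z. cnj z powi n * y powi n)" for n
      using integrable_powi_mult(2)[of "\<lambda>_. 1" n] by simp
    have "(LINT z|circle_measure. cnj z powi n) = (if n = 0 then 1 else 0)" for n
      using fourier_coeff_const[of 1 n] by (simp add: fourier_coeff_def)
    then have "(LINT z|circle_measure. K z) = (\<Sum>i<N. \<Sum>j<N. (if int i - int j = 0 then 1 else 0) * y powi (int i - int j))"
      unfolding K_def using int by (simp add: Bochner_Integration.integral_sum Bochner_Integration.integrable_sum)
    also have "\<dots> = (\<Sum>i<N. \<Sum>j<N. if j = i then 1 else 0)"
      by (intro sum.cong) auto
    finally show ?thesis by simp
  qed
  finally have "norm (\<Sum>i<N. \<Sum>j<N. fourier_coeff u (int i - int j) * y powi (int i - int j)) \<le> C * real N"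
    by simp
  then show ?thesis
    using C0 by (cases "N = 0") (simp_all add: fejer_mean_def norm_divide divide_simps)
qed

lemma fourier_coeff_fejer_mean:
  assumes "int N > \<bar>k\<bar>"
  shows "fourier_coeff (fejer_mean u N) k = (1 - real_of_int \<bar>k\<bar> / N) * fourier_coeff u k"
proof -
  have N: "N \<noteq> 0" using assms by auto
  have c: "fourier_coeff (\<lambda>z. a * z powi n) k = (if n = k then a else 0)" for a n
    using fourier_coeff_cmult[of a "\<lambda>z. z powi n" k] by (simp add: fourier_coeff_powi)
  have int: "integrable circle_measure (\<lambda>z. a * z powi n)" for a n
    by (intro continuous_on_circle_integrable continuous_intros continuous_on_circle_powi) auto
  have "fourier_coeff (fejer_mean u N) k =
      fourier_coeff (\<lambda>z. (1 / of_nat N) * (\<Sum>i<N. \<Sum>j<N. fourier_coeff u (int i - int j) * z powi (int i - int j))) k"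
    by (intro arg_cong2[of _ _ _ _ fourier_coeff] ext) (simp_all add: fejer_mean_def)
  also have "\<dots> = (1 / of_nat N) * (\<Sum>i<N. \<Sum>j<N. if int i - int j = k then fourier_coeff u (int i - int j) else 0)"
    unfolding fourier_coeff_cmult
    by (simp add: fourier_coeff_sum int Bochner_Integration.integrable_sum c)
  also have "(\<Sum>i<N. \<Sum>j<N. if int i - int j = k then fourier_coeff u (int i - int j) else 0) =
      (\<Sum>i<N. \<Sum>j<N. if int i - int j = k then fourier_coeff u k else 0)"
    by (intro sum.cong) auto
  also have "\<dots> = (\<Sum>(i, j)\<in>{..<N} \<times> {..<N}. if int i - int j = k then fourier_coeff u k else 0)"
    by (simp add: sum.cartesian_product)
  also have "\<dots> = (\<Sum>(i, j)\<in>{(i, j). i < N \<and> j < N \<and> int i - int j = k}. fourier_coeff u k)"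
    by (rule sum.mono_neutral_cong_right) (auto split: if_splits)
  also have "\<dots> = of_nat (card {(i, j). i < N \<and> j < N \<and> int i - int j = k}) * fourier_coeff u k"
    by (simp add: case_prod_unfold)
  also have "card {(i, j). i < N \<and> j < N \<and> int i - int j = k} = card {nat \<bar>k\<bar>..<N}"
  proof (rule bij_betw_same_card)
    show "bij_betw (\<lambda>(i, j). max i j) {(i, j). i < N \<and> j < N \<and> int i - int j = k} {nat \<bar>k\<bar>..<N}"
      by (rule bij_betwI[where g = "\<lambda>n. if k \<ge> 0 then (n, n - nat k) else (n - nat (- k), n)"])
         (auto split: if_splits)
  qed
  also have "of_nat (card {nat \<bar>k\<bar>..<N}) = complex_of_real (real N - real_of_int \<bar>k\<bar>)"
  proof -
    have "real (N - nat \<bar>k\<bar>) = real N - real_of_int \<bar>k\<bar>" using assms by (simp add: of_nat_diff)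
    then show ?thesis unfolding card_atLeastLessThan by (metis of_real_of_nat_eq)
  qed
  finally show ?thesis using N by (simp add: field_simps)
qed

text \<open>The Fejer means of \<open>u\<close> are analytic polynomials with a common bound, and they converge weakly
to \<open>u\<close>. Thus each coefficient of \<open>u f\<close> is a limit of coefficients of elements of \<open>H\<^sup>1\<close>.\<close>

lemma hardy_H1_bounded_mult:
  assumes uH: "u \<in> hardy_H1" and C: "AE z in circle_measure. norm (u z) \<le> C"
    and f: "f \<in> hardy_H1"
  shows "(\<lambda>z. u z * f z) \<in> hardy_H1"
proof -
  have u [measurable]: "u \<in> borel_measurable circle_measure" by (rule hardy_H1_measurable[OF uH])
  have iu: "integrable circle_measure u" by (rule hardy_H1_integrable[OF uH])
  have iF: "integrable circle_measure f" by (rule hardy_H1_integrable[OF f])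
  have fm [measurable]: "fejer_mean u N \<in> borel_measurable circle_measure" for N
    using integrable_fejer_mean by auto
  have fb: "AE z in circle_measure. norm (fejer_mean u N z) \<le> C" for N
    using AE_circle_unit by eventually_elim (rule norm_fejer_mean_le[OF u C])
  have i1: "integrable circle_measure (\<lambda>z. fejer_mean u N z * f z)" for N
    by (rule integrable_bounded_mult[OF iF fm fb])
  have i2: "integrable circle_measure (\<lambda>z. u z * f z)"
    by (rule integrable_bounded_mult[OF iF u C])
  \<comment> \<open>The Fejer means of an analytic function are analytic polynomials.\<close>
  have poly: "(\<lambda>z. fejer_mean u N z * f z) \<in> hardy_H1" for N
  proof -
    define p where "p = (\<Sum>i<N. \<Sum>j<N. if j \<le> i then Polynomial.monom (fourier_coeff u (int i - int j)) (i - j) else 0)"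
    have "poly p z = (\<Sum>i<N. \<Sum>j<N. fourier_coeff u (int i - int j) * z powi (int i - int j))" for z
      unfolding p_def poly_sum
    proof (intro sum.cong refl)
      fix i j
      show "poly (if j \<le> i then Polynomial.monom (fourier_coeff u (int i - int j)) (i - j) else 0) z =
          fourier_coeff u (int i - int j) * z powi (int i - int j)"
      proof (cases "j \<le> i")
        case True
        then have ij: "int i - int j = int (i - j)" by simp
        from True show ?thesis unfolding ij by (simp add: poly_monom del: of_nat_diff)
      next
        case False
        then show ?thesis using hardy_H1_D[OF uH] by simp
      qed
    qed
    then have "fejer_mean u N = (\<lambda>z. (1 / of_nat N) * poly p z)"
      by (simp add: fun_eq_iff fejer_mean_def)
    then have "(\<lambda>z. fejer_mean u N z * f z) = (\<lambda>z. (1 / of_nat N) * (poly p z * f z))"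
      by (simp add: mult.assoc)
    also have "\<dots> \<in> hardy_H1" by (intro hardy_H1_cmult hardy_H1_poly_mult f)
    finally show ?thesis .
  qed
  have lim: "(\<lambda>N. fourier_coeff (\<lambda>z. fejer_mean u N z - u z) k) \<longlonglongrightarrow> 0" for k
  proof -
    have "(\<lambda>N. complex_of_real (1 - real_of_int \<bar>k\<bar> / real N) * fourier_coeff u k - fourier_coeff u k) \<longlonglongrightarrow>
        complex_of_real (1 - 0) * fourier_coeff u k - fourier_coeff u k"
      by (intro tendsto_diff tendsto_mult tendsto_of_real tendsto_const lim_const_over_n)
    moreover have "\<forall>\<^sub>F N in sequentially. complex_of_real (1 - real_of_int \<bar>k\<bar> / real N) * fourier_coeff u k - fourier_coeff u k =
        fourier_coeff (\<lambda>z. fejer_mean u N z - u z) k"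
      using eventually_gt_at_top[of "nat \<bar>k\<bar>"]
    proof eventually_elim
      case (elim N)
      then show ?case
        using fourier_coeff_fejer_mean[of k N u] by (simp add: fourier_coeff_diff integrable_fejer_mean iu)
    qed
    ultimately have "(\<lambda>N. fourier_coeff (\<lambda>z. fejer_mean u N z - u z) k) \<longlonglongrightarrow>
        complex_of_real (1 - 0) * fourier_coeff u k - fourier_coeff u k"
      by (rule Lim_transform_eventually)
    then show ?thesis by simp
  qed
  have "fourier_coeff (\<lambda>z. u z * f z) k = 0" if "k < 0" for k
  proof -
    have "(\<lambda>N. LINT z|circle_measure. (fejer_mean u N z - u z) * (cnj z powi k * f z)) \<longlonglongrightarrow> 0"
    proof (rule fourier_coeff_tendsto_imp_weak_star[where C = "C + C"])
      show "AE z in circle_measure. norm (fejer_mean u N z - u z) \<le> C + C" for N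
        using fb[of N] C by eventually_elim (metis add_mono norm_triangle_ineq4 order_trans)
    qed (use lim integrable_powi_mult(2)[OF iF] in auto)
    moreover have "(LINT z|circle_measure. (fejer_mean u N z - u z) * (cnj z powi k * f z)) =
        - fourier_coeff (\<lambda>z. u z * f z) k" for N
    proof -
      have "(LINT z|circle_measure. (fejer_mean u N z - u z) * (cnj z powi k * f z)) =
          fourier_coeff (\<lambda>z. fejer_mean u N z * f z - u z * f z) k"
        unfolding fourier_coeff_def by (intro Bochner_Integration.integral_cong) (auto simp: algebra_simps)
      then show ?thesis using i1 i2 hardy_H1_D[OF poly that] by (simp add: fourier_coeff_diff)
    qed
    ultimately show ?thesis by (simp add: LIMSEQ_const_iff)
  qed
  with i2 show ?thesis by (simp add: hardy_H1_def)
qed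

text \<open>The coefficients \<open>c\<^sub>k\<close> of \<open>g\<close> satisfy \<open>c\<^sub>k\<^sub>-\<^sub>1 = b c\<^sub>k\<close> for \<open>k < 0\<close>. As \<open>|b| \<ge> 1\<close>, their moduli do not
decrease when \<open>k\<close> goes to minus infinity, which contradicts the Riemann-Lebesgue lemma unless all
of them vanish. This argument includes roots on the circle.\<close>

lemma hardy_H1_linear_division:
  assumes g: "integrable circle_measure g" and b: "norm b \<ge> 1"
    and H: "(\<lambda>z. (z - b) * g z) \<in> hardy_H1"
  shows "g \<in> hardy_H1"
proof -
  have rec: "fourier_coeff g (k - 1) = b * fourier_coeff g k" if "k < 0" for k
  proof -
    have "0 = fourier_coeff (\<lambda>z. (z - b) * g z) k" using hardy_H1_D[OF H that] by simp
    also have "\<dots> = fourier_coeff (\<lambda>z. z * g z - b * g z) k" by (simp add: algebra_simps)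
    also have "\<dots> = fourier_coeff g (k - 1) - b * fourier_coeff g k"
      using integrable_powi_mult(1)[OF g, of 1] g
      by (subst fourier_coeff_diff) (auto simp: fourier_coeff_cmult fourier_coeff_id_mult)
    finally show ?thesis by simp
  qed
  have mono: "norm (fourier_coeff g k) \<le> norm (fourier_coeff g (k - int n))" if "k < 0" for k n
  proof (induction n)
    case (Suc n)
    have "norm (fourier_coeff g (k - int n)) \<le> norm b * norm (fourier_coeff g (k - int n))"
      using b by (simp add: mult_le_cancel_right1)
    also have "\<dots> = norm (fourier_coeff g (k - int n - 1))"
      using rec[of "k - int n"] that by (simp add: norm_mult)
    also have "k - int n - 1 = k - int (Suc n)" by simp
    finally show ?case using Suc by linarith
  qed simp
  have "fourier_coeff g k = 0" if "k < 0" for k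
  proof -
    have "(\<lambda>n. fourier_coeff g (- int (n + nat (- k)))) \<longlonglongrightarrow> 0"
      by (rule LIMSEQ_ignore_initial_segment[OF Riemann_Lebesgue[OF g]])
    moreover have "- int (n + nat (- k)) = k - int n" for n using that by simp
    ultimately have "(\<lambda>n. norm (fourier_coeff g (k - int n))) \<longlonglongrightarrow> 0"
      by (simp only: tendsto_norm_zero_iff)
    then have "norm (fourier_coeff g k) \<le> 0"
      by (rule LIMSEQ_le_const) (use mono[OF that] in auto)
    then show ?thesis by simp
  qed
  with g show ?thesis by (simp add: hardy_H1_def)
qed

lemma hardy_H1_poly_division:
  assumes "integrable circle_measure g" "W \<noteq> 0" "\<And>b. poly W b = 0 \<Longrightarrow> norm b \<ge> 1"
    and "(\<lambda>z. poly W z * g z) \<in> hardy_H1"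
  shows "g \<in> hardy_H1"
  using assms
proof (induction "degree W" arbitrary: W g)
  case 0
  then obtain c where W: "W = [:c:]" "c \<noteq> 0" by (metis degree_eq_zeroE pCons_0_0)
  then have "(\<lambda>z. (1 / c) * (poly W z * g z)) \<in> hardy_H1" using 0 by (intro hardy_H1_cmult)
  with W show ?case by simp
next
  case (Suc n)
  then have "\<not> constant (poly W)" by (simp add: constant_degree)
  then obtain b where b: "poly W b = 0" using fundamental_theorem_of_algebra by blast
  then obtain V where V: "W = [:- b, 1:] * V" by (auto simp: poly_eq_0_iff_dvd elim: dvdE)
  have V0: "V \<noteq> 0" using V Suc by auto
  have "degree W = Suc (degree V)" using V0 unfolding V by (subst degree_mult_eq) auto
  then have dV: "n = degree V" using Suc by simp
  have iV: "integrable circle_measure (\<lambda>z. poly V z * g z)" by (rule integrable_poly_mult) fact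
  have "(\<lambda>z. (z - b) * (poly V z * g z)) \<in> hardy_H1"
    using Suc.prems(4) by (simp add: V algebra_simps)
  then have "(\<lambda>z. poly V z * g z) \<in> hardy_H1"
    using Suc.prems(3)[OF b] by (intro hardy_H1_linear_division[OF iV])
  moreover have "norm b' \<ge> 1" if "poly V b' = 0" for b'
    using Suc.prems(3)[of b'] that by (simp add: V)
  ultimately show ?case using Suc.hyps(1)[OF dV Suc.prems(1) V0] by blast
qed

section \<open>Rational inner functions\<close>

lemma hardy_H1_cnj_imp_const:
  assumes u: "u \<in> hardy_H1" and cu: "(\<lambda>z. cnj (u z)) \<in> hardy_H1"
    and C: "AE z in circle_measure. norm (u z) \<le> C"
  obtains c where "AE z in circle_measure. u z = c"
proof -
  define c where "c = fourier_coeff u 0"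
  have um [measurable]: "u \<in> borel_measurable circle_measure" by (rule hardy_H1_measurable[OF u])
  have iu: "integrable circle_measure u" by (rule hardy_H1_integrable[OF u])
  have "fourier_coeff u k = 0" if "k > 0" for k
    using hardy_H1_D[OF cu, of "- k"] that by (simp add: fourier_coeff_cnj)
  then have "fourier_coeff (\<lambda>z. u z - c) k = 0" for k
    using hardy_H1_D[OF u] iu
    by (cases k "0 :: int" rule: linorder_cases) (simp_all add: fourier_coeff_diff fourier_coeff_const c_def)
  moreover have "AE z in circle_measure. norm (u z - c) \<le> C + norm c"
    using C by eventually_elim (metis add_mono norm_triangle_ineq4 order_refl order_trans)
  ultimately have "AE z in circle_measure. u z - c = 0"
    by (intro bounded_fourier_unique[where C = "C + norm c"]) auto
  then have "AE z in circle_measure. u z = c" by eventually_elim simp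
  then show thesis by (rule that)
qed

lemma circle_minus_eq:
  assumes "norm z = 1"
  shows "z - a = z * cnj (1 - cnj a * z)"
proof -
  have "z * cnj z = 1" using complex_norm_square[of z] assms by simp
  then show ?thesis by (simp add: right_diff_distrib flip: mult.assoc)
qed

lemma one_minus_cnj_mult_nonzero:
  assumes "norm a < 1" "norm z \<le> 1"
  shows "1 - cnj a * z \<noteq> 0"
proof
  assume "1 - cnj a * z = 0"
  then have "norm (cnj a * z) = 1" by simp
  moreover have "norm a * norm z \<le> norm a * 1" using assms by (intro mult_left_mono) auto
  ultimately show False using assms by (simp add: norm_mult)
qed

lemma blaschke_circle:
  assumes "norm z = 1"
  shows "blaschke c m a z = c * z ^ m * (\<Prod>j = 1..m. cnj (1 - cnj (a j) * z) / (1 - cnj (a j) * z))"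
proof -
  have "(\<Prod>j = 1..m. (z - a j) / (1 - cnj (a j) * z)) =
      (\<Prod>j = 1..m. z * (cnj (1 - cnj (a j) * z) / (1 - cnj (a j) * z)))"
    by (intro prod.cong refl) (use circle_minus_eq[OF assms] in simp)
  also have "\<dots> = z ^ m * (\<Prod>j = 1..m. cnj (1 - cnj (a j) * z) / (1 - cnj (a j) * z))"
    by (simp only: prod.distrib prod_constant card_atLeastAtMost) simp
  finally show ?thesis by (simp add: blaschke_def)
qed

lemma norm_blaschke_circle:
  assumes "norm z = 1" "norm c = 1" "\<forall>j\<in>{1..m}. norm (a j) < 1"
  shows "norm (blaschke c m a z) = 1"
proof -
  have "norm (cnj (1 - cnj (a j) * z) / (1 - cnj (a j) * z)) = 1" if "j \<in> {1..m}" for j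
    using one_minus_cnj_mult_nonzero[of "a j" z] assms that
    by (simp only: norm_divide complex_mod_cnj) simp
  then show ?thesis
    by (simp add: blaschke_circle assms norm_mult norm_power prod_norm[symmetric] del: complex_cnj_diff complex_cnj_mult)
qed

lemma continuous_on_blaschke:
  assumes "\<forall>j\<in>{1..m}. norm (a j) < 1"
  shows "continuous_on (sphere 0 1) (blaschke c m a)"
  unfolding blaschke_def
  by (intro continuous_intros) (use one_minus_cnj_mult_nonzero assms in force)

text \<open>Morally \<open>P b = (b - b) g b = 0\<close>. On coefficients, with \<open>c\<^sub>n\<close> the coefficient of \<open>g\<close> at \<open>n - 1\<close>,
the sum of \<open>(c\<^sub>n - b c\<^sub>n\<^sub>+\<^sub>1) b ^ n\<close> telescopes, and its remainder tends to \<open>0\<close> because \<open>|b| < 1\<close>.\<close>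

lemma hardy_H1_quotient_root:
  assumes g: "g \<in> hardy_H1" and b: "norm b < 1"
    and eq: "AE z in circle_measure. (z - b) * g z = poly P z"
  shows "poly P b = 0"
proof -
  have ig: "integrable circle_measure g" by (rule hardy_H1_integrable[OF g])
  define c where "c n = fourier_coeff g (int n - 1)" for n
  have P: "Polynomial.coeff P n = c n - b * c (Suc n)" for n
  proof -
    have "Polynomial.coeff P n = fourier_coeff (poly P) (int n)" by (simp add: fourier_coeff_poly)
    also have "\<dots> = fourier_coeff (\<lambda>z. (z - b) * g z) (int n)"
      by (rule fourier_coeff_cong_AE)
         (use eq hardy_H1_measurable[OF g] in \<open>auto intro!: borel_measurable_integrable elim: eventually_mono\<close>)
    also have "\<dots> = fourier_coeff (\<lambda>z. z * g z - b * g z) (int n)" by (simp add: algebra_simps)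
    also have "\<dots> = fourier_coeff g (int n - 1) - b * fourier_coeff g (int n)"
      using integrable_powi_mult(1)[OF ig, of 1] ig
      by (subst fourier_coeff_diff) (auto simp: fourier_coeff_cmult fourier_coeff_id_mult)
    finally show ?thesis by (simp add: c_def)
  qed
  have c0: "c 0 = 0" using hardy_H1_D[OF g] by (simp add: c_def)
  have tele: "(\<Sum>n<N. Polynomial.coeff P n * b ^ n) = - c N * b ^ N" for N
    by (induction N) (simp_all add: c0 P algebra_simps)
  have val: "poly P b = - c N * b ^ N" if "N > degree P" for N
  proof -
    have "poly P b = (\<Sum>n\<le>degree P. Polynomial.coeff P n * b ^ n)" by (rule poly_altdef)
    also have "\<dots> = (\<Sum>n<N. Polynomial.coeff P n * b ^ n)"
      using that by (intro sum.mono_neutral_left) (auto simp: coeff_eq_0)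
    finally show ?thesis by (simp add: tele)
  qed
  have "(\<lambda>N. (LINT z|circle_measure. norm (g z)) * norm b ^ N) \<longlonglongrightarrow> (LINT z|circle_measure. norm (g z)) * 0"
    using b by (intro tendsto_mult tendsto_const LIMSEQ_power_zero) auto
  moreover have "\<forall>\<^sub>F N in sequentially. norm (poly P b) \<le> (LINT z|circle_measure. norm (g z)) * norm b ^ N"
    using eventually_gt_at_top[of "degree P"]
  proof eventually_elim
    case (elim N)
    have "norm (c N) \<le> (LINT z|circle_measure. norm (g z))"
      unfolding c_def by (rule norm_fourier_coeff_le[OF ig])
    then show ?case by (simp add: val[OF elim] norm_mult norm_power mult_right_mono)
  qed
  ultimately have "norm (poly P b) \<le> (LINT z|circle_measure. norm (g z)) * 0"
    by (rule tendsto_lowerbound) simp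
  then show ?thesis by simp
qed

lemma poly_root_factor:
  fixes P :: "complex poly"
  assumes "poly P b = 0"
  obtains V where "P = [:- b, 1:] * V" "P \<noteq> 0 \<Longrightarrow> degree P = Suc (degree V)"
proof -
  obtain V where V: "P = [:- b, 1:] * V" using assms by (auto simp: poly_eq_0_iff_dvd elim: dvdE)
  show thesis
  proof (rule that[OF V])
    assume "P \<noteq> 0"
    then have "V \<noteq> 0" using V by auto
    then show "degree P = Suc (degree V)" unfolding V by (subst degree_mult_eq) auto
  qed
qed

text \<open>As \<open>I\<close> is analytic, a zero of the denominator in the disc is also a zero of the numerator.\<close>

lemma cancel_denominator_roots:
  assumes "I \<in> hardy_H1" "Q \<noteq> 0" "AE z in circle_measure. poly Q z * I z = poly P z"
  shows "\<exists>Q' P'. Q' \<noteq> 0 \<and> (\<forall>b. poly Q' b = 0 \<longrightarrow> norm b \<ge> 1) \<and>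
    (AE z in circle_measure. poly Q' z * I z = poly P' z)"
  using assms
proof (induction "degree Q" arbitrary: Q P rule: less_induct)
  case less
  show ?case
  proof (cases "\<exists>b. poly Q b = 0 \<and> norm b < 1")
    case True
    then obtain b where b: "poly Q b = 0" "norm b < 1" by blast
    obtain V where V: "Q = [:- b, 1:] * V" "degree Q = Suc (degree V)"
      using poly_root_factor[OF b(1)] less.prems(2) by metis
    have V0: "V \<noteq> 0" using V less.prems by auto
    have "AE z in circle_measure. (z - b) * (poly V z * I z) = poly P z"
      using less.prems(3) by eventually_elim (simp add: V algebra_simps)
    then have "poly P b = 0"
      by (rule hardy_H1_quotient_root[OF hardy_H1_poly_mult[OF less.prems(1)] b(2)])
    then obtain R where R: "P = [:- b, 1:] * R" by (rule poly_root_factor)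
    have "AE z in circle_measure. poly V z * I z = poly R z"
      using less.prems(3) AE_circle_unit
    proof eventually_elim
      case (elim z)
      have "z - b \<noteq> 0" using elim(2) b(2) by auto
      moreover have "(z - b) * (poly V z * I z) = (z - b) * poly R z"
        using elim(1) by (simp add: V R algebra_simps)
      ultimately show ?case by simp
    qed
    with V V0 less.prems(1) show ?thesis by (intro less.hyps[of V R]) auto
  next
    case False
    with less.prems show ?thesis by (intro exI[of _ Q] exI[of _ P]) (auto simp: not_less)
  qed
qed

lemma factor_disc_roots:
  fixes P :: "complex poly"
  assumes "P \<noteq> 0"
  shows "\<exists>m a R. P = (\<Prod>j = 1..m::nat. [:- a j, 1:]) * R \<and> (\<forall>j\<in>{1..m}. norm (a j) < 1) \<and>
    R \<noteq> 0 \<and> (\<forall>b. poly R b = 0 \<longrightarrow> norm b \<ge> 1)"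
  using assms
proof (induction "degree P" arbitrary: P rule: less_induct)
  case less
  show ?case
  proof (cases "\<exists>b. poly P b = 0 \<and> norm b < 1")
    case True
    then obtain b where b: "poly P b = 0" "norm b < 1" by blast
    obtain V where V: "P = [:- b, 1:] * V" "degree P = Suc (degree V)"
      using poly_root_factor[OF b(1)] less.prems by metis
    have "V \<noteq> 0" "degree V < degree P" using V less.prems by auto
    from less.hyps[OF this(2,1)] obtain m a R where R: "V = (\<Prod>j = 1..m::nat. [:- a j, 1:]) * R"
        "\<forall>j\<in>{1..m}. norm (a j) < 1" "R \<noteq> 0" "\<forall>b. poly R b = 0 \<longrightarrow> norm b \<ge> 1"
      by blast
    define a' where "a' = a(Suc m := b)"
    have "(\<Prod>j = 1..m. [:- a' j, 1:]) = (\<Prod>j = 1..m. [:- a j, 1:])"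
      by (intro prod.cong) (auto simp: a'_def)
    then have "P = (\<Prod>j = 1..Suc m. [:- a' j, 1:]) * R"
      by (simp add: V R(1) a'_def mult_ac)
    moreover have "\<forall>j\<in>{1..Suc m}. norm (a' j) < 1"
      using R(2) b(2) by (auto simp: a'_def)
    ultimately show ?thesis using R(3,4) by blast
  next
    case False
    with less.prems show ?thesis
      by (intro exI[of _ 0] exI[of _ undefined] exI[of _ P]) (auto simp: not_less)
  qed
qed

text \<open>Let \<open>B\<close> be the Blaschke product of the zeros of the numerator in the disc and put
\<open>u = I / B\<close>, which has modulus \<open>1\<close>. Neither the numerator nor the denominator of \<open>u\<close> has zeros in
the disc, so that \<open>u\<close> and \<open>1 / u = cnj u\<close> are both in \<open>H\<^sup>1\<close>, and \<open>u\<close> is constant.\<close>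

lemma rational_inner_imp_blaschke:
  assumes I: "I \<in> hardy_H1" and I1: "AE z in circle_measure. norm (I z) = 1"
    and Q: "Q \<noteq> 0" and eq: "AE z in circle_measure. poly Q z * I z = poly P z"
  shows "\<exists>c m a. is_blaschke_rep I c m a"
proof -
  obtain Q' P' where Q': "Q' \<noteq> 0" "\<And>b. poly Q' b = 0 \<Longrightarrow> norm b \<ge> 1"
    and eq': "AE z in circle_measure. poly Q' z * I z = poly P' z"
    using cancel_denominator_roots[OF I Q eq] by blast
  have Im [measurable]: "I \<in> borel_measurable circle_measure" by (rule hardy_H1_measurable[OF I])
  have "P' \<noteq> 0"
  proof
    assume "P' = 0"
    have "poly Q' 0 \<noteq> 0" using Q'(2)[of 0] by auto
    then have "AE z in circle_measure. poly Q' z \<noteq> 0"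
      by (intro hardy_H1_nonzero_AE hardy_H1_poly) (simp add: fourier_coeff_poly poly_0_coeff_0)
    with eq' I1 have "AE z in circle_measure. False"
      by eventually_elim (auto simp: \<open>P' = 0\<close>)
    then show False using AE_circle_False by simp
  qed
  then obtain m a R where P': "P' = (\<Prod>j = 1..m::nat. [:- a j, 1:]) * R"
    and a: "\<forall>j\<in>{1..m}. norm (a j) < 1" and R: "R \<noteq> 0" "\<And>b. poly R b = 0 \<Longrightarrow> norm b \<ge> 1"
    using factor_disc_roots by blast
  define B where "B = blaschke 1 m a"
  define A D where "A = (\<Prod>j = 1..m. [:- a j, 1:])" and "D = (\<Prod>j = 1..m. [:1, - cnj (a j):])"
  have Bc: "continuous_on (sphere 0 1) B" unfolding B_def by (rule continuous_on_blaschke[OF a])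
  have B1: "norm (B z) = 1" if "norm z = 1" for z
    unfolding B_def using that a by (intro norm_blaschke_circle) auto
  have D0: "poly D z \<noteq> 0" if "norm z \<le> 1" for z
    using one_minus_cnj_mult_nonzero[OF _ that] a by (auto simp: D_def poly_prod mult.commute)
  have ABD: "poly A z = B z * poly D z" if "norm z = 1" for z
  proof -
    have "B z = poly A z / poly D z"
      by (simp add: B_def blaschke_def A_def D_def poly_prod prod_dividef mult.commute)
    then show ?thesis using D0[of z] that by simp
  qed
  have D: "D \<noteq> 0" using D0[of 0] by auto
  \<comment> \<open>Once its zeros in the disc are divided out, \<open>I\<close> and its reciprocal are both analytic.\<close>
  define u where "u z = cnj (B z) * I z" for z
  have BcB: "cnj (B z) * B z = 1" if "norm z = 1" for z
    using complex_norm_square[of "B z"] B1[OF that] by (simp add: mult.commute)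
  have iu: "integrable circle_measure u"
    unfolding u_def by (intro integrable_continuous_mult hardy_H1_integrable[OF I] continuous_intros Bc)
  then have um [measurable]: "u \<in> borel_measurable circle_measure" by simp
  have icu: "integrable circle_measure (\<lambda>z. cnj (u z))" using iu by simp
  have u1: "AE z in circle_measure. norm (u z) = 1"
    using I1 AE_circle_unit by eventually_elim (simp add: u_def norm_mult B1)
  have ueq: "AE z in circle_measure. poly Q' z * u z = poly (D * R) z"
    using eq' AE_circle_unit
  proof eventually_elim
    case (elim z)
    have "poly Q' z * u z = cnj (B z) * poly P' z" using elim(1) by (simp add: u_def)
    also have "P' = A * R" by (simp only: P' A_def)
    also have "cnj (B z) * poly (A * R) z = (cnj (B z) * B z) * poly (D * R) z"
      by (simp add: ABD[OF elim(2)])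
    finally show ?case by (simp add: BcB[OF elim(2)])
  qed
  have uH: "u \<in> hardy_H1"
  proof (rule hardy_H1_poly_division[OF iu Q'])
    show "(\<lambda>z. poly Q' z * u z) \<in> hardy_H1"
      by (rule hardy_H1_cong_AE[OF hardy_H1_poly[of "D * R"]])
         (use ueq integrable_poly_mult[OF iu] in \<open>auto elim: eventually_mono\<close>)
  qed
  have cuH: "(\<lambda>z. cnj (u z)) \<in> hardy_H1"
  proof (rule hardy_H1_poly_division[OF icu])
    show "D * R \<noteq> 0" using D R by simp
    show "norm b \<ge> 1" if "poly (D * R) b = 0" for b
      using that D0[of b] R(2)[of b] by (cases "norm b \<le> 1") auto
    have "AE z in circle_measure. poly Q' z = poly (D * R) z * cnj (u z)"
      using ueq u1
    proof eventually_elim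
      case (elim z)
      have "u z * cnj (u z) = 1" using complex_norm_square[of "u z"] elim(2) by simp
      then show ?case by (simp add: elim(1)[symmetric] mult.assoc del: poly_mult)
    qed
    then show "(\<lambda>z. poly (D * R) z * cnj (u z)) \<in> hardy_H1"
      by (intro hardy_H1_cong_AE[OF hardy_H1_poly[of Q']] borel_measurable_integrable integrable_poly_mult icu)
  qed
  have "AE z in circle_measure. norm (u z) \<le> 1" using u1 by eventually_elim simp
  then obtain c where c: "AE z in circle_measure. u z = c"
    using hardy_H1_cnj_imp_const[OF uH cuH] by blast
  have c1: "norm c = 1"
    using AE_circle_obtain[OF AE_conjI[OF c u1]] by auto
  have "AE z in circle_measure. I z = blaschke c m a z"
    using c AE_circle_unit
  proof eventually_elim
    case (elim z)
    have "I z = (cnj (B z) * B z) * I z" by (simp add: BcB[OF elim(2)])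
    also have "\<dots> = u z * B z" by (simp add: u_def)
    finally show ?case using elim(1) by (simp add: B_def blaschke_def)
  qed
  with c1 a have "is_blaschke_rep I c m a" by (simp add: is_blaschke_rep_def)
  then show ?thesis by blast
qed

section \<open>Extreme points and real multipliers\<close>

lemma punctured_H1_hardy: "f \<in> punctured_H1 K \<Longrightarrow> f \<in> hardy_H1"
  by (simp add: punctured_H1_def)

lemma punctured_H1_cong_AE:
  assumes "f \<in> punctured_H1 K" "g \<in> borel_measurable circle_measure"
    and "AE z in circle_measure. f z = g z"
  shows "g \<in> punctured_H1 K"
  using assms hardy_H1_cong_AE[of f g] hardy_H1_measurable[of f]
    fourier_coeff_cong_AE[of f g] unfolding punctured_H1_def by auto

lemma punctured_H1_add:
  "f \<in> punctured_H1 K \<Longrightarrow> g \<in> punctured_H1 K \<Longrightarrow> (\<lambda>z. f z + g z) \<in> punctured_H1 K"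
  by (simp add: punctured_H1_def hardy_H1_add fourier_coeff_add hardy_H1_integrable)

lemma punctured_H1_cmult: "f \<in> punctured_H1 K \<Longrightarrow> (\<lambda>z. c * f z) \<in> punctured_H1 K"
  by (simp add: punctured_H1_def hardy_H1_cmult fourier_coeff_cmult)

lemma norm_plus_norm_two_minus:
  fixes w :: complex
  assumes "norm w + norm (2 - w) = 2"
  shows "w = of_real (Re w)" "0 \<le> Re w" "Re w \<le> 2"
proof -
  have "Re w \<le> norm w" "2 - Re w \<le> norm (2 - w)"
    using complex_Re_le_cmod[of w] complex_Re_le_cmod[of "2 - w"] by auto
  with assms have eq: "norm w = Re w" "norm (2 - w) = 2 - Re w" by linarith+
  show "0 \<le> Re w" using eq(1) norm_ge_zero[of w] by linarith
  show "Re w \<le> 2" using eq(2) norm_ge_zero[of "2 - w"] by linarith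
  have "(Re w)\<^sup>2 + (Im w)\<^sup>2 = (Re w)\<^sup>2" using eq(1) by (metis cmod_power2)
  then show "w = of_real (Re w)" by (simp add: complex_eq_iff)
qed

text \<open>After an affine change of \<open>h\<close> one has \<open>|h| \<le> 1\<close> and the integral of \<open>h |f|\<close> is \<open>0\<close>. Then
\<open>(1 + r h) f\<close> has norm \<open>1\<close> for all \<open>r\<close> between \<open>- 1\<close> and \<open>1\<close>, and \<open>f\<close> is the midpoint of this
segment, which must therefore be degenerate.\<close>

lemma L1_extreme_point_imp_multiplier_const:
  fixes h :: "complex \<Rightarrow> real"
  assumes f: "f \<in> punctured_H1 K" and f1: "L1_norm f = 1" and f0: "AE z in circle_measure. f z \<noteq> 0"
    and ext: "L1_extreme_point f (L1_ball (punctured_H1 K))"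
    and h [measurable]: "h \<in> borel_measurable circle_measure"
    and C: "AE z in circle_measure. \<bar>h z\<bar> \<le> C"
    and hf: "(\<lambda>z. of_real (h z) * f z) \<in> punctured_H1 K"
  shows "\<exists>c. AE z in circle_measure. h z = c"
proof -
  have iF: "integrable circle_measure f" using f by (auto simp: punctured_H1_def hardy_H1_def)
  have fm [measurable]: "f \<in> borel_measurable circle_measure" using iF by simp
  have ihf: "integrable circle_measure (\<lambda>z. h z * norm (f z))"
  proof -
    have "integrable circle_measure (\<lambda>z. complex_of_real (h z) * complex_of_real (norm (f z)))"
      using C iF by (intro integrable_bounded_mult[where C=C]) auto
    then show ?thesis by (simp flip: of_real_mult add: complex_of_real_integrable_eq)
  qed
  define \<mu> where "\<mu> = (LINT z|circle_measure. h z * norm (f z))"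
  define s where "s = 1 / (\<bar>C\<bar> + \<bar>\<mu>\<bar> + 1)"
  have s: "s > 0" unfolding s_def by (simp add: add_nonneg_pos)
  \<comment> \<open>Centre \<open>h\<close> with respect to \<open>|f|\<close> and scale it into \<open>[-1, 1]\<close>.\<close>
  define q where "q z = s * (h z - \<mu>)" for z
  have qm [measurable]: "q \<in> borel_measurable circle_measure" unfolding q_def by measurable
  have q1: "AE z in circle_measure. \<bar>q z\<bar> \<le> 1"
    using C
  proof eventually_elim
    case (elim z)
    have "\<bar>h z - \<mu>\<bar> \<le> \<bar>C\<bar> + \<bar>\<mu>\<bar> + 1" using elim by linarith
    then show ?case by (simp add: q_def s_def abs_mult abs_divide divide_le_eq_1 add_nonneg_pos)
  qed
  have q0: "(LINT z|circle_measure. q z * norm (f z)) = 0"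
  proof -
    have "(LINT z|circle_measure. q z * norm (f z)) = (LINT z|circle_measure. s * (h z * norm (f z)) - s * \<mu> * norm (f z))"
      by (simp add: q_def algebra_simps)
    also have "\<dots> = s * \<mu> - s * \<mu> * L1_norm f"
      using ihf iF by (simp add: \<mu>_def L1_norm_def)
    finally show ?thesis using f1 by simp
  qed
  have iq: "integrable circle_measure (\<lambda>z. q z * norm (f z))"
    using ihf iF by (simp add: q_def algebra_simps)
  have qf: "(\<lambda>z. of_real (q z) * f z) \<in> punctured_H1 K"
    using punctured_H1_add[OF punctured_H1_cmult[OF hf, of "of_real s"] punctured_H1_cmult[OF f, of "- of_real (s * \<mu>)"]]
    by (simp add: q_def algebra_simps)
  have seg: "(\<lambda>z. f z + of_real r * (of_real (q z) * f z)) \<in> L1_ball (punctured_H1 K)" if "\<bar>r\<bar> \<le> 1" for r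
  proof -
    have "L1_norm (\<lambda>z. f z + of_real r * (of_real (q z) * f z)) =
        (LINT z|circle_measure. norm (f z) + r * (q z * norm (f z)))"
      unfolding L1_norm_def
    proof (rule integral_cong_AE)
      show "AE z in circle_measure. norm (f z + of_real r * (of_real (q z) * f z)) =
          norm (f z) + r * (q z * norm (f z))"
        using q1
      proof eventually_elim
        case (elim z)
        have "\<bar>r * q z\<bar> \<le> 1" using mult_mono[OF that elim] by (simp add: abs_mult)
        then have "norm (complex_of_real (1 + r * q z)) = 1 + r * q z" unfolding norm_of_real by linarith
        moreover have "f z + of_real r * (of_real (q z) * f z) = of_real (1 + r * q z) * f z"
          by (simp add: algebra_simps)
        ultimately show ?case by (simp only: norm_mult) (simp add: algebra_simps)
      qed
    qed auto
    also have "\<dots> = 1" using iF iq q0 f1 by (simp add: L1_norm_def)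
    finally show ?thesis
      using punctured_H1_add[OF f punctured_H1_cmult[OF qf]] by (simp add: L1_ball_def)
  qed
  let ?g = "\<lambda>z. f z + of_real (q z) * f z" and ?h = "\<lambda>z. f z - of_real (q z) * f z"
  have "(\<lambda>z. of_real (1 - t) * ?g z + of_real t * ?h z) \<in> L1_ball (punctured_H1 K)" if "t \<in> {0..1}" for t :: real
  proof -
    have "(\<lambda>z. of_real (1 - t) * ?g z + of_real t * ?h z) =
        (\<lambda>z. f z + of_real (1 - 2 * t) * (of_real (q z) * f z))"
      by (simp add: fun_eq_iff algebra_simps)
    then show ?thesis using seg[of "1 - 2 * t"] that by auto
  qed
  note segment = this
  have mid: "AE z in circle_measure. f z = (?g z + ?h z) / 2" by simp
  have "AE z in circle_measure. ?g z = ?h z"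
  proof (rule ccontr)
    assume n: "\<not> (AE z in circle_measure. ?g z = ?h z)"
    have "\<exists>g h. \<not> (AE z in circle_measure. g z = h z) \<and>
        (\<forall>t\<in>{0..1::real}. (\<lambda>z. of_real (1 - t) * g z + of_real t * h z) \<in> L1_ball (punctured_H1 K)) \<and>
        (AE z in circle_measure. f z = (g z + h z) / 2)"
      by (intro exI[of _ ?g] exI[of _ ?h] conjI ballI n segment mid)
    with ext show False unfolding L1_extreme_point_def by blast
  qed
  then have "AE z in circle_measure. h z = \<mu>"
    using f0
  proof eventually_elim
    case (elim z)
    have "2 * (of_real (q z) * f z) = 0" using elim(1) by (simp add: algebra_simps)
    then have "q z = 0" using elim(2) by simp
    then show ?case using s by (simp add: q_def)
  qed
  then show ?thesis by blast
qed

text \<open>If \<open>f\<close> is the midpoint of \<open>g\<close> and \<open>h\<close> in the ball, then \<open>|g| + |h| = 2 |f|\<close> almost everywhere, so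
\<open>g / f\<close> is a real multiplier with values in \<open>[0, 2]\<close>. If it is a constant \<open>c\<close>, then the norms
\<open>|c|\<close> and \<open>|2 - c|\<close> of \<open>g\<close> and \<open>h\<close> are at most \<open>1\<close>, so \<open>c = 1\<close>.\<close>

lemma L1_extreme_pointI:
  assumes f: "f \<in> punctured_H1 K" and f1: "L1_norm f = 1" and f0: "AE z in circle_measure. f z \<noteq> 0"
    and const: "\<And>h :: complex \<Rightarrow> real. h \<in> borel_measurable circle_measure \<Longrightarrow>
      (AE z in circle_measure. \<bar>h z\<bar> \<le> 2) \<Longrightarrow> (\<lambda>z. of_real (h z) * f z) \<in> punctured_H1 K \<Longrightarrow>
      \<exists>c. AE z in circle_measure. h z = c"
  shows "L1_extreme_point f (L1_ball (punctured_H1 K))"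
  unfolding L1_extreme_point_def
proof (intro conjI notI)
  show "f \<in> L1_ball (punctured_H1 K)" using f f1 by (simp add: L1_ball_def)
  assume "\<exists>g h. \<not> (AE z in circle_measure. g z = h z) \<and>
    (\<forall>t\<in>{0..1::real}. (\<lambda>z. of_real (1 - t) * g z + of_real t * h z) \<in> L1_ball (punctured_H1 K)) \<and>
    (AE z in circle_measure. f z = (g z + h z) / 2)"
  then obtain g h where gh: "\<not> (AE z in circle_measure. g z = h z)"
    and seg: "\<And>t :: real. t \<in> {0..1} \<Longrightarrow> (\<lambda>z. of_real (1 - t) * g z + of_real t * h z) \<in> L1_ball (punctured_H1 K)"
    and mid: "AE z in circle_measure. f z = (g z + h z) / 2" by blast
  have g: "g \<in> punctured_H1 K" "L1_norm g \<le> 1" using seg[of 0] by (auto simp: L1_ball_def)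
  have h: "h \<in> punctured_H1 K" "L1_norm h \<le> 1" using seg[of 1] by (auto simp: L1_ball_def)
  have int: "integrable circle_measure f" "integrable circle_measure g" "integrable circle_measure h"
    using f g h by (auto simp: punctured_H1_def hardy_H1_def)
  have [measurable]: "f \<in> borel_measurable circle_measure" "g \<in> borel_measurable circle_measure"
    "h \<in> borel_measurable circle_measure" using int by auto
  have nn: "AE z in circle_measure. 0 \<le> norm (g z) + norm (h z) - 2 * norm (f z)"
    using mid
  proof eventually_elim
    case (elim z)
    show ?case using norm_triangle_ineq[of "g z" "h z"] by (simp add: elim norm_divide)
  qed
  have "(LINT z|circle_measure. norm (g z) + norm (h z) - 2 * norm (f z)) =
      L1_norm g + L1_norm h - 2 * L1_norm f"
    using int by (simp add: L1_norm_def)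
  moreover have "\<dots> \<le> 0" using g h f1 by simp
  moreover have "0 \<le> (LINT z|circle_measure. norm (g z) + norm (h z) - 2 * norm (f z))"
    using nn by (rule integral_nonneg_AE)
  ultimately have "(LINT z|circle_measure. norm (g z) + norm (h z) - 2 * norm (f z)) = 0" by linarith
  then have eq: "AE z in circle_measure. norm (g z) + norm (h z) - 2 * norm (f z) = 0"
    using integral_nonneg_eq_0_iff_AE[OF _ nn] int by auto
  define r where "r z = Re (g z / f z)" for z
  have rm [measurable]: "r \<in> borel_measurable circle_measure" unfolding r_def by measurable
  have r: "AE z in circle_measure. g z = of_real (r z) * f z \<and> \<bar>r z\<bar> \<le> 2"
    using eq mid f0
  proof eventually_elim
    case (elim z)
    define w where "w = g z / f z"
    have hw: "2 - w = h z / f z" using elim(2,3) by (simp add: w_def field_simps)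
    have "norm w + norm (2 - w) = (norm (g z) + norm (h z)) / norm (f z)"
      unfolding hw by (simp add: w_def norm_divide add_divide_distrib)
    also have "\<dots> = 2" using elim(1,3) by (simp add: field_simps)
    finally have W: "w = of_real (Re w)" "0 \<le> Re w" "Re w \<le> 2"
      by (rule norm_plus_norm_two_minus)+
    have "g z = w * f z" using elim(3) by (simp add: w_def)
    with W show ?case by (simp add: r_def flip: w_def)
  qed
  have "(\<lambda>z. of_real (r z) * f z) \<in> punctured_H1 K"
    by (rule punctured_H1_cong_AE[OF g(1)]) (use r in \<open>auto elim: eventually_mono\<close>)
  moreover have "AE z in circle_measure. \<bar>r z\<bar> \<le> 2" using r by eventually_elim simp
  ultimately obtain c where c: "AE z in circle_measure. r z = c" using const[OF rm] by blast
  have gc: "AE z in circle_measure. g z = of_real c * f z" using r c by eventually_elim simp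
  have hc: "AE z in circle_measure. h z = of_real (2 - c) * f z"
    using gc mid
  proof eventually_elim
    case (elim z)
    have "h z = 2 * f z - g z" using elim(2) by (simp add: field_simps)
    then show ?case by (simp add: elim(1) algebra_simps)
  qed
  have "L1_norm g = (LINT z|circle_measure. \<bar>c\<bar> * norm (f z))"
    unfolding L1_norm_def using gc
    by (intro integral_cong_AE) (auto elim!: eventually_mono simp: norm_mult)
  also have "\<dots> = \<bar>c\<bar>" using f1 int by (simp add: L1_norm_def)
  finally have "\<bar>c\<bar> \<le> 1" using g by simp
  have "L1_norm h = (LINT z|circle_measure. \<bar>2 - c\<bar> * norm (f z))"
    unfolding L1_norm_def using hc
    by (intro integral_cong_AE) (auto elim!: eventually_mono simp: norm_mult simp del: of_real_diff)
  also have "\<dots> = \<bar>2 - c\<bar>" using f1 int by (simp add: L1_norm_def)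
  finally have "\<bar>2 - c\<bar> \<le> 1" using h by simp
  with \<open>\<bar>c\<bar> \<le> 1\<close> have "c = 1" by linarith
  have "AE z in circle_measure. g z = h z"
    using gc hc by eventually_elim (simp add: \<open>c = 1\<close>)
  with gh show False by simp
qed

section \<open>Rank and kernel of a real matrix\<close>

lemma rank_plus_kernel_dim:
  fixes A :: "real mat"
  assumes A: "A \<in> carrier_mat n d"
  shows "vec_space.rank n A + kernel.dim d A = d"
proof -
  interpret N: vec_space "TYPE(real)" n .
  interpret K: kernel n d A by unfold_locales (rule A)
  have "linear_map class_ring (module_vec TYPE(real) d) (module_vec TYPE(real) n) (\<lambda>v. A *\<^sub>v v)"
  proof (intro linear_map.intro vec_vs)
    show "mod_hom class_ring (module_vec TYPE(real) d) (module_vec TYPE(real) n) (\<lambda>v. A *\<^sub>v v)"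
      by (intro mod_hom.intro vec_module mod_hom_axioms.intro)
         (use A in \<open>auto simp: module_hom_def module_vec_simps mult_add_distrib_mat_vec mult_mat_vec\<close>)
  qed
  then interpret T: linear_map class_ring "module_vec TYPE(real) d" "module_vec TYPE(real) n" "\<lambda>v. A *\<^sub>v v" .
  have "T.imT = N.span (set (cols A))"
    using N.col_space_eq[OF A] A by (auto simp: T.im_def N.col_space_def module_vec_simps)
  then have im: "vectorspace.dim class_ring (N.vs T.imT) = N.rank A"
    by (simp add: N.rank_def)
  have "T.kerT = mat_kernel A"
    using A by (auto simp: T.ker_def mat_kernel_def module_vec_simps)
  then have ker: "vectorspace.dim class_ring (K.NC.vs T.kerT) = K.dim" by simp
  show ?thesis
    using T.rank_nullity im ker K.NC.dim_is_n by simp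
qed

lemma rank_eq_iff_kernel_line:
  fixes A :: "real mat"
  assumes A: "A \<in> carrier_mat n (Suc d)"
    and x0: "x0 \<in> carrier_vec (Suc d)" "x0 \<noteq> 0\<^sub>v (Suc d)" "A *\<^sub>v x0 = 0\<^sub>v n"
  shows "vec_space.rank n A = d \<longleftrightarrow>
    (\<forall>x\<in>carrier_vec (Suc d). A *\<^sub>v x = 0\<^sub>v n \<longrightarrow> (\<exists>c. x = c \<cdot>\<^sub>v x0))"
proof -
  interpret K: kernel n "Suc d" A by unfold_locales (rule A)
  have x0k: "x0 \<in> mat_kernel A" using x0 A by (auto simp: mat_kernel)
  have span: "K.span {b} = {c \<cdot>\<^sub>v b | c. True}" if b: "b \<in> mat_kernel A" for b
  proof -
    have "b \<in> carrier_vec (Suc d)" using b A by (auto simp: mat_kernel)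
    then have l: "K.lincomb a {b} = a b \<cdot>\<^sub>v b" for a
      using b by (simp add: K.Ker.lincomb_def)
    have "K.span {b} = {K.lincomb a {b} | a. a \<in> {b} \<rightarrow> UNIV}"
      using b by (intro K.Ker.finite_span) auto
    also have "\<dots> = {c \<cdot>\<^sub>v b | c. True}"
    proof (intro Set.set_eqI iffI)
      fix x assume "x \<in> {c \<cdot>\<^sub>v b | c. True}"
      then obtain c where "x = c \<cdot>\<^sub>v b" by blast
      then show "x \<in> {K.lincomb a {b} | a. a \<in> {b} \<rightarrow> UNIV}"
        unfolding l by (intro CollectI exI[of _ "\<lambda>_. c"]) simp
    qed (auto simp: l)
    finally show ?thesis .
  qed
  have "vec_space.rank n A = d \<longleftrightarrow> K.dim = 1"
    using rank_plus_kernel_dim[OF A] by auto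
  also have "\<dots> \<longleftrightarrow> (\<forall>x\<in>mat_kernel A. \<exists>c. x = c \<cdot>\<^sub>v x0)"
  proof
    assume dim: "K.dim = 1"
    obtain B where B: "finite B" "K.basis B" using kernel_basis_exists[OF A] by blast
    then have "card B = 1" using K.Ker.dim_basis dim by simp
    then obtain b where "B = {b}" by (rule card_1_singletonE)
    with B have b: "b \<in> mat_kernel A" "mat_kernel A = {c \<cdot>\<^sub>v b | c. True}"
      using span[of b] by (auto simp: K.Ker.basis_def)
    then obtain c0 where c0: "x0 = c0 \<cdot>\<^sub>v b" using x0k by auto
    have "c0 \<noteq> 0" using x0(2) b(1) A unfolding c0 by (auto simp: mat_kernel)
    then have scale: "c \<cdot>\<^sub>v b = (c / c0) \<cdot>\<^sub>v x0" for c by (simp add: c0 smult_smult_assoc)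
    show "\<forall>x\<in>mat_kernel A. \<exists>c. x = c \<cdot>\<^sub>v x0"
    proof
      fix x assume "x \<in> mat_kernel A"
      then obtain c where "x = c \<cdot>\<^sub>v b" unfolding b(2) by auto
      then have "x = (c / c0) \<cdot>\<^sub>v x0" using scale[of c] by (rule trans)
      then show "\<exists>c. x = c \<cdot>\<^sub>v x0" ..
    qed
  next
    assume "\<forall>x\<in>mat_kernel A. \<exists>c. x = c \<cdot>\<^sub>v x0"
    then have "K.span {x0} = mat_kernel A"
      using K.Ker.span_is_subset2[of "{x0}"] x0k span[OF x0k] by auto
    then show "K.dim = 1" using x0 x0k by (intro K.Ker.dim1I[of x0])
  qed
  also have "\<dots> \<longleftrightarrow> (\<forall>x\<in>carrier_vec (Suc d). A *\<^sub>v x = 0\<^sub>v n \<longrightarrow> (\<exists>c. x = c \<cdot>\<^sub>v x0))"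
    using A by (auto simp: mat_kernel)
  finally show ?thesis .
qed

text \<open>Zero rows complete the coefficient matrix to a singular square matrix.\<close>

lemma more_unknowns_than_equations:
  fixes b :: "nat \<Rightarrow> nat \<Rightarrow> real"
  assumes "n < d"
  shows "\<exists>x. (\<exists>j<d. x j \<noteq> 0) \<and> (\<forall>i<n. (\<Sum>j<d. b i j * x j) = 0)"
proof -
  define A where "A = Matrix.mat d d (\<lambda>(i, j). if i < n then b i j else 0)"
  have A: "A \<in> carrier_mat d d" by (simp add: A_def)
  have "A = mat\<^sub>r d d (\<lambda>i. if i = n then 0\<^sub>v d else Matrix.vec d (\<lambda>j. if i < n then b i j else 0))"
    by (intro eq_matI) (auto simp: A_def)
  then have "Determinant.det A = 0" using assms by (simp add: det_row_0)
  then obtain v where v: "v \<in> carrier_vec d" "v \<noteq> 0\<^sub>v d" "A *\<^sub>v v = 0\<^sub>v d"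
    using det_0_iff_vec_prod_zero_field[OF A] by blast
  have "\<exists>j<d. v $ j \<noteq> 0" using v(1,2) by (auto simp: Matrix.vec_eq_iff)
  moreover have "(\<Sum>j<d. b i j * v $ j) = 0" if "i < n" for i
  proof -
    have "0 = (A *\<^sub>v v) $ i" unfolding v(3) using assms that by simp
    also have "\<dots> = (\<Sum>j<d. b i j * v $ j)"
      using v(1) assms that by (auto simp: A_def scalar_prod_def atLeast0LessThan intro!: sum.cong)
    finally show ?thesis by simp
  qed
  ultimately show ?thesis by blast
qed

lemma sum_lessThan_split: "(\<Sum>j<m + n. g j) = (\<Sum>j<m. g j) + (\<Sum>j<n. g (m + j))"
  for g :: "nat \<Rightarrow> 'a :: comm_monoid_add"
  by (induction n) (simp_all add: add.assoc)

section \<open>Inner functions other than finite Blaschke products\<close>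

definition backward_shift :: "(complex \<Rightarrow> complex) \<Rightarrow> nat \<Rightarrow> complex \<Rightarrow> complex" where
  "backward_shift u n z = z powi (- int n) * (u z - (\<Sum>j<n. fourier_coeff u (int j) * z ^ j))"

lemma hardy_H1_backward_shift:
  assumes u: "u \<in> hardy_H1"
  shows "backward_shift u n \<in> hardy_H1"
proof -
  have iu: "integrable circle_measure u" by (rule hardy_H1_integrable[OF u])
  have ip: "integrable circle_measure (\<lambda>z. \<Sum>j<n. fourier_coeff u (int j) * z ^ j)"
    by (intro continuous_on_circle_integrable continuous_intros)
  have c: "fourier_coeff (\<lambda>z. \<Sum>j<n. fourier_coeff u (int j) * z ^ j) k = fourier_coeff u k" if "k < int n" for k
  proof -
    have "fourier_coeff (\<lambda>z. \<Sum>j<n. fourier_coeff u (int j) * z ^ j) k =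
        (\<Sum>j<n. fourier_coeff u (int j) * (if k = int j then 1 else 0))"
      using fourier_coeff_powi[of "int j" k for j]
      by (subst fourier_coeff_sum) (auto intro!: continuous_on_circle_integrable continuous_intros simp: fourier_coeff_cmult)
    also have "\<dots> = (\<Sum>j<n. if j = nat k then if k \<ge> 0 then fourier_coeff u k else 0 else 0)"
      by (intro sum.cong) auto
    also have "\<dots> = fourier_coeff u k" using that hardy_H1_D[OF u, of k] by (auto simp: nat_less_iff)
    finally show ?thesis .
  qed
  have "fourier_coeff (backward_shift u n) k = 0" if "k < 0" for k
    unfolding backward_shift_def[abs_def] fourier_coeff_powi_mult
    using that by (simp add: fourier_coeff_diff iu ip c)
  moreover have "integrable circle_measure (backward_shift u n)"
    unfolding backward_shift_def[abs_def] using iu ip by (intro integrable_powi_mult) simp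
  ultimately show ?thesis by (simp add: hardy_H1_def)
qed

text \<open>On the circle \<open>I cnj I = 1\<close>, so the product is \<open>z ^ n - I p\<close> with
\<open>p = z ^ n cnj (\<Sum>j<n. c\<^sub>j z ^ j)\<close>, and \<open>p\<close> is an analytic polynomial.\<close>

lemma inner_cnj_backward_shift:
  assumes I: "I \<in> hardy_H1" and I1: "AE z in circle_measure. norm (I z) = 1"
  shows "(\<lambda>z. I z * cnj (backward_shift I n z)) \<in> hardy_H1"
proof -
  define p where "p = (\<Sum>j<n. Polynomial.monom (cnj (fourier_coeff I (int j))) (n - j))"
  have "(\<lambda>z. poly (Polynomial.monom 1 n) z + (- 1) * (poly p z * I z)) \<in> hardy_H1"
    by (intro hardy_H1_add hardy_H1_cmult hardy_H1_poly_mult hardy_H1_poly I)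
  moreover have "AE z in circle_measure. poly (Polynomial.monom 1 n) z + (- 1) * (poly p z * I z) =
      I z * cnj (backward_shift I n z)"
    using I1 AE_circle_unit
  proof eventually_elim
    case (elim z)
    have z: "z \<noteq> 0" "z * cnj z = 1" using elim(2) complex_norm_square[of z] by auto
    have II: "I z * cnj (I z) = 1" using elim(1) complex_norm_square[of "I z"] by simp
    have "cnj (z powi (- int n)) = z ^ n"
      using elim(2) cnj_powi_circle[of z "- int n"] by simp
    then have "I z * cnj (backward_shift I n z) =
        z ^ n * (I z * cnj (I z)) - (\<Sum>j<n. cnj (fourier_coeff I (int j)) * (z ^ n * cnj z ^ j)) * I z"
      by (simp add: backward_shift_def algebra_simps sum_distrib_left sum_distrib_right)
    also have "(\<Sum>j<n. cnj (fourier_coeff I (int j)) * (z ^ n * cnj z ^ j)) = poly p z"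
      unfolding p_def poly_sum poly_monom
    proof (intro sum.cong refl)
      fix j assume "j \<in> {..<n}"
      then have "z ^ n * cnj z ^ j = z ^ (n - j) * (z * cnj z) ^ j"
        by (simp add: power_mult_distrib flip: power_add mult.assoc)
      then show "cnj (fourier_coeff I (int j)) * (z ^ n * cnj z ^ j) = cnj (fourier_coeff I (int j)) * z ^ (n - j)"
        by (simp add: z)
    qed
    finally show ?case by (simp add: II poly_monom)
  qed
  moreover have "(\<lambda>z. I z * cnj (backward_shift I n z)) \<in> borel_measurable circle_measure"
    using hardy_H1_measurable[OF I] hardy_H1_measurable[OF hardy_H1_backward_shift[OF I, of n]]
    by measurable
  ultimately show ?thesis using hardy_H1_cong_AE by blast
qed

lemma backward_shift_bounded:
  assumes "AE z in circle_measure. norm (I z) = 1"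
  obtains C where "AE z in circle_measure. norm (backward_shift I n z) \<le> C"
proof -
  have "continuous_on (sphere 0 1) (\<lambda>z. \<Sum>j<n. fourier_coeff I (int j) * z ^ j)"
    by (intro continuous_intros)
  then obtain C where C: "\<And>z. norm z = 1 \<Longrightarrow> norm (\<Sum>j<n. fourier_coeff I (int j) * z ^ j) \<le> C"
    using continuous_on_circle_bounded by blast
  have "AE z in circle_measure. norm (backward_shift I n z) \<le> 1 + C"
    using assms AE_circle_unit
  proof eventually_elim
    case (elim z)
    have "norm (backward_shift I n z) = norm (I z - (\<Sum>j<n. fourier_coeff I (int j) * z ^ j))"
      using elim(2) by (simp add: backward_shift_def norm_mult norm_power_int)
    also have "\<dots> \<le> norm (I z) + norm (\<Sum>j<n. fourier_coeff I (int j) * z ^ j)"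
      by (rule norm_triangle_ineq4)
    also have "\<dots> \<le> 1 + C" using elim C[OF elim(2)] by simp
    finally show ?case .
  qed
  then show thesis by (rule that)
qed

text \<open>Let \<open>w\<close> be a combination of the first \<open>M + 1\<close> backward shifts of \<open>I\<close>. Both \<open>w f\<close> and
\<open>cnj w f = (I cnj w) F\<close> lie in \<open>H\<^sup>1\<close>, so \<open>Re w\<close> multiplies \<open>f\<close> into \<open>H\<^sup>1\<close>. The \<open>2 M + 2\<close> real
parameters of \<open>w\<close> suffice to satisfy the \<open>2 M\<close> real conditions at the punctures nontrivially. By
assumption \<open>Re w\<close> is then constant, hence so is \<open>w\<close>, and clearing the powers of \<open>z\<close> leaves a linear
equation for \<open>I\<close> with polynomial coefficients.\<close>

lemma multipliers_const_imp_blaschke: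
  fixes k :: "nat \<Rightarrow> int" and M :: nat
  assumes inner: "inner_function I" and F: "F \<in> hardy_H1"
    and fIF: "AE z in circle_measure. f z = I z * F z"
    and f: "f \<in> punctured_H1 (k ` {1..M})"
    and const: "\<And>h :: complex \<Rightarrow> real. h \<in> borel_measurable circle_measure \<Longrightarrow>
      (\<exists>C. AE z in circle_measure. \<bar>h z\<bar> \<le> C) \<Longrightarrow>
      (\<lambda>z. of_real (h z) * f z) \<in> punctured_H1 (k ` {1..M}) \<Longrightarrow>
      \<exists>c. AE z in circle_measure. h z = c"
  shows "\<exists>c m a. is_blaschke_rep I c m a"
proof -
  have I: "I \<in> hardy_H1" and I1: "AE z in circle_measure. norm (I z) = 1"
    using inner by (auto simp: inner_function_def)
  have fH: "f \<in> hardy_H1" by (rule punctured_H1_hardy[OF f])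
  note fm [measurable] = hardy_H1_measurable[OF fH]
  define N where "N = Suc M"
  define g where "g n = backward_shift I (Suc n)" for n
  have gH: "g n \<in> hardy_H1" for n unfolding g_def by (rule hardy_H1_backward_shift[OF I])
  have gm [measurable]: "g n \<in> borel_measurable circle_measure" for n by (rule hardy_H1_measurable[OF gH])
  have "\<exists>C. AE z in circle_measure. norm (g n z) \<le> C" for n
    unfolding g_def using backward_shift_bounded[OF I1] by metis
  then obtain C where C: "\<And>n. AE z in circle_measure. norm (g n z) \<le> C n" by metis
  have gf: "(\<lambda>z. g n z * f z) \<in> hardy_H1" for n
    by (rule hardy_H1_bounded_mult[OF gH C fH])
  have cgf: "(\<lambda>z. cnj (g n z) * f z) \<in> hardy_H1" for n
  proof (rule hardy_H1_cong_AE)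
    show "(\<lambda>z. (I z * cnj (g n z)) * F z) \<in> hardy_H1"
    proof (rule hardy_H1_bounded_mult[OF _ _ F])
      show "(\<lambda>z. I z * cnj (g n z)) \<in> hardy_H1"
        unfolding g_def by (rule inner_cnj_backward_shift[OF I I1])
      show "AE z in circle_measure. norm (I z * cnj (g n z)) \<le> C n"
        using I1 C[of n] by eventually_elim (simp add: norm_mult)
    qed
    show "AE z in circle_measure. I z * cnj (g n z) * F z = cnj (g n z) * f z"
      using fIF by eventually_elim simp
  qed simp
  \<comment> \<open>The coefficient of \<open>Re w f\<close> at \<open>l\<close>, as a real-linear form in the real parts (\<open>j < N\<close>) and the
    imaginary parts of the coefficients of \<open>w\<close>.\<close>
  define \<gamma> where "\<gamma> l j = (if j < N then (fourier_coeff (\<lambda>z. g j z * f z) l + fourier_coeff (\<lambda>z. cnj (g j z) * f z) l) / 2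
    else \<i> * (fourier_coeff (\<lambda>z. g (j - N) z * f z) l - fourier_coeff (\<lambda>z. cnj (g (j - N)  z) * f z) l) / 2)" for l j
  obtain x where x: "\<exists>j<N + N. x j \<noteq> 0"
    "\<And>i. i < M + M \<Longrightarrow> (\<Sum>j<N + N. (if i < M then Re (\<gamma> (k (Suc i)) j) else Im (\<gamma> (k (Suc (i - M))) j)) * x j) = 0"
    using more_unknowns_than_equations[of "M + M" "N + N"
        "\<lambda>i j. if i < M then Re (\<gamma> (k (Suc i)) j) else Im (\<gamma> (k (Suc (i - M))) j)"]
    by (auto simp: N_def)
  have \<gamma>0: "(\<Sum>j<N + N. \<gamma> l j * of_real (x j)) = 0" if l: "l \<in> k ` {1..M}" for l
  proof -
    obtain i where i: "i < M" "l = k (Suc i)" using l by (auto simp: image_iff) (metis Suc_le_D Suc_le_eq One_nat_def)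
    show ?thesis using x(2)[of i] x(2)[of "M + i"] i by (simp add: complex_eq_iff)
  qed
  define \<alpha> where "\<alpha> n = Complex (x n) (x (N + n))" for n
  define w where "w z = (\<Sum>n<N. \<alpha> n * g n z)" for z
  have wH: "w \<in> hardy_H1" unfolding w_def[abs_def] by (intro hardy_H1_sum hardy_H1_cmult gH)
  have wm [measurable]: "w \<in> borel_measurable circle_measure" by (rule hardy_H1_measurable[OF wH])
  have wb: "AE z in circle_measure. norm (w z) \<le> (\<Sum>n<N. norm (\<alpha> n) * C n)"
  proof -
    have "AE z in circle_measure. \<forall>n. norm (g n z) \<le> C n" using C by (simp add: AE_all_countable)
    then show ?thesis
    proof eventually_elim
      case (elim z)
      then show ?case unfolding w_def
        by (intro order_trans[OF norm_sum] sum_mono) (simp add: norm_mult mult_left_mono)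
    qed
  qed
  have Rewf: "(\<lambda>z. of_real (Re (w z)) * f z) =
      (\<lambda>z. \<Sum>n<N. (\<alpha> n / 2) * (g n z * f z) + (cnj (\<alpha> n) / 2) * (cnj (g n z) * f z))"
  proof
    fix z
    have "of_real (Re (w z)) * f z = (w z + cnj (w z)) / 2 * f z"
      by (simp add: complex_add_cnj)
    also have "\<dots> = (\<Sum>n<N. (\<alpha> n / 2) * (g n z * f z) + (cnj (\<alpha> n) / 2) * (cnj (g n z) * f z))"
      by (simp add: w_def sum.distrib add_divide_distrib distrib_right distrib_left sum_distrib_right
          sum_distrib_left sum_divide_distrib mult_ac)
    finally show "of_real (Re (w z)) * f z = (\<Sum>n<N. (\<alpha> n / 2) * (g n z * f z) + (cnj (\<alpha> n) / 2) * (cnj (g n z) * f z))" .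
  qed
  have "(\<lambda>z. of_real (Re (w z)) * f z) \<in> punctured_H1 (k ` {1..M})"
    unfolding punctured_H1_def Rewf
  proof (intro CollectI conjI ballI)
    show "(\<lambda>z. \<Sum>n<N. (\<alpha> n / 2) * (g n z * f z) + (cnj (\<alpha> n) / 2) * (cnj (g n z) * f z)) \<in> hardy_H1"
      by (intro hardy_H1_sum hardy_H1_add hardy_H1_cmult gf cgf)
    fix l assume l: "l \<in> k ` {1..M}"
    have "fourier_coeff (\<lambda>z. \<Sum>n<N. (\<alpha> n / 2) * (g n z * f z) + (cnj (\<alpha> n) / 2) * (cnj (g n z) * f z)) l =
        (\<Sum>n<N. fourier_coeff (\<lambda>z. (\<alpha> n / 2) * (g n z * f z) + (cnj (\<alpha> n) / 2) * (cnj (g n z) * f z)) l)"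
      by (intro fourier_coeff_sum hardy_H1_integrable hardy_H1_add hardy_H1_cmult gf cgf)
    also have "\<dots> = (\<Sum>n<N. (\<alpha> n / 2) * fourier_coeff (\<lambda>z. g n z * f z) l + (cnj (\<alpha> n) / 2) * fourier_coeff (\<lambda>z. cnj (g n z) * f z) l)"
      by (subst fourier_coeff_add) (intro hardy_H1_integrable hardy_H1_cmult gf cgf, intro hardy_H1_integrable hardy_H1_cmult gf cgf, simp only: fourier_coeff_cmult)
    also have "\<dots> = (\<Sum>n<N. \<gamma> l n * of_real (x n) + \<gamma> l (N + n) * of_real (x (N + n)))"
      by (intro sum.cong refl) (simp add: \<gamma>_def \<alpha>_def Complex_eq algebra_simps add_divide_distrib diff_divide_distrib)
    also have "\<dots> = (\<Sum>j<N + N. \<gamma> l j * of_real (x j))"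
      by (simp only: sum_lessThan_split sum.distrib)
    finally show "fourier_coeff (\<lambda>z. \<Sum>n<N. (\<alpha> n / 2) * (g n z * f z) + (cnj (\<alpha> n) / 2) * (cnj (g n z) * f z)) l = 0"
      using \<gamma>0[OF l] by simp
  qed
  moreover have "AE z in circle_measure. \<bar>Re (w z)\<bar> \<le> (\<Sum>n<N. norm (\<alpha> n) * C n)"
    using wb by eventually_elim (metis abs_Re_le_cmod order_trans)
  ultimately obtain c where c: "AE z in circle_measure. Re (w z) = c"
    using const[of "\<lambda>z. Re (w z)"] by auto
  have "(\<lambda>z. cnj (w z)) \<in> hardy_H1"
  proof (rule hardy_H1_cong_AE)
    show "(\<lambda>z. poly [:of_real (2 * c):] z + (- 1) * w z) \<in> hardy_H1"
      by (intro hardy_H1_add hardy_H1_cmult hardy_H1_poly wH)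
    show "AE z in circle_measure. poly [:of_real (2 * c):] z + (- 1) * w z = cnj (w z)"
      using c by eventually_elim (simp add: complex_eq_iff)
  qed simp
  then obtain d where d: "AE z in circle_measure. w z = d"
    using hardy_H1_cnj_imp_const[OF wH _ wb] by blast
  define Q where "Q = (\<Sum>n<N. Polynomial.monom (\<alpha> n) (N - Suc n))"
  define P where "P = Polynomial.monom d N + (\<Sum>n<N. Polynomial.monom (\<alpha> n) (N - Suc n) * (\<Sum>j<Suc n. Polynomial.monom (fourier_coeff I (int j)) j))"
  have "\<exists>n<N. \<alpha> n \<noteq> 0"
  proof -
    obtain j where j: "j < N + N" "x j \<noteq> 0" using x(1) by blast
    show ?thesis
    proof (cases "j < N")
      case True
      with j show ?thesis by (intro exI[of _ j]) (simp add: \<alpha>_def complex_eq_iff)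
    next
      case False
      with j show ?thesis by (intro exI[of _ "j - N"]) (auto simp: \<alpha>_def complex_eq_iff)
    qed
  qed
  then obtain n where n: "n < N" "\<alpha> n \<noteq> 0" by blast
  have "Polynomial.coeff Q (N - Suc n) = (\<Sum>i<N. if i = n then \<alpha> n else 0)"
    unfolding Q_def Polynomial.coeff_sum by (intro sum.cong) (use n in \<open>auto simp: Polynomial.coeff_monom\<close>)
  then have Q0: "Q \<noteq> 0" using n by auto
  have "AE z in circle_measure. poly Q z * I z = poly P z"
    using d AE_circle_unit
  proof eventually_elim
    case (elim z)
    have "z \<noteq> 0" using elim(2) by auto
    have "d * z ^ N = (\<Sum>n<N. \<alpha> n * g n z * z ^ N)"
      unfolding elim(1)[symmetric] w_def by (rule sum_distrib_right)
    also have "\<dots> = (\<Sum>n<N. \<alpha> n * z ^ (N - Suc n) * (I z - (\<Sum>j<Suc n. fourier_coeff I (int j) * z ^ j)))"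
    proof (intro sum.cong refl)
      fix n assume "n \<in> {..<N}"
      then have "N = (N - Suc n) + Suc n" by simp
      then have "z ^ N = z ^ (N - Suc n) * z ^ Suc n" by (metis power_add)
      moreover have "z powi (- int (Suc n)) * z ^ Suc n = 1"
        unfolding power_int_minus power_int_of_nat
        using \<open>z \<noteq> 0\<close> by (intro left_inverse) simp
      ultimately show "\<alpha> n * g n z * z ^ N = \<alpha> n * z ^ (N - Suc n) * (I z - (\<Sum>j<Suc n. fourier_coeff I (int j) * z ^ j))"
        by (simp add: g_def backward_shift_def mult_ac del: power_Suc of_nat_Suc sum.lessThan_Suc)
    qed
    also have "\<dots> = poly Q z * I z - (\<Sum>n<N. \<alpha> n * z ^ (N - Suc n) * (\<Sum>j<Suc n. fourier_coeff I (int j) * z ^ j))"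
      by (simp add: Q_def poly_sum poly_monom sum_distrib_right right_diff_distrib sum_subtractf del: sum.lessThan_Suc)
    finally show ?case
      by (simp add: P_def poly_sum poly_monom del: sum.lessThan_Suc)
  qed
  then show ?thesis by (rule rational_inner_imp_blaschke[OF I I1 Q0])
qed

section \<open>Multipliers for a finite Blaschke product\<close>

definition denominator_poly :: "nat \<Rightarrow> (nat \<Rightarrow> complex) \<Rightarrow> complex poly" where
  "denominator_poly m a = (\<Prod>j = 1..m. [:1, - cnj (a j):])"

lemma poly_denominator: "poly (denominator_poly m a) z = (\<Prod>j = 1..m. 1 - cnj (a j) * z)"
  by (simp add: denominator_poly_def poly_prod mult.commute)

lemma poly_denominator_nonzero:
  "\<forall>j\<in>{1..m}. norm (a j) < 1 \<Longrightarrow> norm z \<le> 1 \<Longrightarrow> poly (denominator_poly m a) z \<noteq> 0"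
  using one_minus_cnj_mult_nonzero by (auto simp: poly_denominator)

lemma blaschke_circle_denominator:
  assumes "norm z = 1"
  shows "blaschke c m a z = c * z ^ m * cnj (poly (denominator_poly m a) z) / poly (denominator_poly m a) z"
  unfolding blaschke_circle[OF assms] poly_denominator by (simp add: prod_dividef)

lemma F0_eq: "F0 F m a z = F z / (poly (denominator_poly m a) z)\<^sup>2"
  by (simp add: F0_def poly_denominator power_int_minus prod_dividef prod_power_distrib prod_inversef[unfolded o_def] divide_inverse)

text \<open>\<open>F0\<close> arises from \<open>F\<close> by division by a polynomial whose zeros lie outside the closed disc.\<close>

lemma hardy_H1_F0:
  assumes F: "F \<in> hardy_H1" and a: "\<forall>j\<in>{1..m}. norm (a j) < 1"
  shows "F0 F m a \<in> hardy_H1"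
proof (rule hardy_H1_poly_division)
  let ?D = "denominator_poly m a"
  have D0: "poly ?D z \<noteq> 0" if "norm z \<le> 1" for z by (rule poly_denominator_nonzero[OF a that])
  have "integrable circle_measure (\<lambda>z. (1 / (poly ?D z)\<^sup>2) * F z)"
    using D0 by (intro integrable_continuous_mult hardy_H1_integrable[OF F] continuous_intros) auto
  then show "integrable circle_measure (F0 F m a)" by (simp add: F0_eq[abs_def])
  show "?D * ?D \<noteq> 0" using D0[of 0] by auto
  show "norm b \<ge> 1" if "poly (?D * ?D) b = 0" for b using D0[of b] that by (cases "norm b \<le> 1") auto
  show "(\<lambda>z. poly (?D * ?D) z * F0 F m a z) \<in> hardy_H1"
  proof (rule hardy_H1_cong_AE[OF F])
    show "AE z in circle_measure. F z = poly (?D * ?D) z * F0 F m a z"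
      using AE_circle_unit by eventually_elim (simp add: F0_eq D0 power2_eq_square)
    show "(\<lambda>z. poly (?D * ?D) z * F0 F m a z) \<in> borel_measurable circle_measure"
      using \<open>integrable circle_measure (F0 F m a)\<close>
      by (intro borel_measurable_integrable integrable_poly_mult)
  qed
qed

text \<open>A vector of length \<open>2 m + 1\<close> encodes the real trigonometric polynomial \<open>2 Re (coeff_poly m x)\<close>.
Its first \<open>m + 1\<close> entries are the real parts of the coefficients and the others the imaginary parts
at positive indices; this is the order of the columns of the matrix. The imaginary part of the
constant term does not influence the trigonometric polynomial and is set to \<open>0\<close>.\<close>

definition coeff_poly :: "nat \<Rightarrow> real Matrix.vec \<Rightarrow> complex poly" where
  "coeff_poly m x = (\<Sum>l\<le>m. Polynomial.monom (Complex (x $ l) (if l = 0 then 0 else x $ (m + l))) l)"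

lemma coeff_coeff_poly:
  "Polynomial.coeff (coeff_poly m x) l = (if l \<le> m then Complex (x $ l) (if l = 0 then 0 else x $ (m + l)) else 0)"
proof -
  have "Polynomial.coeff (coeff_poly m x) l =
      (\<Sum>i\<le>m. if i = l then Complex (x $ l) (if l = 0 then 0 else x $ (m + l)) else 0)"
    unfolding coeff_poly_def Polynomial.coeff_sum by (intro sum.cong) (auto simp: Polynomial.coeff_monom)
  then show ?thesis by auto
qed

lemma coeff_poly_smult:
  assumes "x \<in> carrier_vec (Suc (2 * m))"
  shows "coeff_poly m (c \<cdot>\<^sub>v x) = Polynomial.smult (of_real c) (coeff_poly m x)"
  using assms by (intro poly_eqI) (simp add: coeff_coeff_poly complex_eq_iff)

lemma coeff_poly_inject:
  assumes "x \<in> carrier_vec (Suc (2 * m))" "y \<in> carrier_vec (Suc (2 * m))" "coeff_poly m x = coeff_poly m y"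
  shows "x = y"
proof (rule eq_vecI)
  fix i assume "i < dim_vec y"
  then have i: "i < Suc (2 * m)" using assms by simp
  show "x $ i = y $ i"
  proof (cases "i \<le> m")
    case True
    then show ?thesis using arg_cong[OF assms(3), of "\<lambda>p. Re (Polynomial.coeff p i)"]
      by (simp add: coeff_coeff_poly)
  next
    case False
    then have "i - m \<le> m" "i - m \<noteq> 0" "m + (i - m) = i" using i by auto
    then show ?thesis using arg_cong[OF assms(3), of "\<lambda>p. Im (Polynomial.coeff p (i - m))"]
      by (simp add: coeff_coeff_poly)
  qed
qed (use assms in simp)

lemma coeff_poly_surj:
  assumes "degree p \<le> m" "Im (Polynomial.coeff p 0) = 0"
  obtains x where "x \<in> carrier_vec (Suc (2 * m))" "coeff_poly m x = p"
proof
  define x where "x = Matrix.vec (Suc (2 * m)) (\<lambda>i. if i \<le> m then Re (Polynomial.coeff p i) else Im (Polynomial.coeff p (i - m)))"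
  show "x \<in> carrier_vec (Suc (2 * m))" by (simp add: x_def)
  show "coeff_poly m x = p"
    using assms by (intro poly_eqI) (auto simp: coeff_coeff_poly x_def complex_eq_iff coeff_eq_0)
qed

lemma Re_poly_eq_0_imp_0:
  assumes 0: "AE z in circle_measure. Re (poly p z) = 0" and Im: "Im (Polynomial.coeff p 0) = 0"
  shows "p = 0"
proof -
  have eq: "fourier_coeff (poly p) k + cnj (fourier_coeff (poly p) (- k)) = 0" for k
  proof -
    have "fourier_coeff (poly p) k + cnj (fourier_coeff (poly p) (- k)) =
        fourier_coeff (\<lambda>z. poly p z + cnj (poly p z)) k"
      by (subst fourier_coeff_add) (auto simp: fourier_coeff_cnj)
    also have "\<dots> = fourier_coeff (\<lambda>z. 0) k"
    proof (rule fourier_coeff_cong_AE)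
      show "AE z in circle_measure. poly p z + cnj (poly p z) = 0"
        using 0 by eventually_elim (simp add: complex_eq_iff)
    qed (intro borel_measurable_integrable, simp)+
    finally show ?thesis by (simp add: fourier_coeff_const)
  qed
  show ?thesis
  proof (rule poly_eqI)
    fix n
    show "Polynomial.coeff p n = Polynomial.coeff 0 n"
      using eq[of "int n"] Im by (cases "n = 0") (auto simp: fourier_coeff_poly complex_eq_iff)
  qed
qed

text \<open>For a real function the coefficients at \<open>k\<close> and \<open>- k\<close> are conjugate, so the spectrum lies between
\<open>- m\<close> and \<open>m\<close>. The constant coefficient is halved because it contributes twice to \<open>2 Re p\<close>.\<close>

lemma real_trig_poly_of_spectrum:
  fixes R :: "complex \<Rightarrow> real"
  assumes R [measurable]: "R \<in> borel_measurable circle_measure"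
    and C: "AE z in circle_measure. \<bar>R z\<bar> \<le> C"
    and 0: "\<And>k. k < - int m \<Longrightarrow> fourier_coeff (\<lambda>z. of_real (R z)) k = 0"
  obtains p where "degree p \<le> m" "Im (Polynomial.coeff p 0) = 0"
    "AE z in circle_measure. R z = 2 * Re (poly p z)"
proof -
  define r where "r k = fourier_coeff (\<lambda>z. of_real (R z)) k" for k
  have iR: "integrable circle_measure (\<lambda>z. complex_of_real (R z))"
    using C by (intro bounded_integrable[where N=C]) auto
  have sym: "r (- k) = cnj (r k)" for k
    using fourier_coeff_cnj[of "\<lambda>z. of_real (R z)" "- k"] by (simp add: r_def)
  have r0: "r k = 0" if "\<bar>k\<bar> > int m" for k
  proof (cases "k < 0")
    case True
    then show ?thesis using 0[of k] that by (simp add: r_def)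
  next
    case False
    then have "r (- k) = 0" using 0[of "- k"] that by (simp add: r_def)
    then show ?thesis using sym[of k] by simp
  qed
  define p where "p = (\<Sum>l\<le>m. Polynomial.monom (if l = 0 then r 0 / 2 else r (int l)) l)"
  have cp: "Polynomial.coeff p l = (if l \<le> m then if l = 0 then r 0 / 2 else r (int l) else 0)" for l
  proof -
    have "Polynomial.coeff p l = (\<Sum>i\<le>m. if i = l then if l = 0 then r 0 / 2 else r (int l) else 0)"
      unfolding p_def Polynomial.coeff_sum by (intro sum.cong) (auto simp: Polynomial.coeff_monom)
    then show ?thesis by auto
  qed
  have Im0: "Im (r 0) = 0" using sym[of 0] by (simp add: complex_eq_iff)
  have ih: "integrable circle_measure (\<lambda>z. poly p z + cnj (poly p z))" by simp
  note hm [measurable] = borel_measurable_integrable[OF ih]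
  have "fourier_coeff (\<lambda>z. of_real (R z) - (poly p z + cnj (poly p z))) k = 0" for k
  proof -
    have "fourier_coeff (\<lambda>z. of_real (R z) - (poly p z + cnj (poly p z))) k =
        r k - (fourier_coeff (poly p) k + cnj (fourier_coeff (poly p) (- k)))"
      using iR ih by (simp add: fourier_coeff_diff fourier_coeff_add fourier_coeff_cnj r_def)
    also have "\<dots> = 0"
    proof (cases k "0 :: int" rule: linorder_cases)
      case less
      then show ?thesis using r0[of k] sym[of "- k"] by (auto simp: fourier_coeff_poly cp)
    next
      case equal
      then show ?thesis using Im0 by (simp add: fourier_coeff_poly cp complex_eq_iff)
    next
      case greater
      then show ?thesis using r0[of k] by (auto simp: fourier_coeff_poly cp)
    qed
    finally show ?thesis .
  qed
  moreover obtain C' where C': "\<And>z. norm z = 1 \<Longrightarrow> norm (poly p z + cnj (poly p z)) \<le> C'"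
  proof -
    have "continuous_on (sphere 0 1) (\<lambda>z. poly p z + cnj (poly p z))" by (intro continuous_intros)
    then show thesis using that continuous_on_circle_bounded by blast
  qed
  moreover have "AE z in circle_measure. norm (of_real (R z) - (poly p z + cnj (poly p z))) \<le> C + C'"
    using C AE_circle_unit
  proof eventually_elim
    case (elim z)
    show ?case
      using norm_triangle_ineq4[of "of_real (R z)" "poly p z + cnj (poly p z)"] C'[OF elim(2)] elim(1)
      unfolding norm_of_real by linarith
  qed
  ultimately have "AE z in circle_measure. of_real (R z) - (poly p z + cnj (poly p z)) = 0"
    by (intro bounded_fourier_unique[where C = "C + C'"]) measurable
  then have "AE z in circle_measure. R z = 2 * Re (poly p z)"
    by eventually_elim (simp add: complex_eq_iff)
  moreover have "degree p \<le> m" by (rule degree_le) (simp add: cp)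
  ultimately show thesis using Im0 by (intro that[of p]) (simp_all add: cp)
qed

lemma fourier_coeff_trig_poly_mult:
  assumes G: "integrable circle_measure G"
  shows "fourier_coeff (\<lambda>z. z ^ m * of_real (2 * Re (poly (coeff_poly m x) z)) * G z) k =
    (\<Sum>l\<le>m. Complex (x $ l) (if l = 0 then 0 else x $ (m + l)) * fourier_coeff G (k - int l - int m) +
      cnj (Complex (x $ l) (if l = 0 then 0 else x $ (m + l))) * fourier_coeff G (k + int l - int m))"
proof -
  define c where "c l = Complex (x $ l) (if l = 0 then 0 else x $ (m + l))" for l
  have iG: "integrable circle_measure (\<lambda>z. a * (z powi n * G z))" for a n
    using integrable_powi_mult(1)[OF G] by simp
  have "fourier_coeff (\<lambda>z. z ^ m * of_real (2 * Re (poly (coeff_poly m x) z)) * G z) k =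
      fourier_coeff (\<lambda>z. \<Sum>l\<le>m. c l * (z powi (int m + int l) * G z) + cnj (c l) * (z powi (int m - int l) * G z)) k"
  proof (rule fourier_coeff_cong)
    fix z :: complex assume z: "norm z = 1"
    then have z0: "z \<noteq> 0" by auto
    have "of_real (2 * Re (poly (coeff_poly m x) z)) = poly (coeff_poly m x) z + cnj (poly (coeff_poly m x) z)"
      by (simp only: complex_add_cnj)
    also have "\<dots> = (\<Sum>l\<le>m. c l * z ^ l + cnj (c l) * cnj z ^ l)"
      by (simp add: coeff_poly_def poly_sum poly_monom c_def sum.distrib)
    finally have "z ^ m * of_real (2 * Re (poly (coeff_poly m x) z)) * G z =
        (\<Sum>l\<le>m. c l * (z ^ m * z ^ l * G z) + cnj (c l) * (z ^ m * cnj z ^ l * G z))"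
      by (simp add: sum_distrib_left sum_distrib_right distrib_left distrib_right mult_ac)
    also have "\<dots> = (\<Sum>l\<le>m. c l * (z powi (int m + int l) * G z) + cnj (c l) * (z powi (int m - int l) * G z))"
      using z0 by (intro sum.cong refl) (simp add: power_int_add power_int_diff cnj_circle[OF z] divide_inverse power_inverse)
    finally show "z ^ m * of_real (2 * Re (poly (coeff_poly m x) z)) * G z =
        (\<Sum>l\<le>m. c l * (z powi (int m + int l) * G z) + cnj (c l) * (z powi (int m - int l) * G z))" .
  qed
  also have "\<dots> = (\<Sum>l\<le>m. c l * fourier_coeff G (k - (int m + int l)) + cnj (c l) * fourier_coeff G (k - (int m - int l)))"
    using iG by (simp add: fourier_coeff_sum fourier_coeff_add fourier_coeff_cmult fourier_coeff_powi_mult)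
  finally show ?thesis by (simp add: c_def algebra_simps)
qed

lemma frakM_carrier: "frakM M k F m a \<in> carrier_mat (2 * M) (Suc (2 * m))"
  by (rule carrier_matI) (simp_all add: frakM_def Let_def)

text \<open>Separating real and imaginary parts in \<open>fourier_coeff_trig_poly_mult\<close> gives exactly the entries of
the four blocks.\<close>

lemma frakM_mult_vec:
  fixes k :: "nat \<Rightarrow> int"
  assumes x: "x \<in> carrier_vec (Suc (2 * m))" and r: "r < M"
    and G: "integrable circle_measure (F0 F m a)"
  defines "E \<equiv> fourier_coeff (\<lambda>z. z ^ m * of_real (2 * Re (poly (coeff_poly m x) z)) * F0 F m a z) (k (Suc r))"
  shows "(frakM M k F m a *\<^sub>v x) $ r = Re E" and "(frakM M k F m a *\<^sub>v x) $ (M + r) = Im E"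
proof -
  define C where "C = fourier_coeff (F0 F m a)"
  let ?A = "frakM M k F m a"
  have split: "(?A *\<^sub>v x) $ i = (\<Sum>l\<le>m. ?A $$ (i, l) * x $ l) + (\<Sum>l<m. ?A $$ (i, Suc m + l) * x $ (Suc m + l))"
    if "i < 2 * M" for i
  proof -
    have "(?A *\<^sub>v x) $ i = (\<Sum>j<Suc m + m. ?A $$ (i, j) * x $ j)"
      using frakM_carrier[of M k F m a] x that
      by (auto simp: scalar_prod_def atLeast0LessThan mult_2 intro!: sum.cong)
    then show ?thesis by (simp only: sum_lessThan_split lessThan_Suc_atMost)
  qed
  have shift: "(\<Sum>l<m. g (Suc l)) = (\<Sum>l\<le>m. if l = 0 then 0 else g l)" for g :: "nat \<Rightarrow> real"
    by (simp add: sum.atMost_shift)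
  define K where "K = k (Suc r)"
  define P where "P l = C (K + int l - int m)" for l
  define N where "N l = C (K - int l - int m)" for l
  define \<beta> where "\<beta> l = x $ (m + l)" for l
  have E: "E = (\<Sum>l\<le>m. Complex (x $ l) (if l = 0 then 0 else \<beta> l) * N l +
      cnj (Complex (x $ l) (if l = 0 then 0 else \<beta> l)) * P l)"
    unfolding E_def C_def K_def P_def N_def \<beta>_def by (rule fourier_coeff_trig_poly_mult[OF G])
  have entries:
    "l \<le> m \<Longrightarrow> ?A $$ (r, l) = Re (P l) + Re (N l)"
    "l \<le> m \<Longrightarrow> ?A $$ (M + r, l) = Im (P l) + Im (N l)"
    "l < m \<Longrightarrow> ?A $$ (r, Suc (m + l)) = Im (P (Suc l)) - Im (N (Suc l))"
    "l < m \<Longrightarrow> ?A $$ (M + r, Suc (m + l)) = - (Re (P (Suc l)) - Re (N (Suc l)))" for l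
    using r by (simp_all add: frakM_def Let_def C_def K_def P_def N_def)
  have "(?A *\<^sub>v x) $ r = (\<Sum>l\<le>m. (Re (P l) + Re (N l)) * x $ l) +
      (\<Sum>l<m. (Im (P (Suc l)) - Im (N (Suc l))) * \<beta> (Suc l))"
    using r by (subst split) (simp_all add: entries \<beta>_def)
  also have "\<dots> = Re E"
    unfolding E Re_sum shift[of "\<lambda>l. (Im (P l) - Im (N l)) * \<beta> l"] sum.distrib[symmetric]
    by (intro sum.cong refl) (simp add: algebra_simps)
  finally show "(?A *\<^sub>v x) $ r = Re E" .
  have "(?A *\<^sub>v x) $ (M + r) = (\<Sum>l\<le>m. (Im (P l) + Im (N l)) * x $ l) +
      (\<Sum>l<m. - (Re (P (Suc l)) - Re (N (Suc l))) * \<beta> (Suc l))"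
    using r by (subst split) (simp_all add: entries \<beta>_def)
  also have "\<dots> = Im E"
    unfolding E Im_sum shift[of "\<lambda>l. - (Re (P l) - Re (N l)) * \<beta> l"] sum.distrib[symmetric]
    by (intro sum.cong refl) (simp add: algebra_simps)
  finally show "(?A *\<^sub>v x) $ (M + r) = Im E" .
qed

lemma frakM_kernel_iff:
  fixes k :: "nat \<Rightarrow> int"
  assumes x: "x \<in> carrier_vec (Suc (2 * m))" and G: "F0 F m a \<in> hardy_H1"
  shows "frakM M k F m a *\<^sub>v x = 0\<^sub>v (2 * M) \<longleftrightarrow>
    (\<lambda>z. z ^ m * of_real (2 * Re (poly (coeff_poly m x) z)) * F0 F m a z) \<in> punctured_H1 (k ` {1..M})"
    (is "?L \<longleftrightarrow> ?g \<in> _")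
proof -
  have iG: "integrable circle_measure (F0 F m a)" by (rule hardy_H1_integrable[OF G])
  have "continuous_on (sphere 0 1) (\<lambda>z. z ^ m * complex_of_real (2 * Re (poly (coeff_poly m x) z)))"
    by (intro continuous_intros)
  then have ig: "integrable circle_measure ?g" by (rule integrable_continuous_mult[OF iG])
  have "fourier_coeff ?g l = 0" if "l < 0" for l
    unfolding fourier_coeff_trig_poly_mult[OF iG]
    using that by (intro sum.neutral) (auto simp: hardy_H1_D[OF G])
  with ig have gH: "?g \<in> hardy_H1" by (simp add: hardy_H1_def)
  have "?L \<longleftrightarrow> (\<forall>i<2 * M. (frakM M k F m a *\<^sub>v x) $ i = 0)"
    using frakM_carrier[of M k F m a] by (auto simp: Matrix.vec_eq_iff)
  also have "\<dots> \<longleftrightarrow> (\<forall>r<M. (frakM M k F m a *\<^sub>v x) $ r = 0 \<and> (frakM M k F m a *\<^sub>v x) $ (M + r) = 0)"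
  proof (intro iffI allI impI conjI)
    fix i assume *: "\<forall>r<M. (frakM M k F m a *\<^sub>v x) $ r = 0 \<and> (frakM M k F m a *\<^sub>v x) $ (M + r) = 0"
      and "i < 2 * M"
    then show "(frakM M k F m a *\<^sub>v x) $ i = 0"
      using *[rule_format, of i] *[rule_format, of "i - M"] by (cases "i < M") auto
  qed auto
  also have "\<dots> \<longleftrightarrow> (\<forall>r<M. fourier_coeff ?g (k (Suc r)) = 0)"
    using frakM_mult_vec[OF x _ iG] by (simp add: complex_eq_iff)
  also have "\<dots> \<longleftrightarrow> (\<forall>l\<in>k ` {1..M}. fourier_coeff ?g l = 0)"
  proof -
    have "{1..M} = Suc ` {..<M}" by (simp add: image_Suc_lessThan)
    then show ?thesis by (simp only:) blast
  qed
  also have "\<dots> \<longleftrightarrow> ?g \<in> punctured_H1 (k ` {1..M})" using gH by (simp add: punctured_H1_def)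
  finally show ?thesis .
qed

text \<open>On the circle \<open>D\<^sup>2 h f = z ^ m (h |D|\<^sup>2) F\<close>. Hence Smirnov's theorem places \<open>z ^ m (h |D|\<^sup>2)\<close>
in \<open>H\<^sup>1\<close>, which bounds the spectrum of the real function \<open>h |D|\<^sup>2\<close> from below by \<open>- m\<close>.\<close>

lemma multiplier_eq_trig_poly_quotient:
  fixes h :: "complex \<Rightarrow> real"
  assumes F: "outer_function F" and a: "\<forall>j\<in>{1..m}. norm (a j) < 1"
    and f: "AE z in circle_measure. f z = blaschke 1 m a z * F z"
    and h [measurable]: "h \<in> borel_measurable circle_measure"
    and C: "AE z in circle_measure. \<bar>h z\<bar> \<le> C"
    and hf: "(\<lambda>z. of_real (h z) * f z) \<in> hardy_H1"
  obtains x where "x \<in> carrier_vec (Suc (2 * m))"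
    "AE z in circle_measure. h z * (norm (poly (denominator_poly m a) z))\<^sup>2 = 2 * Re (poly (coeff_poly m x) z)"
proof -
  let ?D = "denominator_poly m a"
  have D0: "poly ?D z \<noteq> 0" if "norm z = 1" for z
    using poly_denominator_nonzero[OF a, of z] that by simp
  define R where "R z = h z * (norm (poly ?D z))\<^sup>2" for z
  have Rm [measurable]: "R \<in> borel_measurable circle_measure" unfolding R_def by measurable
  obtain B where B: "\<And>z. norm z = 1 \<Longrightarrow> norm (poly ?D z) \<le> B"
  proof -
    have "continuous_on (sphere 0 1) (poly ?D)" by (intro continuous_intros)
    then show thesis using that continuous_on_circle_bounded by blast
  qed
  have Rb: "AE z in circle_measure. \<bar>R z\<bar> \<le> C * B\<^sup>2"
    using C AE_circle_unit
  proof eventually_elim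
    case (elim z)
    have "(norm (poly ?D z))\<^sup>2 \<le> B\<^sup>2" using B[OF elim(2)] by (intro power_mono) auto
    then show ?case using elim(1) by (simp add: R_def abs_mult mult_mono')
  qed
  define \<phi> where "\<phi> z = z powi int m * complex_of_real (R z)" for z
  have "\<phi> \<in> hardy_H1"
  proof (rule Smirnov[OF F])
    show "(\<lambda>z. poly (?D * ?D) z * (of_real (h z) * f z)) \<in> hardy_H1"
      by (rule hardy_H1_poly_mult[OF hf])
    show "\<phi> \<in> borel_measurable circle_measure" unfolding \<phi>_def by measurable
    show "AE z in circle_measure. norm (\<phi> z) \<le> C * B\<^sup>2"
      using Rb AE_circle_unit by eventually_elim (simp add: \<phi>_def norm_mult norm_power)
    show "AE z in circle_measure. poly (?D * ?D) z * (of_real (h z) * f z) = \<phi> z * F z"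
      using f AE_circle_unit
    proof eventually_elim
      case (elim z)
      have "of_real (R z) = of_real (h z) * (poly ?D z * cnj (poly ?D z))"
        using complex_norm_square[of "poly ?D z"] by (simp add: R_def)
      then show ?case
        using D0[OF elim(2)] by (simp add: elim(1) blaschke_circle_denominator[OF elim(2)] \<phi>_def field_simps)
    qed
  qed
  then have "fourier_coeff (\<lambda>z. complex_of_real (R z)) k = 0" if "k < - int m" for k
    using hardy_H1_D[of \<phi> "k + int m"] that
    unfolding \<phi>_def[abs_def] fourier_coeff_powi_mult by simp
  then obtain p where p: "degree p \<le> m" "Im (Polynomial.coeff p 0) = 0"
      "AE z in circle_measure. R z = 2 * Re (poly p z)"
    using real_trig_poly_of_spectrum[OF Rm Rb] by blast
  obtain x where "x \<in> carrier_vec (Suc (2 * m))" "coeff_poly m x = p"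
    using coeff_poly_surj[OF p(1,2)] by blast
  with p(3) show thesis by (intro that[of x]) (simp_all add: R_def)
qed

text \<open>The map \<open>x \<mapsto> H x = 2 Re (coeff_poly m x) / |D|\<^sup>2\<close> is an injective linear parametrization of all bounded
real \<open>h\<close> with \<open>h f \<in> H\<^sup>1\<close>, and the kernel of the matrix corresponds to \<open>h f\<close> in the punctured space.\<close>

lemma frakM_rank_iff_multipliers_const:
  fixes k :: "nat \<Rightarrow> int"
  assumes F: "outer_function F" and a: "\<forall>j\<in>{1..m}. norm (a j) < 1"
    and fBF: "AE z in circle_measure. f z = blaschke 1 m a z * F z"
    and f: "f \<in> punctured_H1 (k ` {1..M})"
  shows "vec_space.rank (2 * M) (frakM M k F m a) = 2 * m \<longleftrightarrow>
    (\<forall>h :: complex \<Rightarrow> real. h \<in> borel_measurable circle_measure \<longrightarrow>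
      (\<exists>C. AE z in circle_measure. \<bar>h z\<bar> \<le> C) \<longrightarrow>
      (\<lambda>z. of_real (h z) * f z) \<in> punctured_H1 (k ` {1..M}) \<longrightarrow>
      (\<exists>c. AE z in circle_measure. h z = c))" (is "_ \<longleftrightarrow> ?const")
proof -
  let ?D = "denominator_poly m a" and ?A = "frakM M k F m a" and ?X = "punctured_H1 (k ` {1..M})"
  have D0: "poly ?D z \<noteq> 0" if "norm z = 1" for z
    using poly_denominator_nonzero[OF a, of z] that by simp
  have FH: "F \<in> hardy_H1" using F by (simp add: outer_function_def)
  have GH: "F0 F m a \<in> hardy_H1" by (rule hardy_H1_F0[OF FH a])
  have fH: "f \<in> hardy_H1" by (rule punctured_H1_hardy[OF f])
  note fm [measurable] = hardy_H1_measurable[OF fH]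
  define H where "H x z = 2 * Re (poly (coeff_poly m x) z) / (norm (poly ?D z))\<^sup>2" for x z
  have Hm [measurable]: "H x \<in> borel_measurable circle_measure" for x unfolding H_def by measurable
  have Hb: "\<exists>C. AE z in circle_measure. \<bar>H x z\<bar> \<le> C" for x
  proof -
    have "continuous_on (sphere 0 1) (\<lambda>z. complex_of_real (H x z))"
      unfolding H_def using D0 by (intro continuous_intros) auto
    then obtain C where "\<And>z. norm z = 1 \<Longrightarrow> norm (complex_of_real (H x z)) \<le> C"
      using continuous_on_circle_bounded by blast
    then show ?thesis by (intro exI[of _ C] AE_I2) simp
  qed
  have Hf: "AE z in circle_measure. z ^ m * of_real (2 * Re (poly (coeff_poly m x) z)) * F0 F m a z =
      of_real (H x z) * f z" for x
    using fBF AE_circle_unit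
  proof eventually_elim
    case (elim z)
    have "of_real (H x z) = of_real (2 * Re (poly (coeff_poly m x) z)) / (poly ?D z * cnj (poly ?D z))"
      using complex_norm_square[of "poly ?D z"] by (simp add: H_def)
    then show ?case
      using D0[OF elim(2)]
      by (simp add: elim(1) blaschke_circle_denominator[OF elim(2)] F0_eq field_simps power2_eq_square)
  qed
  have ker: "?A *\<^sub>v x = 0\<^sub>v (2 * M) \<longleftrightarrow> (\<lambda>z. of_real (H x z) * f z) \<in> ?X"
    if x: "x \<in> carrier_vec (Suc (2 * m))" for x
  proof -
    have m1: "(\<lambda>z. of_real (H x z) * f z) \<in> borel_measurable circle_measure" by measurable
    have m2: "(\<lambda>z. z ^ m * of_real (2 * Re (poly (coeff_poly m x) z)) * F0 F m a z) \<in> borel_measurable circle_measure"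
      using hardy_H1_measurable[OF GH] by measurable
    show ?thesis
      unfolding frakM_kernel_iff[OF x GH]
      using punctured_H1_cong_AE[OF _ m1 Hf] punctured_H1_cong_AE[OF _ m2 AE_symmetric[OF Hf]] by blast
  qed
  have param: "\<exists>x\<in>carrier_vec (Suc (2 * m)). AE z in circle_measure. h z = H x z"
    if h: "h \<in> borel_measurable circle_measure" "AE z in circle_measure. \<bar>h z\<bar> \<le> C"
      "(\<lambda>z. of_real (h z) * f z) \<in> ?X" for h :: "complex \<Rightarrow> real" and C
  proof -
    obtain x where x: "x \<in> carrier_vec (Suc (2 * m))"
      "AE z in circle_measure. h z * (norm (poly ?D z))\<^sup>2 = 2 * Re (poly (coeff_poly m x) z)"
      using multiplier_eq_trig_poly_quotient[OF F a fBF h(1,2) punctured_H1_hardy[OF h(3)]] by blast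
    have "AE z in circle_measure. h z = H x z"
      using x(2) AE_circle_unit by eventually_elim (use D0 in \<open>simp add: H_def divide_simps\<close>)
    with x(1) show ?thesis by blast
  qed
  have Hsmult: "H (c \<cdot>\<^sub>v x) z = c * H x z" if "x \<in> carrier_vec (Suc (2 * m))" for c x z
    using that by (simp add: H_def coeff_poly_smult)
  have Hinj: "x = y" if xy: "x \<in> carrier_vec (Suc (2 * m))" "y \<in> carrier_vec (Suc (2 * m))"
      and eq: "AE z in circle_measure. H x z = H y z" for x y
  proof -
    have "AE z in circle_measure. Re (poly (coeff_poly m x - coeff_poly m y) z) = 0"
      using eq AE_circle_unit by eventually_elim (use D0 in \<open>simp add: H_def divide_simps\<close>)
    then have "coeff_poly m x - coeff_poly m y = 0"
      by (rule Re_poly_eq_0_imp_0) (simp add: coeff_coeff_poly)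
    then show ?thesis using coeff_poly_inject[OF xy] by simp
  qed
  \<comment> \<open>The multiplier \<open>1\<close> always belongs to the kernel.\<close>
  obtain x0 where x0: "x0 \<in> carrier_vec (Suc (2 * m))" "AE z in circle_measure. 1 = H x0 z"
    using param[of "\<lambda>_. 1" 1] f by auto
  have x0_ker: "?A *\<^sub>v x0 = 0\<^sub>v (2 * M)"
  proof -
    have "(\<lambda>z. of_real (H x0 z) * f z) \<in> ?X"
      by (rule punctured_H1_cong_AE[OF f]) (use x0(2) in \<open>auto elim: eventually_mono\<close>)
    then show ?thesis using ker[OF x0(1)] by simp
  qed
  have x0_nz: "x0 \<noteq> 0\<^sub>v (Suc (2 * m))"
  proof
    assume z: "x0 = 0\<^sub>v (Suc (2 * m))"
    have "coeff_poly m x0 = 0" unfolding z by (intro poly_eqI) (simp add: coeff_coeff_poly complex_eq_iff)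
    then have "H x0 z = 0" for z by (simp add: H_def)
    with AE_circle_obtain[OF x0(2)] show False by auto
  qed
  have "vec_space.rank (2 * M) ?A = 2 * m \<longleftrightarrow>
      (\<forall>x\<in>carrier_vec (Suc (2 * m)). ?A *\<^sub>v x = 0\<^sub>v (2 * M) \<longrightarrow> (\<exists>c. x = c \<cdot>\<^sub>v x0))"
    by (rule rank_eq_iff_kernel_line[OF frakM_carrier x0(1) x0_nz x0_ker])
  also have "\<dots> \<longleftrightarrow> ?const"
  proof (intro iffI allI impI ballI)
    fix h :: "complex \<Rightarrow> real"
    assume line: "\<forall>x\<in>carrier_vec (Suc (2 * m)). ?A *\<^sub>v x = 0\<^sub>v (2 * M) \<longrightarrow> (\<exists>c. x = c \<cdot>\<^sub>v x0)"
      and hm [measurable]: "h \<in> borel_measurable circle_measure"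
      and hb: "\<exists>C. AE z in circle_measure. \<bar>h z\<bar> \<le> C"
      and hf: "(\<lambda>z. of_real (h z) * f z) \<in> ?X"
    from hb obtain C where "AE z in circle_measure. \<bar>h z\<bar> \<le> C" by blast
    then obtain x where x: "x \<in> carrier_vec (Suc (2 * m))" "AE z in circle_measure. h z = H x z"
      using param[OF hm _ hf] by blast
    have "(\<lambda>z. of_real (H x z) * f z) \<in> ?X"
      by (rule punctured_H1_cong_AE[OF hf]) (use x(2) in \<open>auto elim: eventually_mono\<close>)
    then obtain c where c: "x = c \<cdot>\<^sub>v x0" using line x(1) ker[OF x(1)] by blast
    have "AE z in circle_measure. h z = c"
      using x(2) x0(2) by eventually_elim (simp add: c Hsmult[OF x0(1)])
    then show "\<exists>c. AE z in circle_measure. h z = c" ..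
  next
    fix x assume const: ?const and x: "x \<in> carrier_vec (Suc (2 * m))" and "?A *\<^sub>v x = 0\<^sub>v (2 * M)"
    then have "(\<lambda>z. of_real (H x z) * f z) \<in> ?X" using ker[OF x] by simp
    from const[rule_format, OF Hm Hb this] obtain c where c: "AE z in circle_measure. H x z = c" ..
    have "AE z in circle_measure. H x z = H (c \<cdot>\<^sub>v x0) z"
      using c x0(2) by eventually_elim (simp add: Hsmult[OF x0(1)])
    then have "x = c \<cdot>\<^sub>v x0" using x x0(1) by (intro Hinj) auto
    then show "\<exists>c. x = c \<cdot>\<^sub>v x0" ..
  qed
  finally show ?thesis .
qed

text \<open>This turns the rank condition into the bound \<open>m \<le> M\<close> on the degree.\<close>

lemma rank_le_rows:
  fixes A :: "real mat"
  assumes A: "A \<in> carrier_mat n d"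
  shows "vec_space.rank n A \<le> n"
proof -
  interpret N: vec_space "TYPE(real)" n .
  obtain S where S: "maximal S (\<lambda>T. T \<subseteq> set (cols A) \<and> N.lin_indpt T)"
    using maximal_exists_superset[of "set (cols A)" "\<lambda>T. T \<subseteq> set (cols A) \<and> N.lin_indpt T" "{}"]
    by (auto simp: N.finite_lin_indpt2)
  then have "S \<subseteq> carrier_vec n" "N.lin_indpt S"
    using cols_dim[of A] A by (auto simp: maximal_def)
  then have "card S \<le> n" using N.li_le_dim(2)[OF N.fin_dim] by (simp add: N.dim_is_n)
  then show ?thesis using N.rank_card_indpt[OF A S] by simp
qed

lemma outer_function_cmult:
  assumes F: "outer_function F" and c: "norm c = 1"
  shows "outer_function (\<lambda>z. c * F z)"
proof -
  have "c \<noteq> 0" using c by auto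
  then show ?thesis
    using F c by (simp add: outer_function_def hardy_H1_cmult poisson_ext_0 fourier_coeff_cmult norm_mult)
qed

section \<open>Characterization of the extreme points\<close>

(* If I is the Blaschke product with constant c, the normalized canonical factorization of f
   is (I / c) (c F), so the matrix is built from c F. *)
theorem theorem1p1:
  fixes M :: nat and k :: "nat \<Rightarrow> int" and f I F :: "complex \<Rightarrow> complex"
  assumes "strict_mono_on {1..M} k"
    and "\<forall>j\<in>{1..M}. k j > 0"
    and "f \<in> punctured_H1 (k ` {1..M})"
    and "L1_norm f = 1"
    and "canonical_factorization f I F"
  shows "L1_extreme_point f (L1_ball (punctured_H1 (k ` {1..M}))) \<longleftrightarrow>
    (\<exists>c m a. is_blaschke_rep I c m a \<and> m \<le> M \<and>
       vec_space.rank (2 * M) (frakM M k (\<lambda>z. c * F z) m a) = 2 * m)"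
proof -
  let ?X = "punctured_H1 (k ` {1..M})"
  have inner: "inner_function I" and F: "outer_function F"
    and fIF: "AE z in circle_measure. f z = I z * F z"
    using assms(5) by (auto simp: canonical_factorization_def)
  have FH: "F \<in> hardy_H1" using F by (simp add: outer_function_def)
  have I1: "AE z in circle_measure. norm (I z) = 1" using inner by (simp add: inner_function_def)
  have f0: "AE z in circle_measure. f z \<noteq> 0"
    using fIF I1 outer_function_nonzero_AE[OF F] by eventually_elim auto
  have rank: "vec_space.rank (2 * M) (frakM M k (\<lambda>z. c * F z) m a) = 2 * m \<longleftrightarrow>
    (\<forall>h :: complex \<Rightarrow> real. h \<in> borel_measurable circle_measure \<longrightarrow>
      (\<exists>C. AE z in circle_measure. \<bar>h z\<bar> \<le> C) \<longrightarrow> (\<lambda>z. of_real (h z) * f z) \<in> ?X \<longrightarrow>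
      (\<exists>c. AE z in circle_measure. h z = c))"
    if rep: "is_blaschke_rep I c m a" for c m a
  proof (rule frakM_rank_iff_multipliers_const[OF _ _ _ assms(3)])
    show "outer_function (\<lambda>z. c * F z)" "\<forall>j\<in>{1..m}. norm (a j) < 1"
      using rep F by (auto simp: is_blaschke_rep_def outer_function_cmult)
    have "AE z in circle_measure. I z = blaschke c m a z" using rep by (simp add: is_blaschke_rep_def)
    with fIF show "AE z in circle_measure. f z = blaschke 1 m a z * (c * F z)"
      by eventually_elim (simp add: blaschke_def)
  qed
  show ?thesis
  proof
    assume ext: "L1_extreme_point f (L1_ball ?X)"
    have const: "\<exists>c. AE z in circle_measure. h z = c"
      if h: "h \<in> borel_measurable circle_measure" "\<exists>C. AE z in circle_measure. \<bar>h z\<bar> \<le> C"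
        "(\<lambda>z. of_real (h z) * f z) \<in> ?X" for h :: "complex \<Rightarrow> real"
      using L1_extreme_point_imp_multiplier_const[OF assms(3,4) f0 ext h(1) _ h(3)] h(2) by blast
    obtain c m a where rep: "is_blaschke_rep I c m a"
      using multipliers_const_imp_blaschke[OF inner FH fIF assms(3) const] by blast
    then have "vec_space.rank (2 * M) (frakM M k (\<lambda>z. c * F z) m a) = 2 * m"
      using rank const by blast
    moreover from this have "m \<le> M"
      using rank_le_rows[OF frakM_carrier[of M k "\<lambda>z. c * F z" m a]] by simp
    ultimately show "\<exists>c m a. is_blaschke_rep I c m a \<and> m \<le> M \<and>
       vec_space.rank (2 * M) (frakM M k (\<lambda>z. c * F z) m a) = 2 * m"
      using rep by blast
  next
    assume "\<exists>c m a. is_blaschke_rep I c m a \<and> m \<le> M \<and>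
       vec_space.rank (2 * M) (frakM M k (\<lambda>z. c * F z) m a) = 2 * m"
    then obtain c m a where "is_blaschke_rep I c m a"
      "vec_space.rank (2 * M) (frakM M k (\<lambda>z. c * F z) m a) = 2 * m" by blast
    then show "L1_extreme_point f (L1_ball ?X)"
      using rank[of c m a] by (intro L1_extreme_pointI[OF assms(3,4) f0]) blast
  qed
qed

end
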